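(* (In $\mathbf{ZF}$.) For every zero-dimensional $T_1$-space $\mathbf{X}$, the following conditions are all equivalent: (i) the extension $e^{\ast}_{2}\mathbf{X}$ of $\mathbf{X}$ is compact; (ii) the Banaschewski compactification $\beta_0\mathbf{X}$ of $\mathbf{X}$ exists; (iii) there exists a Hausdorff compactification $\alpha\mathbf{X}$ of $\mathbf{X}$ such that $C(\mathbf{X}, \mathbf{2})\subseteq C_{\alpha}(\mathbf{X})$; (iv) the Wallman space $\mathcal{W}(X, \mathcal{CO}(\mathbf{X}))$ is compact.
   Context: The base theory is $\mathbf{ZF}$ (the Axiom of Choice is not assumed). A space is compact if every open cover has a finite subcover. $\mathcal{CO}(\mathbf{X})$ is the family of all clopen subsets of $\mathbf{X}$; $\mathbf{X}$ is zero-dimensional if $\mathcal{CO}(\mathbf{X})$ is a base of $\mathbf{X}$. $C(\mathbf{X},\mathbf{E})$ is the set of continuous maps from $\mathbf{X}$ to $\mathbf{E}$, $C(\mathbf{X})=C(\mathbf{X},\mathbb{R})$, and $\mathbf{2}$ is the discrete space $\{0,1\}$; functions in $C(\mathbf{X},\mathbf{2})$ are also regarded as real-valued. An extension of $\mathbf{X}$ is a pair $\langle\mathbf{Y},h\rangle$ where $h:\mathbf{X}\to\mathbf{Y}$ is a homeomorphic embedding with $h[X]$ dense in $\mathbf{Y}$; it is called compact, Hausdorff, etc. when $\mathbf{Y}$ is. A compactification is a compact extension; a compactification $\langle\alpha\mathbf{X},\alpha\rangle$ is denoted by $\alpha\mathbf{X}$, and $C_{\alpha}(\mathbf{X})=\{f\in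 C(\mathbf{X}): \exists \tilde f\in C(\alpha\mathbf{X})\ \ \tilde f\circ\alpha=f\}$. The evaluation map $e^{\ast}_2:\mathbf{X}\to\mathbf{2}^{C(\mathbf{X},\mathbf{2})}$ is given by $e^{\ast}_2(x)(f)=f(x)$; for a zero-dimensional $T_1$-space it is a homeomorphic embedding, and $e^{\ast}_2\mathbf{X}$ is the extension of $\mathbf{X}$ consisting of the closure of $e^{\ast}_2[X]$ in the product space $\mathbf{2}^{C(\mathbf{X},\mathbf{2})}$ together with the embedding $e^{\ast}_2$. A Banaschewski compactification of a zero-dimensional $T_1$-space $\mathbf{X}$ is a zero-dimensional $T_1$-compactification $\beta_0\mathbf{X}$ of $\mathbf{X}$ such that for every compact zero-dimensional $T_1$-space $\mathbf{K}$ and every $f\in C(\mathbf{X},\mathbf{K})$ there is $\tilde f\in C(\beta_0\mathbf{X},\mathbf{K})$ with $\tilde f\circ\beta_0=f$. A filter in $\mathcal{CO}(\mathbf{X})$ is a non-empty subfamily of $\mathcal{CO}(\mathbf{X})$ not containing $\emptyset$, closed under finite intersections and under supersets belonging to $\mathcal{CO}(\mathbf{X})$; an ultrafilter in $\mathcal{CO}(\mathbf{X})$ is a maximal such filter. $\mathcal{W}(X,\mathcal{CO}(\mathbf{X}))$ is the set of all ultrafilters in $\mathcal{CO}(\mathbf{X})$ with the topology having $\{\,\{p: A\in p\}: A\in\mathcal{CO}(\mathbf{X})\}$ as a base for the closed sets. *)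

theory Defs
  imports Main
begin

text \<open>
  HOL has a choice operator, so the four conditions of the theorem, read for HOL sets and HOL
  topologies, would all be outright true and their equivalence would carry no information. A theorem
  of ZF is therefore rendered as a statement about an arbitrary model of (first-order) ZF: a
  type \<open>'v\<close> with a binary relation satisfying the ZF axioms, the two axiom schemas
  ranging over first-order formulas with parameters. All topological notions below are the internal
  ones of such a model; every quantifier in them ranges over \<open>'v\<close>.
\<close>

section \<open>First-order formulas of the language of set theory\<close>

datatype fm =
    Mem nat nat
  | Eq nat nat
  | Neg fm
  | Conj fm fm
  | All nat fm

primrec sat :: "('v \<Rightarrow> 'v \<Rightarrow> bool) \<Rightarrow> (nat \<Rightarrow> 'v) \<Rightarrow> fm \<Rightarrow> bool" where
  "sat E e (Mem i j) \<longleftrightarrow> E (e i) (e j)"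
| "sat E e (Eq i j) \<longleftrightarrow> e i = e j"
| "sat E e (Neg p) \<longleftrightarrow> \<not> sat E e p"
| "sat E e (Conj p q) \<longleftrightarrow> sat E e p \<and> sat E e q"
| "sat E e (All i p) \<longleftrightarrow> (\<forall>x. sat E (e(i := x)) p)"


section \<open>Set-theoretic vocabulary\<close>

locale set_structure =
  fixes mem :: "'v \<Rightarrow> 'v \<Rightarrow> bool"  (infix "\<in>\<^sub>M" 50)
begin

definition sub :: "'v \<Rightarrow> 'v \<Rightarrow> bool"  (infix "\<subseteq>\<^sub>M" 50) where
  "a \<subseteq>\<^sub>M b \<longleftrightarrow> (\<forall>x. x \<in>\<^sub>M a \<longrightarrow> x \<in>\<^sub>M b)"

text \<open>
  \<open>coll P\<close> is the set-builder term \<open>{x. P x}\<close> of the model. It is meaningful only if \<open>P\<close>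
  defines a set of the model; below it is applied only to first-order definable \<open>P\<close> whose
  extension is a set by the axioms of ZF.
\<close>

definition coll :: "('v \<Rightarrow> bool) \<Rightarrow> 'v" where
  "coll P = (THE y. \<forall>x. x \<in>\<^sub>M y \<longleftrightarrow> P x)"

definition empty :: 'v where
  "empty = coll (\<lambda>x. False)"

definition upair :: "'v \<Rightarrow> 'v \<Rightarrow> 'v" where
  "upair a b = coll (\<lambda>x. x = a \<or> x = b)"

definition pair :: "'v \<Rightarrow> 'v \<Rightarrow> 'v" where
  "pair a b = upair (upair a a) (upair a b)"

definition union :: "'v \<Rightarrow> 'v" where
  "union a = coll (\<lambda>x. \<exists>y. y \<in>\<^sub>M a \<and> x \<in>\<^sub>M y)"

definition inter :: "'v \<Rightarrow> 'v \<Rightarrow> 'v" where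
  "inter a b = coll (\<lambda>x. x \<in>\<^sub>M a \<and> x \<in>\<^sub>M b)"

definition diff :: "'v \<Rightarrow> 'v \<Rightarrow> 'v" where
  "diff a b = coll (\<lambda>x. x \<in>\<^sub>M a \<and> \<not> x \<in>\<^sub>M b)"

definition pow :: "'v \<Rightarrow> 'v" where
  "pow a = coll (\<lambda>x. x \<subseteq>\<^sub>M a)"

definition cart :: "'v \<Rightarrow> 'v \<Rightarrow> 'v" where
  "cart a b = coll (\<lambda>p. \<exists>x y. x \<in>\<^sub>M a \<and> y \<in>\<^sub>M b \<and> p = pair x y)"

definition is_fun :: "'v \<Rightarrow> 'v \<Rightarrow> 'v \<Rightarrow> bool" where
  "is_fun f a b \<longleftrightarrow> f \<subseteq>\<^sub>M cart a b \<and> (\<forall>x. x \<in>\<^sub>M a \<longrightarrow> (\<exists>!y. pair x y \<in>\<^sub>M f))"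

definition funs :: "'v \<Rightarrow> 'v \<Rightarrow> 'v" where
  "funs a b = coll (\<lambda>f. is_fun f a b)"

definition app :: "'v \<Rightarrow> 'v \<Rightarrow> 'v" where
  "app f x = (THE y. pair x y \<in>\<^sub>M f)"

definition lam :: "'v \<Rightarrow> ('v \<Rightarrow> 'v) \<Rightarrow> 'v" where
  "lam a F = coll (\<lambda>p. \<exists>x. x \<in>\<^sub>M a \<and> p = pair x (F x))"

definition comp :: "'v \<Rightarrow> 'v \<Rightarrow> 'v" where
  "comp g f = coll (\<lambda>p. \<exists>x y z. p = pair x z \<and> pair x y \<in>\<^sub>M f \<and> pair y z \<in>\<^sub>M g)"

definition conv :: "'v \<Rightarrow> 'v" where
  "conv f = coll (\<lambda>p. \<exists>x y. p = pair y x \<and> pair x y \<in>\<^sub>M f)"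

definition image :: "'v \<Rightarrow> 'v \<Rightarrow> 'v" where
  "image f a = coll (\<lambda>y. \<exists>x. x \<in>\<^sub>M a \<and> pair x y \<in>\<^sub>M f)"

definition preimage :: "'v \<Rightarrow> 'v \<Rightarrow> 'v" where
  "preimage f b = coll (\<lambda>x. \<exists>y. y \<in>\<^sub>M b \<and> pair x y \<in>\<^sub>M f)"

definition is_bij :: "'v \<Rightarrow> 'v \<Rightarrow> 'v \<Rightarrow> bool" where
  "is_bij f a b \<longleftrightarrow> is_fun f a b \<and> (\<forall>y. y \<in>\<^sub>M b \<longrightarrow> (\<exists>!x. pair x y \<in>\<^sub>M f))"

definition suc :: "'v \<Rightarrow> 'v" where
  "suc n = coll (\<lambda>x. x \<in>\<^sub>M n \<or> x = n)"

definition is_inductive :: "'v \<Rightarrow> bool" where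
  "is_inductive I \<longleftrightarrow> empty \<in>\<^sub>M I \<and> (\<forall>n. n \<in>\<^sub>M I \<longrightarrow> suc n \<in>\<^sub>M I)"

definition omega :: 'v where
  "omega = coll (\<lambda>n. \<forall>I. is_inductive I \<longrightarrow> n \<in>\<^sub>M I)"

text \<open>
  Finiteness is that of the model: equinumerous, in the model, to an element of its \<open>\<omega>\<close>.
\<close>

definition is_finite :: "'v \<Rightarrow> bool" where
  "is_finite a \<longleftrightarrow> (\<exists>n f. n \<in>\<^sub>M omega \<and> is_bij f n a)"

end


section \<open>Models of ZF\<close>

locale ZF = set_structure mem
  for mem :: "'v \<Rightarrow> 'v \<Rightarrow> bool"  (infix "\<in>\<^sub>M" 50) +
  assumes extensionality: "(\<forall>x. x \<in>\<^sub>M a \<longleftrightarrow> x \<in>\<^sub>M b) \<Longrightarrow> a = b"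
    and foundation: "x \<in>\<^sub>M a \<Longrightarrow> \<exists>y. y \<in>\<^sub>M a \<and> \<not> (\<exists>z. z \<in>\<^sub>M y \<and> z \<in>\<^sub>M a)"
    and pairing: "\<exists>c. \<forall>x. x \<in>\<^sub>M c \<longleftrightarrow> x = a \<or> x = b"
    and union_set: "\<exists>u. \<forall>x. x \<in>\<^sub>M u \<longleftrightarrow> (\<exists>y. y \<in>\<^sub>M a \<and> x \<in>\<^sub>M y)"
    and power_set: "\<exists>p. \<forall>x. x \<in>\<^sub>M p \<longleftrightarrow> (\<forall>z. z \<in>\<^sub>M x \<longrightarrow> z \<in>\<^sub>M a)"
    and infinity: "\<exists>I. (\<exists>o'. o' \<in>\<^sub>M I \<and> (\<forall>x. \<not> x \<in>\<^sub>M o'))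
        \<and> (\<forall>n. n \<in>\<^sub>M I \<longrightarrow> (\<exists>s. s \<in>\<^sub>M I \<and> (\<forall>x. x \<in>\<^sub>M s \<longleftrightarrow> x \<in>\<^sub>M n \<or> x = n)))"
    and separation: "\<exists>b. \<forall>x. x \<in>\<^sub>M b \<longleftrightarrow> x \<in>\<^sub>M a \<and> sat mem (e(i := x)) \<phi>"
    and replacement: "i \<noteq> j \<Longrightarrow>
        (\<forall>x y z. x \<in>\<^sub>M a \<and> sat mem (e(i := x, j := y)) \<psi> \<and> sat mem (e(i := x, j := z)) \<psi> \<longrightarrow> y = z) \<Longrightarrow>
        \<exists>b. \<forall>y. y \<in>\<^sub>M b \<longleftrightarrow> (\<exists>x. x \<in>\<^sub>M a \<and> sat mem (e(i := x, j := y)) \<psi>)"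


context set_structure
begin

section \<open>Topological spaces\<close>

text \<open>A space is given by its carrier \<open>X\<close> and its family \<open>T\<close> of open sets.\<close>

definition top_space :: "'v \<Rightarrow> 'v \<Rightarrow> bool" where
  "top_space X T \<longleftrightarrow> T \<subseteq>\<^sub>M pow X \<and> empty \<in>\<^sub>M T \<and> X \<in>\<^sub>M T
     \<and> (\<forall>G. G \<subseteq>\<^sub>M T \<longrightarrow> union G \<in>\<^sub>M T)
     \<and> (\<forall>U V. U \<in>\<^sub>M T \<and> V \<in>\<^sub>M T \<longrightarrow> inter U V \<in>\<^sub>M T)"

definition subtop :: "'v \<Rightarrow> 'v \<Rightarrow> 'v" where
  "subtop T A = coll (\<lambda>W. \<exists>U. U \<in>\<^sub>M T \<and> W = inter U A)"

definition closure :: "'v \<Rightarrow> 'v \<Rightarrow> 'v \<Rightarrow> 'v" where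
  "closure X T A = coll (\<lambda>x. x \<in>\<^sub>M X \<and>
     (\<forall>U. U \<in>\<^sub>M T \<and> x \<in>\<^sub>M U \<longrightarrow> (\<exists>a. a \<in>\<^sub>M A \<and> a \<in>\<^sub>M U)))"

definition compact :: "'v \<Rightarrow> 'v \<Rightarrow> bool" where
  "compact X T \<longleftrightarrow> (\<forall>G. G \<subseteq>\<^sub>M T \<and> union G = X \<longrightarrow>
     (\<exists>F. F \<subseteq>\<^sub>M G \<and> is_finite F \<and> union F = X))"

definition T1 :: "'v \<Rightarrow> 'v \<Rightarrow> bool" where
  "T1 X T \<longleftrightarrow> (\<forall>x y. x \<in>\<^sub>M X \<and> y \<in>\<^sub>M X \<and> x \<noteq> y \<longrightarrow>
     (\<exists>U. U \<in>\<^sub>M T \<and> x \<in>\<^sub>M U \<and> \<not> y \<in>\<^sub>M U))"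

definition hausdorff :: "'v \<Rightarrow> 'v \<Rightarrow> bool" where
  "hausdorff X T \<longleftrightarrow> (\<forall>x y. x \<in>\<^sub>M X \<and> y \<in>\<^sub>M X \<and> x \<noteq> y \<longrightarrow>
     (\<exists>U V. U \<in>\<^sub>M T \<and> V \<in>\<^sub>M T \<and> x \<in>\<^sub>M U \<and> y \<in>\<^sub>M V \<and> inter U V = empty))"

definition CO :: "'v \<Rightarrow> 'v \<Rightarrow> 'v" where
  "CO X T = coll (\<lambda>A. A \<in>\<^sub>M T \<and> diff X A \<in>\<^sub>M T)"

definition is_base :: "'v \<Rightarrow> 'v \<Rightarrow> bool" where
  "is_base B T \<longleftrightarrow> B \<subseteq>\<^sub>M T \<and> (\<forall>U. U \<in>\<^sub>M T \<longrightarrow> (\<exists>G. G \<subseteq>\<^sub>M B \<and> U = union G))"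

definition zero_dim_T1_space :: "'v \<Rightarrow> 'v \<Rightarrow> bool" where
  "zero_dim_T1_space X T \<longleftrightarrow> top_space X T \<and> is_base (CO X T) T \<and> T1 X T"

definition continuous :: "'v \<Rightarrow> 'v \<Rightarrow> 'v \<Rightarrow> 'v \<Rightarrow> 'v \<Rightarrow> bool" where
  "continuous X T Y S f \<longleftrightarrow> is_fun f X Y \<and> (\<forall>V. V \<in>\<^sub>M S \<longrightarrow> preimage f V \<in>\<^sub>M T)"

definition Cont :: "'v \<Rightarrow> 'v \<Rightarrow> 'v \<Rightarrow> 'v \<Rightarrow> 'v" where
  "Cont X T Y S = coll (\<lambda>f. continuous X T Y S f)"

definition homeomorphism :: "'v \<Rightarrow> 'v \<Rightarrow> 'v \<Rightarrow> 'v \<Rightarrow> 'v \<Rightarrow> bool" where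
  "homeomorphism X T Y S f \<longleftrightarrow>
     is_bij f X Y \<and> continuous X T Y S f \<and> continuous Y S X T (conv f)"

definition embedding :: "'v \<Rightarrow> 'v \<Rightarrow> 'v \<Rightarrow> 'v \<Rightarrow> 'v \<Rightarrow> bool" where
  "embedding X T Y S h \<longleftrightarrow>
     is_fun h X Y \<and> homeomorphism X T (image h X) (subtop S (image h X)) h"


section \<open>Extensions and compactifications\<close>

definition extension :: "'v \<Rightarrow> 'v \<Rightarrow> 'v \<Rightarrow> 'v \<Rightarrow> 'v \<Rightarrow> bool" where
  "extension X T Y S h \<longleftrightarrow>
     top_space Y S \<and> embedding X T Y S h \<and> closure Y S (image h X) = Y"

definition compactification :: "'v \<Rightarrow> 'v \<Rightarrow> 'v \<Rightarrow> 'v \<Rightarrow> 'v \<Rightarrow> bool" where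
  "compactification X T Y S h \<longleftrightarrow> extension X T Y S h \<and> compact Y S"

definition banaschewski :: "'v \<Rightarrow> 'v \<Rightarrow> 'v \<Rightarrow> 'v \<Rightarrow> 'v \<Rightarrow> bool" where
  "banaschewski X T Y S h \<longleftrightarrow> compactification X T Y S h \<and> zero_dim_T1_space Y S \<and>
     (\<forall>K Q f. zero_dim_T1_space K Q \<and> compact K Q \<and> f \<in>\<^sub>M Cont X T K Q \<longrightarrow>
        (\<exists>g. g \<in>\<^sub>M Cont Y S K Q \<and> comp g h = f))"


section \<open>The extension given by evaluation on two-valued maps\<close>

definition one :: 'v where
  "one = suc empty"

definition two :: 'v where
  "two = upair empty one"

definition C2 :: "'v \<Rightarrow> 'v \<Rightarrow> 'v" where
  "C2 X T = Cont X T two (pow two)"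

text \<open>
  The product topology on \<open>Y\<^sup>J\<close>: its basic open sets are the boxes \<open>\<Prod>j\<in>J. B j\<close> with each \<open>B j\<close> open
  and \<open>B j = Y\<close> for all but finitely many \<open>j\<close>.
\<close>

definition box :: "'v \<Rightarrow> 'v \<Rightarrow> 'v \<Rightarrow> 'v" where
  "box J Y B = coll (\<lambda>q. q \<in>\<^sub>M funs J Y \<and> (\<forall>j. j \<in>\<^sub>M J \<longrightarrow> app q j \<in>\<^sub>M app B j))"

definition power_top :: "'v \<Rightarrow> 'v \<Rightarrow> 'v \<Rightarrow> 'v" where
  "power_top J Y S = coll (\<lambda>U. U \<subseteq>\<^sub>M funs J Y \<and> (\<forall>p. p \<in>\<^sub>M U \<longrightarrow>
     (\<exists>B. B \<in>\<^sub>M funs J S \<and> is_finite (coll (\<lambda>j. j \<in>\<^sub>M J \<and> app B j \<noteq> Y))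
        \<and> p \<in>\<^sub>M box J Y B \<and> box J Y B \<subseteq>\<^sub>M U)))"

definition e2 :: "'v \<Rightarrow> 'v \<Rightarrow> 'v" where
  "e2 X T = lam X (\<lambda>x. lam (C2 X T) (\<lambda>f. app f x))"

definition e2_carrier :: "'v \<Rightarrow> 'v \<Rightarrow> 'v" where
  "e2_carrier X T =
     closure (funs (C2 X T) two) (power_top (C2 X T) two (pow two)) (image (e2 X T) X)"

definition e2_top :: "'v \<Rightarrow> 'v \<Rightarrow> 'v" where
  "e2_top X T = subtop (power_top (C2 X T) two (pow two)) (e2_carrier X T)"


section \<open>The real line\<close>

text \<open>
  \<open>(R, p, m, z, u, l)\<close> is a Dedekind complete ordered field of the model, with addition \<open>p\<close>,
  multiplication \<open>m\<close>, zero \<open>z\<close>, unit \<open>u\<close> and (graph of) the order \<open>l\<close>. By a theorem of ZF such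
  a structure exists and is unique up to a unique isomorphism; it is the real line of the model.
\<close>

definition real_field :: "'v \<Rightarrow> 'v \<Rightarrow> 'v \<Rightarrow> 'v \<Rightarrow> 'v \<Rightarrow> 'v \<Rightarrow> bool" where
  "real_field R p m z u l \<longleftrightarrow>
     (let add = (\<lambda>x y. app p (pair x y)); mul = (\<lambda>x y. app m (pair x y));
          le = (\<lambda>x y. pair x y \<in>\<^sub>M l)
      in is_fun p (cart R R) R \<and> is_fun m (cart R R) R \<and> l \<subseteq>\<^sub>M cart R R
       \<and> z \<in>\<^sub>M R \<and> u \<in>\<^sub>M R \<and> z \<noteq> u
       \<and> (\<forall>a b c. a \<in>\<^sub>M R \<and> b \<in>\<^sub>M R \<and> c \<in>\<^sub>M R \<longrightarrow>
            add (add a b) c = add a (add b c) \<and> add a b = add b a \<and> add z a = a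
          \<and> mul (mul a b) c = mul a (mul b c) \<and> mul a b = mul b a \<and> mul u a = a
          \<and> mul a (add b c) = add (mul a b) (mul a c)
          \<and> (\<exists>d. d \<in>\<^sub>M R \<and> add a d = z)
          \<and> (a \<noteq> z \<longrightarrow> (\<exists>d. d \<in>\<^sub>M R \<and> mul a d = u))
          \<and> (le a b \<or> le b a) \<and> (le a b \<and> le b a \<longrightarrow> a = b) \<and> (le a b \<and> le b c \<longrightarrow> le a c)
          \<and> (le a b \<longrightarrow> le (add a c) (add b c))
          \<and> (le z a \<and> le z b \<longrightarrow> le z (mul a b)))
       \<and> (\<forall>A. A \<subseteq>\<^sub>M R \<and> A \<noteq> empty \<and> (\<exists>b. b \<in>\<^sub>M R \<and> (\<forall>a. a \<in>\<^sub>M A \<longrightarrow> le a b)) \<longrightarrow>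
            (\<exists>s. s \<in>\<^sub>M R \<and> (\<forall>a. a \<in>\<^sub>M A \<longrightarrow> le a s)
               \<and> (\<forall>b. b \<in>\<^sub>M R \<and> (\<forall>a. a \<in>\<^sub>M A \<longrightarrow> le a b) \<longrightarrow> le s b))))"

definition real_top :: "'v \<Rightarrow> 'v \<Rightarrow> 'v" where
  "real_top R l = (let lt = (\<lambda>x y. pair x y \<in>\<^sub>M l \<and> x \<noteq> y) in
     coll (\<lambda>U. U \<subseteq>\<^sub>M R \<and> (\<forall>x. x \<in>\<^sub>M U \<longrightarrow>
       (\<exists>a b. a \<in>\<^sub>M R \<and> b \<in>\<^sub>M R \<and> lt a x \<and> lt x b
          \<and> (\<forall>y. y \<in>\<^sub>M R \<and> lt a y \<and> lt y b \<longrightarrow> y \<in>\<^sub>M U)))))"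

text \<open>The inclusion of \<open>2 = {0, 1}\<close> in the real line, by which two-valued maps are real-valued.\<close>

definition two_to_real :: "'v \<Rightarrow> 'v \<Rightarrow> 'v" where
  "two_to_real z u = upair (pair empty z) (pair one u)"

definition C_alpha :: "'v \<Rightarrow> 'v \<Rightarrow> 'v \<Rightarrow> 'v \<Rightarrow> 'v \<Rightarrow> 'v \<Rightarrow> 'v \<Rightarrow> 'v" where
  "C_alpha R l X T Y S h = coll (\<lambda>f. f \<in>\<^sub>M Cont X T R (real_top R l)
     \<and> (\<exists>g. g \<in>\<^sub>M Cont Y S R (real_top R l) \<and> comp g h = f))"


section \<open>The Wallman space of the clopen algebra\<close>

definition CO_filter :: "'v \<Rightarrow> 'v \<Rightarrow> 'v \<Rightarrow> bool" where
  "CO_filter X T p \<longleftrightarrow> p \<subseteq>\<^sub>M CO X T \<and> p \<noteq> empty \<and> \<not> empty \<in>\<^sub>M p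
     \<and> (\<forall>A B. A \<in>\<^sub>M p \<and> B \<in>\<^sub>M p \<longrightarrow> inter A B \<in>\<^sub>M p)
     \<and> (\<forall>A B. A \<in>\<^sub>M p \<and> B \<in>\<^sub>M CO X T \<and> A \<subseteq>\<^sub>M B \<longrightarrow> B \<in>\<^sub>M p)"

definition CO_ultrafilter :: "'v \<Rightarrow> 'v \<Rightarrow> 'v \<Rightarrow> bool" where
  "CO_ultrafilter X T p \<longleftrightarrow> CO_filter X T p
     \<and> (\<forall>q. CO_filter X T q \<and> p \<subseteq>\<^sub>M q \<longrightarrow> q = p)"

definition wallman :: "'v \<Rightarrow> 'v \<Rightarrow> 'v" where
  "wallman X T = coll (\<lambda>p. CO_ultrafilter X T p)"

definition wallman_closed_base :: "'v \<Rightarrow> 'v \<Rightarrow> 'v" where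
  "wallman_closed_base X T = coll (\<lambda>D. \<exists>A. A \<in>\<^sub>M CO X T
     \<and> D = coll (\<lambda>p. p \<in>\<^sub>M wallman X T \<and> A \<in>\<^sub>M p))"

text \<open>
  A set is open iff its complement is an intersection of members of the closed base; the empty
  intersection is the whole space.
\<close>

definition wallman_top :: "'v \<Rightarrow> 'v \<Rightarrow> 'v" where
  "wallman_top X T = coll (\<lambda>U. U \<subseteq>\<^sub>M wallman X T \<and>
     (\<exists>G. G \<subseteq>\<^sub>M wallman_closed_base X T \<and>
        diff (wallman X T) U = coll (\<lambda>p. p \<in>\<^sub>M wallman X T \<and> (\<forall>D. D \<in>\<^sub>M G \<longrightarrow> p \<in>\<^sub>M D))))"

end

end

theory Submission
  imports Defs
begin

text \<open>
Each of the four conditions is equivalent to the Boolean prime ideal theorem for the algebra of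
clopen subsets of \<open>X\<close>, in the form \<open>ultrafilter_existence\<close>: a family of clopen sets without a
finite subcover of \<open>X\<close> is avoided by some ultrafilter of clopen sets.

The bridge between compactness and ultrafilters is a continuous map \<open>h\<close> of \<open>X\<close> onto a dense subset
of a space \<open>Y\<close> such that every clopen \<open>A \<subseteq> X\<close> is \<open>h\<^sup>-\<^sup>1[V]\<close> for some clopen \<open>V \<subseteq> Y\<close> (the locale
\<open>clopen_lifting\<close>). By density \<open>V\<close> is determined by \<open>A\<close>, lifting respects inclusions and
complements, and a finite clopen cover of \<open>X\<close> lifts to a cover of \<open>Y\<close> (\<open>cover_lift\<close>).

If \<open>Y\<close> is compact and \<open>G\<close> has no finite subcover of \<open>X\<close>, the lifts of the members of \<open>G\<close> do not
cover \<open>Y\<close>; the clopen sets whose lifts contain a missed point form an ultrafilter avoiding \<open>G\<close>.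
Conversely, if the clopen sets form a base of \<open>Y\<close> and every ultrafilter arises in this way from a
point of \<open>Y\<close>, then \<open>ultrafilter_existence\<close> makes \<open>Y\<close> compact. The Wallman space and \<open>e\<^sub>2\<^sup>*X\<close> both
meet all these requirements, so (i) and (iv) are equivalent to \<open>ultrafilter_existence\<close>
(\<open>e2_compact_iff\<close>, \<open>wallman_compact_iff\<close>).

A compact zero-dimensional \<open>T\<^sub>1\<close>-space \<open>Y\<close> with such a map is a Banaschewski compactification: if \<open>K\<close>
is a compact zero-dimensional \<open>T\<^sub>1\<close>-space and \<open>f : X \<rightarrow> K\<close> is continuous, the extension of \<open>f\<close> sends \<open>y\<close> to the
unique \<open>k\<close> such that \<open>y\<close> lies in the lift of \<open>f\<^sup>-\<^sup>1[D]\<close> for all clopen \<open>D\<close> containing \<open>k\<close>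
(\<open>extend_continuous\<close>). Hence (i) implies (ii). A Banaschewski compactification extends the maps into
\<open>2\<close>, which gives (iii). Under (iii), the extension of a characteristic function takes only the
values 0 and 1, by density, and so splits the compactification into two clopen pieces; thus
\<open>clopen_lifting\<close> holds and (iii) implies \<open>ultrafilter_existence\<close>. Choices are made only from finite
families (\<open>finite_collection\<close>) or where the object is unique, so no form of choice is needed.

All of this takes place inside a model of ZF, where a class of elements is a set only if an axiom
says so. Nearly every set below comes from the separation schema, whose use requires a first-order
formula. The predicate \<open>definable\<close> says that such a formula with parameters exists; it is closed
under the logical operations and under substitution of definable terms, so the rules
\<open>definable_intros\<close> establish it by decomposing the text of a predicate.
\<close>

section \<open>Definable classes of a model\<close>

text \<open>
Quantified variables are renamed together with the free ones, so for injective \<open>r\<close> nothing is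
captured.
\<close>

primrec rename :: "(nat \<Rightarrow> nat) \<Rightarrow> fm \<Rightarrow> fm" where
  "rename r (Mem i j) = Mem (r i) (r j)"
| "rename r (Eq i j) = Eq (r i) (r j)"
| "rename r (Neg p) = Neg (rename r p)"
| "rename r (Conj p q) = Conj (rename r p) (rename r q)"
| "rename r (All i p) = All (r i) (rename r p)"

lemma sat_rename: "inj r \<Longrightarrow> sat E e (rename r p) \<longleftrightarrow> sat E (\<lambda>n. e (r n)) p"
proof (induction p arbitrary: e)
  case (All i p)
  have "(\<lambda>n. (e(r i := x)) (r n)) = (\<lambda>n. e (r n))(i := x)" for x
    using All.prems by (auto simp: inj_eq)
  then show ?case using All by simp
qed auto

text \<open>
An environment \<open>e\<close> and a sequence \<open>c\<close> of parameters share the variables of one formula: the even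
variables belong to \<open>e\<close>, the odd ones to \<open>c\<close>.
\<close>

definition interleave :: "(nat \<Rightarrow> 'v) \<Rightarrow> (nat \<Rightarrow> 'v) \<Rightarrow> nat \<Rightarrow> 'v" where
  "interleave e c n = (if even n then e (n div 2) else c (n div 2))"

text \<open>
Used with \<open>intro\<close>, these rules reduce definability of a predicate to that of its parts, down to
variables and parameters.
\<close>

named_theorems definable_intros

context set_structure
begin

text \<open>
Definability with parameters, for predicates of an environment. Variables are used in de Bruijn
style: under a binder, \<open>e 0\<close> is the bound variable and \<open>e (Suc n)\<close> is the variable \<open>n\<close> of the context.
\<close>

definition definable :: "((nat \<Rightarrow> 'v) \<Rightarrow> bool) \<Rightarrow> bool" where
  "definable P \<longleftrightarrow> (\<exists>\<phi> c. \<forall>e. P e \<longleftrightarrow> sat mem (interleave e c) \<phi>)"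

text \<open>
A class function is definable if its graph is. The value of the function is put into variable 0,
and the arguments are shifted to make room for it.
\<close>

definition definable_term :: "((nat \<Rightarrow> 'v) \<Rightarrow> 'v) \<Rightarrow> bool" where
  "definable_term t \<longleftrightarrow> definable (\<lambda>e. e 0 = t (\<lambda>n. e (Suc n)))"

lemma definable_not [definable_intros]: "definable P \<Longrightarrow> definable (\<lambda>e. \<not> P e)"
  unfolding definable_def by (metis sat.simps(3))

lemma definable_rename_inj:
  assumes "definable P" "inj r"
  shows "definable (\<lambda>e. P (\<lambda>n. e (r n)))"
proof -
  obtain \<phi> c where \<phi>: "\<And>e. P e \<longleftrightarrow> sat mem (interleave e c) \<phi>"
    using assms(1) unfolding definable_def by blast
  define s where "s n = (if even n then 2 * r (n div 2) else n)" for n :: nat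
  have "inj s"
  proof (rule injI)
    fix m n assume eq: "s m = s n"
    have "even (s m) \<longleftrightarrow> even m" "even (s n) \<longleftrightarrow> even n" by (auto simp: s_def)
    then have parity: "even m \<longleftrightarrow> even n" using eq by simp
    show "m = n"
    proof (cases "even m")
      case True
      then have "m div 2 = n div 2" using eq parity assms(2) by (simp add: s_def inj_eq)
      then show ?thesis using True parity by (metis dvd_mult_div_cancel)
    next
      case False
      then show ?thesis using eq parity by (simp add: s_def)
    qed
  qed
  moreover have "(\<lambda>n. interleave e c (s n)) = interleave (\<lambda>n. e (r n)) c" for e
    by (auto simp: interleave_def s_def)
  ultimately have "P (\<lambda>n. e (r n)) \<longleftrightarrow> sat mem (interleave e c) (rename s \<phi>)" for e
    by (simp add: sat_rename \<phi>)
  then show ?thesis unfolding definable_def by blast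
qed

text \<open>
The parameters of the two formulas are interleaved in turn, and each formula is renamed to read its
own half.
\<close>

lemma definable_conj [definable_intros]:
  assumes "definable P" "definable Q"
  shows "definable (\<lambda>e. P e \<and> Q e)"
proof -
  obtain \<phi> c where \<phi>: "\<And>e. P e \<longleftrightarrow> sat mem (interleave e c) \<phi>"
    using assms(1) unfolding definable_def by blast
  obtain \<psi> d where \<psi>: "\<And>e. Q e \<longleftrightarrow> sat mem (interleave e d) \<psi>"
    using assms(2) unfolding definable_def by blast
  define r where "r n = (if even n then n else 2 * (2 * (n div 2)) + 1)" for n :: nat
  define s where "s n = (if even n then n else 2 * (2 * (n div 2) + 1) + 1)" for n :: nat
  have "inj r"
    by (rule inj_on_inverseI[where g = "\<lambda>n. if even n then n else 2 * (n div 2 div 2) + 1"])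
      (auto simp: r_def)
  moreover have "inj s"
    by (rule inj_on_inverseI[where g = "\<lambda>n. if even n then n else 2 * (n div 2 div 2) + 1"])
      (auto simp: s_def)
  moreover have "(\<lambda>n. interleave e (interleave c d) (r n)) = interleave e c" for e
    by (rule ext) (auto simp: interleave_def r_def elim: oddE)
  moreover have "(\<lambda>n. interleave e (interleave c d) (s n)) = interleave e d" for e
    by (rule ext) (auto simp: interleave_def s_def elim: oddE)
  ultimately have "P e \<and> Q e \<longleftrightarrow>
      sat mem (interleave e (interleave c d)) (Conj (rename r \<phi>) (rename s \<psi>))" for e
    by (simp add: sat_rename \<phi> \<psi>)
  then show ?thesis unfolding definable_def by blast
qed

lemma definable_all [definable_intros]:
  assumes "definable (\<lambda>e. Q (\<lambda>n. e (Suc n)) (e 0))"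
  shows "definable (\<lambda>e. \<forall>x. Q e x)"
proof -
  obtain \<phi> c where \<phi>: "\<And>e. Q (\<lambda>n. e (Suc n)) (e 0) \<longleftrightarrow> sat mem (interleave e c) \<phi>"
    using assms unfolding definable_def by blast
  \<comment> \<open>the parameters move up by one place and free the variable 1 for the quantifier\<close>
  define r where "r n = (if odd n then n + 2 else if n = 0 then 1 else n - 2)" for n :: nat
  have inj: "inj r"
    by (rule inj_on_inverseI[where g = "\<lambda>n. if n = 1 then 0 else if odd n then n - 2 else n + 2"])
      (auto simp: r_def elim!: oddE, presburger)
  define d where "d = case_nat (c 0) c"
  have 1: "(\<lambda>n. ((interleave e d)(1 := x)) (r n)) = interleave (case_nat x e) c" for e x
  proof
    fix n
    consider k where "n = 2 * k + 1" | "n = 0" | k where "n = 2 * Suc k"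
    proof (cases "even n")
      case True
      then show ?thesis using that(2,3) by (cases "n div 2") auto
    next
      case False
      then show ?thesis using that(1) by (rule oddE)
    qed
    then show "((interleave e d)(1 := x)) (r n) = interleave (case_nat x e) c n"
      by cases (auto simp: interleave_def r_def d_def)
  qed
  have "(\<forall>x. Q e x) \<longleftrightarrow> sat mem (interleave e d) (All 1 (rename r \<phi>))" for e
  proof -
    have "sat mem ((interleave e d)(1 := x)) (rename r \<phi>) \<longleftrightarrow> Q e x" for x
      using \<phi>[of "case_nat x e"] unfolding sat_rename[OF inj] 1 by simp
    then show ?thesis by simp
  qed
  then show ?thesis unfolding definable_def by blast
qed

lemma definable_const [definable_intros]: "definable (\<lambda>e. Q)"
proof (cases Q)
  case True
  then have "\<forall>e. Q \<longleftrightarrow> sat mem (interleave e c) (Eq 0 0)" for c by simp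
  then show ?thesis unfolding definable_def by blast
next
  case False
  then have "\<forall>e. Q \<longleftrightarrow> sat mem (interleave e c) (Neg (Eq 0 0))" for c by simp
  then show ?thesis unfolding definable_def by blast
qed

lemma definable_disj [definable_intros]:
  assumes "definable P" "definable Q"
  shows "definable (\<lambda>e. P e \<or> Q e)"
proof -
  have "definable (\<lambda>e. \<not> (\<not> P e \<and> \<not> Q e))"
    by (intro definable_not definable_conj assms)
  then show ?thesis by simp
qed

lemma definable_imp [definable_intros]: "definable P \<Longrightarrow> definable Q \<Longrightarrow> definable (\<lambda>e. P e \<longrightarrow> Q e)"
  unfolding imp_conv_disj by (intro definable_disj definable_not)

lemma definable_iff [definable_intros]: "definable P \<Longrightarrow> definable Q \<Longrightarrow> definable (\<lambda>e. P e \<longleftrightarrow> Q e)"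
  unfolding iff_conv_conj_imp by (intro definable_conj definable_imp)

lemma definable_ex [definable_intros]:
  assumes "definable (\<lambda>e. Q (\<lambda>n. e (Suc n)) (e 0))"
  shows "definable (\<lambda>e. \<exists>x. Q e x)"
proof -
  have "definable (\<lambda>e. \<not> (\<forall>x. \<not> Q e x))"
    by (intro definable_not definable_all assms)
  then show ?thesis by simp
qed

text \<open>
This renaming inserts a fresh variable directly after variable 0.
\<close>

lemma inj_lift: "inj (case_nat 0 (\<lambda>n. Suc (Suc n)))"
  by (auto simp: inj_def split: nat.splits)

lemma definable_term_var [definable_intros]: "definable_term (\<lambda>e. e k)"
proof -
  have "\<forall>e. (e 0 = e (Suc k)) \<longleftrightarrow> sat mem (interleave e c) (Eq 0 (2 * Suc k))" for c
    by (simp add: interleave_def)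
  then show ?thesis unfolding definable_def definable_term_def by blast
qed

lemma definable_term_const [definable_intros]: "definable_term (\<lambda>e. a)"
proof -
  have "\<forall>e. (e 0 = a) \<longleftrightarrow> sat mem (interleave e (\<lambda>n. a)) (Eq 0 1)"
    by (simp add: interleave_def)
  then show ?thesis unfolding definable_def definable_term_def by blast
qed

lemma definable_term_shift:
  assumes "definable_term t"
  shows "definable_term (\<lambda>e. t (\<lambda>n. e (Suc n)))"
  using definable_rename_inj[OF assms[unfolded definable_term_def] inj_lift]
  by (simp add: definable_term_def)

text \<open>
Substitution for variable 0 is expressed by the quantifier in \<open>\<exists>x. x = t \<and> P x\<close>, since the language
has no terms besides variables. The versions with several arguments below iterate this.
\<close>

lemma definable_subst:
  assumes "definable P" "definable_term t"
  shows "definable (\<lambda>e. P (case_nat (t e) e))"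
proof -
  have "case_nat (e 0) (\<lambda>n. e (Suc n)) = e" for e :: "nat \<Rightarrow> 'v"
    by (auto split: nat.split)
  then have "definable (\<lambda>e. \<exists>x. x = t e \<and> P (case_nat x e))"
    using assms by (intro definable_ex definable_conj) (simp_all add: definable_term_def)
  then show ?thesis by simp
qed

lemma definable_subst1:
  assumes "definable (\<lambda>e. P (e 0))" "definable_term t"
  shows "definable (\<lambda>e. P (t e))"
  using definable_subst[of "\<lambda>e. P (e 0)", OF assms] by simp

lemma definable_subst2:
  assumes "definable (\<lambda>e. P (e 0) (e (Suc 0)))" "definable_term t" "definable_term u"
  shows "definable (\<lambda>e. P (t e) (u e))"
proof -
  have "definable (\<lambda>e. P (t (\<lambda>n. e (Suc n))) (e 0))"
    using definable_subst[of "\<lambda>e. P (e 0) (e (Suc 0))" "\<lambda>e. t (\<lambda>n. e (Suc n))"]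
      assms(1) definable_term_shift[OF assms(2)] by simp
  then show ?thesis
    using definable_subst[of "\<lambda>e. P (t (\<lambda>n. e (Suc n))) (e 0)" u] assms(3) by simp
qed

lemma definable_subst3:
  assumes "definable (\<lambda>e. P (e 0) (e (Suc 0)) (e (Suc (Suc 0))))"
    and "definable_term t" "definable_term u" "definable_term v"
  shows "definable (\<lambda>e. P (t e) (u e) (v e))"
proof -
  have "definable_term (\<lambda>e. t (\<lambda>n. e (Suc (Suc n))))"
    using definable_term_shift[OF definable_term_shift[OF assms(2)]] by simp
  then have "definable (\<lambda>e. P (t (\<lambda>n. e (Suc (Suc n)))) (e 0) (e (Suc 0)))"
    using definable_subst[of "\<lambda>e. P (e 0) (e (Suc 0)) (e (Suc (Suc 0)))" "\<lambda>e. t (\<lambda>n. e (Suc (Suc n)))"]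
      assms(1) by simp
  then have "definable (\<lambda>e. P (t (\<lambda>n. e (Suc n))) (u (\<lambda>n. e (Suc n))) (e 0))"
    using definable_subst[of "\<lambda>e. P (t (\<lambda>n. e (Suc (Suc n)))) (e 0) (e (Suc 0))" "\<lambda>e. u (\<lambda>n. e (Suc n))"]
      definable_term_shift[OF assms(3)] by simp
  then show ?thesis
    using definable_subst[of "\<lambda>e. P (t (\<lambda>n. e (Suc n))) (u (\<lambda>n. e (Suc n))) (e 0)" v] assms(4)
    by simp
qed

lemma definable_mem [definable_intros]:
  "definable_term t \<Longrightarrow> definable_term u \<Longrightarrow> definable (\<lambda>e. t e \<in>\<^sub>M u e)"
proof (rule definable_subst2)
  have "\<forall>e. (e 0 \<in>\<^sub>M e (Suc 0)) \<longleftrightarrow> sat mem (interleave e c) (Mem 0 2)" for c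
    by (simp add: interleave_def)
  then show "definable (\<lambda>e. e 0 \<in>\<^sub>M e (Suc 0))" unfolding definable_def by blast
qed

lemma definable_eq [definable_intros]:
  "definable_term t \<Longrightarrow> definable_term u \<Longrightarrow> definable (\<lambda>e. t e = u e)"
proof (rule definable_subst2)
  have "\<forall>e. (e 0 = e (Suc 0)) \<longleftrightarrow> sat mem (interleave e c) (Eq 0 2)" for c
    by (simp add: interleave_def)
  then show "definable (\<lambda>e. e 0 = e (Suc 0))" unfolding definable_def by blast
qed

lemma definable_ex1 [definable_intros]:
  assumes "definable (\<lambda>e. Q (\<lambda>n. e (Suc n)) (e 0))"
  shows "definable (\<lambda>e. \<exists>!x. Q e x)"
proof -
  have "definable (\<lambda>e. Q (\<lambda>n. e (Suc (Suc n))) (e 0))"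
    using definable_rename_inj[OF assms inj_lift] by simp
  then show ?thesis
    unfolding Ex1_def by (intro definable_intros assms)
qed

lemma definable_term_subst1:
  assumes "definable_term (\<lambda>e. F (e 0))" "definable_term t"
  shows "definable_term (\<lambda>e. F (t e))"
  using definable_subst2[of "\<lambda>x y. x = F y", OF _ definable_term_var[of 0] definable_term_shift[OF assms(2)]]
    assms(1) by (simp add: definable_term_def)

lemma definable_term_subst2:
  assumes "definable_term (\<lambda>e. F (e 0) (e (Suc 0)))" "definable_term t" "definable_term u"
  shows "definable_term (\<lambda>e. F (t e) (u e))"
  using definable_subst3[of "\<lambda>x y z. x = F y z", OF _ definable_term_var[of 0]
      definable_term_shift[OF assms(2)] definable_term_shift[OF assms(3)]]
    assms(1) by (simp add: definable_term_def)

lemma definable_sub [definable_intros]: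
  "definable_term t \<Longrightarrow> definable_term u \<Longrightarrow> definable (\<lambda>e. t e \<subseteq>\<^sub>M u e)"
  by (rule definable_subst2)
    (unfold sub_def, intro definable_all definable_imp definable_mem definable_term_var)

end

section \<open>Elementary set theory inside the model\<close>

context ZF
begin

lemma ext_iff: "a = b \<longleftrightarrow> (\<forall>x. x \<in>\<^sub>M a \<longleftrightarrow> x \<in>\<^sub>M b)"
  using extensionality by blast

text \<open>
The term \<open>coll P\<close> is a definite description, so its membership law depends on \<open>P\<close> defining a set. For the
set operations below, that comes from an axiom or from separation within a known bound.
\<close>

lemma mem_coll_ex:
  assumes "\<exists>y. \<forall>x. x \<in>\<^sub>M y \<longleftrightarrow> P x"
  shows "x \<in>\<^sub>M coll P \<longleftrightarrow> P x"
proof -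
  obtain y where y: "\<And>x. x \<in>\<^sub>M y \<longleftrightarrow> P x" using assms by blast
  then have "coll P = y"
    unfolding coll_def using extensionality by (intro the_equality) auto
  then show ?thesis using y by simp
qed

lemma separation_definable:
  assumes "definable (\<lambda>e. P (e 0))"
  shows "\<exists>b. \<forall>x. x \<in>\<^sub>M b \<longleftrightarrow> x \<in>\<^sub>M a \<and> P x"
proof -
  obtain \<phi> c where \<phi>: "\<And>e. P (e 0) \<longleftrightarrow> sat mem (interleave e c) \<phi>"
    using assms unfolding definable_def by blast
  have "P x \<longleftrightarrow> sat mem ((interleave (\<lambda>n. a) c)(0 := x)) \<phi>" for x
  proof -
    have "(interleave (\<lambda>n. a) c)(0 := x) = interleave ((\<lambda>n. a)(0 := x)) c"
      by (rule ext) (auto simp: interleave_def elim: evenE)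
    then show ?thesis using \<phi>[of "(\<lambda>n. a)(0 := x)"] by simp
  qed
  then show ?thesis using separation[of a "interleave (\<lambda>n. a) c" 0 \<phi>] by simp
qed

lemma ex_sep:
  assumes "definable (\<lambda>e. P (e 0))" "\<And>x. P x \<Longrightarrow> x \<in>\<^sub>M a"
  shows "\<exists>b. \<forall>x. x \<in>\<^sub>M b \<longleftrightarrow> P x"
  using separation_definable[OF assms(1), of a] assms(2) by blast

lemma mem_coll:
  assumes "definable (\<lambda>e. P (e 0))" "\<And>x. P x \<Longrightarrow> x \<in>\<^sub>M a"
  shows "x \<in>\<^sub>M coll P \<longleftrightarrow> P x"
  using mem_coll_ex[OF ex_sep[OF assms]] .

lemma coll_eqI: "(\<And>x. x \<in>\<^sub>M y \<longleftrightarrow> P x) \<Longrightarrow> coll P = y"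
  unfolding coll_def using extensionality by (intro the_equality) auto

text \<open>
Set-builder terms may occur inside separated predicates, provided that they denote sets for all
values of the variables.
\<close>

lemma definable_term_coll:
  assumes "definable (\<lambda>e. P (\<lambda>n. e (Suc n)) (e 0))"
    and "\<And>e. \<exists>y. \<forall>x. x \<in>\<^sub>M y \<longleftrightarrow> P e x"
  shows "definable_term (\<lambda>e. coll (P e))"
proof -
  have "y = coll (P e) \<longleftrightarrow> (\<forall>x. x \<in>\<^sub>M y \<longleftrightarrow> P e x)" for y e
    using mem_coll_ex[OF assms(2)] by (subst ext_iff) simp
  moreover have "definable (\<lambda>e. P (\<lambda>n. e (Suc (Suc n))) (e 0))"
    using definable_rename_inj[OF assms(1) inj_lift] by simp
  then have "definable (\<lambda>e. \<forall>x. x \<in>\<^sub>M e 0 \<longleftrightarrow> P (\<lambda>n. e (Suc n)) x)"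
    by (intro definable_intros)
  ultimately show ?thesis unfolding definable_term_def by simp
qed

lemma mem_empty [simp]: "\<not> x \<in>\<^sub>M empty"
proof -
  have "\<exists>b. \<forall>x. x \<in>\<^sub>M b \<longleftrightarrow> x \<in>\<^sub>M a \<and> False" for a
    by (rule separation_definable) (rule definable_const)
  then show ?thesis unfolding empty_def by (subst mem_coll_ex) auto
qed

lemma mem_upair [simp]: "x \<in>\<^sub>M upair a b \<longleftrightarrow> x = a \<or> x = b"
  unfolding upair_def using pairing by (rule mem_coll_ex)

lemma mem_union [simp]: "x \<in>\<^sub>M union a \<longleftrightarrow> (\<exists>y. y \<in>\<^sub>M a \<and> x \<in>\<^sub>M y)"
  unfolding union_def using union_set by (rule mem_coll_ex)

lemma mem_pow [simp]: "x \<in>\<^sub>M pow a \<longleftrightarrow> x \<subseteq>\<^sub>M a"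
  unfolding pow_def sub_def using power_set by (rule mem_coll_ex)

lemma ex_inter: "\<exists>y. \<forall>x. x \<in>\<^sub>M y \<longleftrightarrow> x \<in>\<^sub>M a \<and> x \<in>\<^sub>M b"
  by (rule separation_definable) (intro definable_intros)

lemma mem_inter [simp]: "x \<in>\<^sub>M inter a b \<longleftrightarrow> x \<in>\<^sub>M a \<and> x \<in>\<^sub>M b"
  unfolding inter_def using ex_inter by (rule mem_coll_ex)

lemma ex_diff: "\<exists>y. \<forall>x. x \<in>\<^sub>M y \<longleftrightarrow> x \<in>\<^sub>M a \<and> \<not> x \<in>\<^sub>M b"
  by (rule separation_definable) (intro definable_intros)

lemma mem_diff [simp]: "x \<in>\<^sub>M diff a b \<longleftrightarrow> x \<in>\<^sub>M a \<and> \<not> x \<in>\<^sub>M b"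
  unfolding diff_def using ex_diff by (rule mem_coll_ex)

definition ins :: "'v \<Rightarrow> 'v \<Rightarrow> 'v" where
  "ins x a = union (upair (upair x x) a)"

lemma mem_ins [simp]: "y \<in>\<^sub>M ins x a \<longleftrightarrow> y = x \<or> y \<in>\<^sub>M a"
  unfolding ins_def by auto

lemma suc_eq: "suc n = ins n n"
  unfolding suc_def by (rule coll_eqI) auto

lemma mem_suc [simp]: "x \<in>\<^sub>M suc n \<longleftrightarrow> x \<in>\<^sub>M n \<or> x = n"
  unfolding suc_eq by auto

lemma pair_eq_iff [simp]: "pair a b = pair c d \<longleftrightarrow> a = c \<and> b = d"
proof
  assume eq: "pair a b = pair c d"
  have 1: "x \<in>\<^sub>M pair a b \<longleftrightarrow> x = upair a a \<or> x = upair a b"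
    "x \<in>\<^sub>M pair c d \<longleftrightarrow> x = upair c c \<or> x = upair c d" for x
    by (auto simp: pair_def)
  have u: "upair p q = upair r s \<longleftrightarrow> p = r \<and> q = s \<or> p = s \<and> q = r" for p q r s
    by (subst ext_iff) auto
  have "upair a a = upair c c \<or> upair a a = upair c d"
    and "upair a b = upair c c \<or> upair a b = upair c d"
    and "upair c d = upair a a \<or> upair c d = upair a b"
    using 1 eq by metis+
  then show "a = c \<and> b = d" unfolding u by blast
qed simp

lemma definable_term_upair_vars: "definable_term (\<lambda>e. upair (e 0) (e (Suc 0)))"
  unfolding upair_def using pairing
  by (intro definable_term_coll definable_intros) 

lemmas definable_term_upair [definable_intros] = definable_term_subst2[OF definable_term_upair_vars]

lemma definable_term_pair [definable_intros]: 
  "definable_term t \<Longrightarrow> definable_term u \<Longrightarrow> definable_term (\<lambda>e. pair (t e) (u e))"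
  unfolding pair_def by (intro definable_term_upair)

lemma definable_term_union [definable_intros]: "definable_term t \<Longrightarrow> definable_term (\<lambda>e. union (t e))"
  by (rule definable_term_subst1)
   (unfold union_def, intro definable_term_coll definable_intros union_set)

lemma definable_term_inter [definable_intros]:
  "definable_term t \<Longrightarrow> definable_term u \<Longrightarrow> definable_term (\<lambda>e. inter (t e) (u e))"
  by (rule definable_term_subst2)
   (unfold inter_def, intro definable_term_coll definable_intros ex_inter)

lemma definable_term_diff [definable_intros]:
  "definable_term t \<Longrightarrow> definable_term u \<Longrightarrow> definable_term (\<lambda>e. diff (t e) (u e))"
  by (rule definable_term_subst2)
   (unfold diff_def, intro definable_term_coll definable_intros ex_diff)

lemma definable_term_ins [definable_intros]:
  "definable_term t \<Longrightarrow> definable_term u \<Longrightarrow> definable_term (\<lambda>e. ins (t e) (u e))"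
  unfolding ins_def by (intro definable_term_upair definable_term_union)

lemma mem_sub: "a \<subseteq>\<^sub>M b \<Longrightarrow> x \<in>\<^sub>M a \<Longrightarrow> x \<in>\<^sub>M b"
  unfolding sub_def by blast

lemma subI: "(\<And>x. x \<in>\<^sub>M a \<Longrightarrow> x \<in>\<^sub>M b) \<Longrightarrow> a \<subseteq>\<^sub>M b"
  unfolding sub_def by blast

lemma eqI: "(\<And>x. x \<in>\<^sub>M a \<Longrightarrow> x \<in>\<^sub>M b) \<Longrightarrow> (\<And>x. x \<in>\<^sub>M b \<Longrightarrow> x \<in>\<^sub>M a) \<Longrightarrow> a = b"
  using ext_iff by blast

lemma ex_cart: "\<exists>c. \<forall>p. p \<in>\<^sub>M c \<longleftrightarrow> (\<exists>x y. x \<in>\<^sub>M a \<and> y \<in>\<^sub>M b \<and> p = pair x y)"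
proof (rule ex_sep)
  show "definable (\<lambda>e. \<exists>x y. x \<in>\<^sub>M a \<and> y \<in>\<^sub>M b \<and> e 0 = pair x y)"
    by (intro definable_intros)
  show "p \<in>\<^sub>M pow (pow (union (upair a b)))" if "\<exists>x y. x \<in>\<^sub>M a \<and> y \<in>\<^sub>M b \<and> p = pair x y" for p
    using that by (auto simp: pair_def sub_def; blast)
qed

lemma mem_cart: "p \<in>\<^sub>M cart a b \<longleftrightarrow> (\<exists>x y. x \<in>\<^sub>M a \<and> y \<in>\<^sub>M b \<and> p = pair x y)"
  unfolding cart_def using ex_cart by (rule mem_coll_ex)

lemma pair_mem_cart [simp]: "pair x y \<in>\<^sub>M cart a b \<longleftrightarrow> x \<in>\<^sub>M a \<and> y \<in>\<^sub>M b"
  by (simp add: mem_cart)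

lemma definable_term_cart [definable_intros]:
  "definable_term t \<Longrightarrow> definable_term u \<Longrightarrow> definable_term (\<lambda>e. cart (t e) (u e))"
  by (rule definable_term_subst2) (unfold cart_def, intro definable_term_coll definable_intros ex_cart)

lemma definable_is_fun [definable_intros]:
  "definable_term t \<Longrightarrow> definable_term u \<Longrightarrow> definable_term v \<Longrightarrow>
    definable (\<lambda>e. is_fun (t e) (u e) (v e))"
  by (rule definable_subst3) (unfold is_fun_def, intro definable_intros)

lemma definable_is_bij [definable_intros]:
  "definable_term t \<Longrightarrow> definable_term u \<Longrightarrow> definable_term v \<Longrightarrow>
    definable (\<lambda>e. is_bij (t e) (u e) (v e))"
  by (rule definable_subst3) (unfold is_bij_def, intro definable_intros)

lemma is_fun_pairD: "is_fun f a b \<Longrightarrow> pair x y \<in>\<^sub>M f \<Longrightarrow> x \<in>\<^sub>M a \<and> y \<in>\<^sub>M b"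
  unfolding is_fun_def using mem_sub[of f "cart a b" "pair x y"] by simp

lemma is_fun_memD: "is_fun f a b \<Longrightarrow> p \<in>\<^sub>M f \<Longrightarrow> \<exists>x y. p = pair x y \<and> x \<in>\<^sub>M a \<and> y \<in>\<^sub>M b"
  unfolding is_fun_def using mem_sub[of f "cart a b" p] by (auto simp: mem_cart)

lemma is_fun_unique: "is_fun f a b \<Longrightarrow> pair x y \<in>\<^sub>M f \<Longrightarrow> pair x z \<in>\<^sub>M f \<Longrightarrow> y = z"
  unfolding is_fun_def using mem_sub[of f "cart a b" "pair x y"] by (auto simp: mem_cart)

lemma is_fun_ex: "is_fun f a b \<Longrightarrow> x \<in>\<^sub>M a \<Longrightarrow> \<exists>y. y \<in>\<^sub>M b \<and> pair x y \<in>\<^sub>M f"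
  unfolding is_fun_def using mem_sub[of f "cart a b"] by (metis pair_mem_cart)

lemma is_funI:
  assumes "\<And>p. p \<in>\<^sub>M f \<Longrightarrow> \<exists>x y. p = pair x y \<and> x \<in>\<^sub>M a \<and> y \<in>\<^sub>M b"
    and "\<And>x. x \<in>\<^sub>M a \<Longrightarrow> \<exists>y. pair x y \<in>\<^sub>M f"
    and "\<And>x y z. pair x y \<in>\<^sub>M f \<Longrightarrow> pair x z \<in>\<^sub>M f \<Longrightarrow> y = z"
  shows "is_fun f a b"
  unfolding is_fun_def sub_def mem_cart using assms by blast

lemma app_eq: "is_fun f a b \<Longrightarrow> pair x y \<in>\<^sub>M f \<Longrightarrow> app f x = y"
  unfolding app_def using is_fun_unique by (intro the_equality) blast+

lemma is_fun_eqI: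
  assumes "is_fun f a b" "is_fun g a c" "\<And>x y. pair x y \<in>\<^sub>M f \<Longrightarrow> pair x y \<in>\<^sub>M g"
  shows "f = g"
proof (rule eqI)
  fix p assume "p \<in>\<^sub>M f"
  then show "p \<in>\<^sub>M g" using is_fun_memD[OF assms(1)] assms(3) by blast
next
  fix p assume p: "p \<in>\<^sub>M g"
  then obtain x y where xy: "p = pair x y" "x \<in>\<^sub>M a" using is_fun_memD[OF assms(2)] by blast
  then obtain z where z: "pair x z \<in>\<^sub>M f" using is_fun_ex[OF assms(1)] by blast
  then show "p \<in>\<^sub>M f" using xy p assms(3) is_fun_unique[OF assms(2)] by metis
qed

text \<open>
This is how functions are constructed in the model: separate a definable functional relation from
the product. The uniqueness hypothesis is what replaces any choice of values.
\<close>

lemma ex_fun: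
  assumes "definable (\<lambda>e. R (e 0) (e (Suc 0)))"
    and "\<And>x. x \<in>\<^sub>M a \<Longrightarrow> \<exists>y. y \<in>\<^sub>M b \<and> R x y"
    and "\<And>x y z. x \<in>\<^sub>M a \<Longrightarrow> y \<in>\<^sub>M b \<Longrightarrow> z \<in>\<^sub>M b \<Longrightarrow> R x y \<Longrightarrow> R x z \<Longrightarrow> y = z"
  obtains f where "is_fun f a b" "\<And>x y. pair x y \<in>\<^sub>M f \<longleftrightarrow> x \<in>\<^sub>M a \<and> y \<in>\<^sub>M b \<and> R x y"
proof -
  have "definable (\<lambda>e. \<exists>x y. e 0 = pair x y \<and> R x y)"
    by (intro definable_intros definable_subst2[OF assms(1)])
  then obtain f where f: "\<And>p. p \<in>\<^sub>M f \<longleftrightarrow> p \<in>\<^sub>M cart a b \<and> (\<exists>x y. p = pair x y \<and> R x y)"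
    using separation_definable[of "\<lambda>p. \<exists>x y. p = pair x y \<and> R x y" "cart a b"] by blast
  have 1: "pair x y \<in>\<^sub>M f \<longleftrightarrow> x \<in>\<^sub>M a \<and> y \<in>\<^sub>M b \<and> R x y" for x y
    using f by auto
  have "is_fun f a b"
  proof (rule is_funI)
    show "\<exists>x y. p = pair x y \<and> x \<in>\<^sub>M a \<and> y \<in>\<^sub>M b" if "p \<in>\<^sub>M f" for p
      using that f by (auto simp: mem_cart)
  qed (use 1 assms(2,3) in blast)+
  with 1 show thesis using that by blast
qed

text \<open>
The double union bounds the domain and range of an arbitrary set of pairs, so that images, preimages
and compositions exist even for sets that are not functions.
\<close>

lemma pair_mem_field: "pair x y \<in>\<^sub>M f \<Longrightarrow> x \<in>\<^sub>M union (union f) \<and> y \<in>\<^sub>M union (union f)"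
proof -
  assume "pair x y \<in>\<^sub>M f"
  moreover have "upair x y \<in>\<^sub>M pair x y" by (simp add: pair_def)
  ultimately have "upair x y \<in>\<^sub>M union f" by (simp only: mem_union) blast
  moreover have "x \<in>\<^sub>M upair x y" "y \<in>\<^sub>M upair x y" by simp_all
  ultimately show ?thesis by (simp only: mem_union) blast
qed

lemma ex_image: "\<exists>z. \<forall>y. y \<in>\<^sub>M z \<longleftrightarrow> (\<exists>x. x \<in>\<^sub>M a \<and> pair x y \<in>\<^sub>M f)"
  by (rule ex_sep[where a = "union (union f)"]) (intro definable_intros, use pair_mem_field in blast)

lemma mem_image [simp]: "y \<in>\<^sub>M image f a \<longleftrightarrow> (\<exists>x. x \<in>\<^sub>M a \<and> pair x y \<in>\<^sub>M f)"
  unfolding image_def using ex_image by (rule mem_coll_ex)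

lemma ex_preimage: "\<exists>z. \<forall>x. x \<in>\<^sub>M z \<longleftrightarrow> (\<exists>y. y \<in>\<^sub>M b \<and> pair x y \<in>\<^sub>M f)"
  by (rule ex_sep[where a = "union (union f)"]) (intro definable_intros, use pair_mem_field in blast)

lemma mem_preimage [simp]: "x \<in>\<^sub>M preimage f b \<longleftrightarrow> (\<exists>y. y \<in>\<^sub>M b \<and> pair x y \<in>\<^sub>M f)"
  unfolding preimage_def using ex_preimage by (rule mem_coll_ex)

lemma definable_term_preimage [definable_intros]:
  "definable_term t \<Longrightarrow> definable_term u \<Longrightarrow> definable_term (\<lambda>e. preimage (t e) (u e))"
  by (rule definable_term_subst2)
    (unfold preimage_def, intro definable_term_coll definable_intros ex_preimage)

lemma mem_comp: "p \<in>\<^sub>M comp g f \<longleftrightarrow> (\<exists>x y z. p = pair x z \<and> pair x y \<in>\<^sub>M f \<and> pair y z \<in>\<^sub>M g)"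
  unfolding comp_def
proof (rule mem_coll)
  show "definable (\<lambda>e. \<exists>x y z. e 0 = pair x z \<and> pair x y \<in>\<^sub>M f \<and> pair y z \<in>\<^sub>M g)"
    by (intro definable_intros)
  show "p \<in>\<^sub>M cart (union (union f)) (union (union g))"
    if "\<exists>x y z. p = pair x z \<and> pair x y \<in>\<^sub>M f \<and> pair y z \<in>\<^sub>M g" for p
    using that pair_mem_field unfolding mem_cart by blast
qed

lemma pair_mem_comp [simp]: "pair x z \<in>\<^sub>M comp g f \<longleftrightarrow> (\<exists>y. pair x y \<in>\<^sub>M f \<and> pair y z \<in>\<^sub>M g)"
  by (simp add: mem_comp)

lemma ex_comp:
  "\<exists>c. \<forall>p. p \<in>\<^sub>M c \<longleftrightarrow> (\<exists>x y z. p = pair x z \<and> pair x y \<in>\<^sub>M f \<and> pair y z \<in>\<^sub>M g)"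
  using mem_comp by blast

lemma definable_term_comp [definable_intros]:
  "definable_term t \<Longrightarrow> definable_term u \<Longrightarrow> definable_term (\<lambda>e. comp (t e) (u e))"
  by (rule definable_term_subst2) (unfold comp_def, intro definable_term_coll definable_intros ex_comp)

lemma comp_assoc: "comp (comp k g) f = comp k (comp g f)"
proof -
  have "p \<in>\<^sub>M comp (comp k g) f \<longleftrightarrow> p \<in>\<^sub>M comp k (comp g f)" for p
    unfolding mem_comp[of p] pair_mem_comp by blast
  then show ?thesis using ext_iff by blast
qed

lemma is_fun_comp: "is_fun f a b \<Longrightarrow> is_fun g b c \<Longrightarrow> is_fun (comp g f) a c"
  by (rule is_funI)
    (simp_all add: mem_comp, (metis is_fun_pairD is_fun_ex is_fun_unique)+)

lemma preimage_comp: "preimage (comp g f) V = preimage f (preimage g V)"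
  by (subst ext_iff) auto

lemma mem_conv: "p \<in>\<^sub>M conv f \<longleftrightarrow> (\<exists>x y. p = pair y x \<and> pair x y \<in>\<^sub>M f)"
  unfolding conv_def
proof (rule mem_coll)
  show "definable (\<lambda>e. \<exists>x y. e 0 = pair y x \<and> pair x y \<in>\<^sub>M f)"
    by (intro definable_intros)
  show "p \<in>\<^sub>M cart (union (union f)) (union (union f))"
    if "\<exists>x y. p = pair y x \<and> pair x y \<in>\<^sub>M f" for p
    using that pair_mem_field unfolding mem_cart by blast
qed

lemma pair_mem_conv [simp]: "pair y x \<in>\<^sub>M conv f \<longleftrightarrow> pair x y \<in>\<^sub>M f"
  by (simp add: mem_conv)

lemma mem_funs [simp]: "f \<in>\<^sub>M funs a b \<longleftrightarrow> is_fun f a b"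
  unfolding funs_def
proof (rule mem_coll)
  show "definable (\<lambda>e. is_fun (e 0) a b)" by (intro definable_intros)
  show "f \<in>\<^sub>M pow (cart a b)" if "is_fun f a b" for f using that by (simp add: is_fun_def)
qed

section \<open>The finite sets of the model\<close>

lemma definable_is_inductive [definable_intros]:
  "definable_term t \<Longrightarrow> definable (\<lambda>e. is_inductive (t e))"
  by (rule definable_subst1) (unfold is_inductive_def suc_eq, intro definable_intros)

lemma mem_omega: "n \<in>\<^sub>M omega \<longleftrightarrow> (\<forall>I. is_inductive I \<longrightarrow> n \<in>\<^sub>M I)"
proof -
  obtain I z where I: "z \<in>\<^sub>M I" "\<And>x. \<not> x \<in>\<^sub>M z"
      "\<And>n. n \<in>\<^sub>M I \<Longrightarrow> \<exists>s. s \<in>\<^sub>M I \<and> (\<forall>x. x \<in>\<^sub>M s \<longleftrightarrow> x \<in>\<^sub>M n \<or> x = n)"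
    using infinity by blast
  have "is_inductive I"
    unfolding is_inductive_def
  proof (intro conjI allI impI)
    have "empty = z" using I(2) by (subst ext_iff) simp
    then show "empty \<in>\<^sub>M I" using I(1) by simp
    fix n assume "n \<in>\<^sub>M I"
    then obtain s where s: "s \<in>\<^sub>M I" "\<And>x. x \<in>\<^sub>M s \<longleftrightarrow> x \<in>\<^sub>M n \<or> x = n" using I(3) by blast
    have "suc n = s" using s(2) by (subst ext_iff) simp
    then show "suc n \<in>\<^sub>M I" using s(1) by simp
  qed
  then show ?thesis
    unfolding omega_def by (intro mem_coll[where a = I]) (intro definable_intros, blast)
qed

lemma empty_mem_omega: "empty \<in>\<^sub>M omega" and suc_mem_omega: "n \<in>\<^sub>M omega \<Longrightarrow> suc n \<in>\<^sub>M omega"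
  unfolding mem_omega is_inductive_def by blast+

text \<open>
Induction inside the model is available for definable predicates only, because the
inductive set of numbers that satisfy the predicate must be an element of the model.
\<close>

lemma omega_induct:
  assumes "definable (\<lambda>e. P (e 0))" and "n \<in>\<^sub>M omega"
    and "P empty" and "\<And>n. n \<in>\<^sub>M omega \<Longrightarrow> P n \<Longrightarrow> P (suc n)"
  shows "P n"
proof -
  obtain I where I: "\<And>n. n \<in>\<^sub>M I \<longleftrightarrow> n \<in>\<^sub>M omega \<and> P n"
    using separation_definable[OF assms(1), of omega] by blast
  then have "is_inductive I"
    unfolding is_inductive_def using assms(3,4) empty_mem_omega suc_mem_omega by blast
  then show ?thesis using assms(2) I mem_omega by blast
qed

lemma not_mem_self: "\<not> n \<in>\<^sub>M n"
  using foundation[of n "upair n n"] by auto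

lemma definable_is_finite [definable_intros]:
  "definable_term t \<Longrightarrow> definable (\<lambda>e. is_finite (t e))"
  by (rule definable_subst1) (unfold is_finite_def, intro definable_intros)

lemma is_finite_empty: "is_finite empty"
proof -
  have "is_bij empty empty empty" by (simp add: is_bij_def is_fun_def sub_def)
  then show ?thesis unfolding is_finite_def using empty_mem_omega by blast
qed

text \<open>
A bijection with \<open>n\<close> grows to one with \<open>suc n\<close> by sending the new index \<open>n\<close> to the new element.
Foundation ensures that \<open>n\<close> is a new index.
\<close>

lemma is_finite_ins: 
  assumes "is_finite a" shows "is_finite (ins x a)"
proof (cases "x \<in>\<^sub>M a")
  case True
  then have "ins x a = a" by (subst ext_iff) auto
  then show ?thesis using assms by simp
next
  case False
  obtain n f where n: "n \<in>\<^sub>M omega" and f: "is_fun f n a"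
    and bij: "\<And>y. y \<in>\<^sub>M a \<Longrightarrow> \<exists>!k. pair k y \<in>\<^sub>M f"
    using assms unfolding is_finite_def is_bij_def by blast
  let ?g = "ins (pair n x) f"
  have "is_fun ?g (suc n) (ins x a)"
  proof (rule is_funI)
    fix p assume "p \<in>\<^sub>M ?g"
    then consider "p = pair n x" | "p \<in>\<^sub>M f" by auto
    then show "\<exists>k y. p = pair k y \<and> k \<in>\<^sub>M suc n \<and> y \<in>\<^sub>M ins x a"
    proof cases
      case 2
      then show ?thesis using is_fun_memD[OF f] by force
    qed auto
  next
    fix k assume "k \<in>\<^sub>M suc n"
    then show "\<exists>y. pair k y \<in>\<^sub>M ?g" using is_fun_ex[OF f, of k] by auto
  next
    fix k y z assume "pair k y \<in>\<^sub>M ?g" "pair k z \<in>\<^sub>M ?g"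
    then show "y = z"
      using is_fun_unique[OF f, of k] is_fun_pairD[OF f, of n] not_mem_self[of n] by auto
  qed
  moreover have "\<exists>!k. pair k y \<in>\<^sub>M ?g" if "y \<in>\<^sub>M ins x a" for y
  proof (cases "y = x")
    case True
    then show ?thesis using False is_fun_pairD[OF f, of _ x] by auto
  next
    case False
    then show ?thesis using that bij[of y] by auto
  qed
  ultimately have "is_bij ?g (suc n) (ins x a)" unfolding is_bij_def by blast
  then show ?thesis unfolding is_finite_def using suc_mem_omega[OF n] by blast
qed

text \<open>
Finiteness in the model may admit sets that are infinite outside of it, so induction over finite
sets must run along the \<open>\<omega>\<close> of the model. In the step, the element enumerated last is removed.
\<close>

lemma finite_induct_definable:
  assumes P: "definable (\<lambda>e. P (e 0))" and "is_finite a"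
    and base: "P empty" and step: "\<And>x b. P b \<Longrightarrow> P (ins x b)"
  shows "P a"
proof -
  have "\<forall>f a. is_bij f n a \<longrightarrow> P a" if "n \<in>\<^sub>M omega" for n
  proof (rule omega_induct[OF _ that, of "\<lambda>n. \<forall>f a. is_bij f n a \<longrightarrow> P a"])
    show "definable (\<lambda>e. \<forall>f a. is_bij f (e 0) a \<longrightarrow> P a)"
      by (intro definable_intros definable_subst1[OF P])
    show "\<forall>f a. is_bij f empty a \<longrightarrow> P a"
    proof (intro allI impI)
      fix f a assume "is_bij f empty a"
      then have "\<not> y \<in>\<^sub>M a" for y
        unfolding is_bij_def using is_fun_pairD[of f empty a _ y] by (metis mem_empty)
      then have "a = empty" by (subst ext_iff) simp
      then show "P a" using base by simp
    qed
    fix m assume IH: "\<forall>f a. is_bij f m a \<longrightarrow> P a"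
    show "\<forall>f a. is_bij f (suc m) a \<longrightarrow> P a"
    proof (intro allI impI)
      fix f a assume "is_bij f (suc m) a"
      then have f: "is_fun f (suc m) a" and bij: "\<And>y. y \<in>\<^sub>M a \<Longrightarrow> \<exists>!k. pair k y \<in>\<^sub>M f"
        unfolding is_bij_def by auto
      obtain x where x: "x \<in>\<^sub>M a" "pair m x \<in>\<^sub>M f" using is_fun_ex[OF f, of m] by auto
      \<comment> \<open>restrict the bijection to \<open>m\<close> by deleting the pair of the last index \<open>m\<close>\<close>
      let ?g = "diff f (upair (pair m x) (pair m x))" and ?b = "diff a (upair x x)"
      have inj: "k = l" if "pair k y \<in>\<^sub>M f" "pair l y \<in>\<^sub>M f" for k l y
        using that bij is_fun_pairD[OF f] by blast
      have "is_fun ?g m ?b"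
      proof (rule is_funI)
        fix p assume p: "p \<in>\<^sub>M ?g"
        then obtain k y where ky: "p = pair k y" "k \<in>\<^sub>M suc m" "y \<in>\<^sub>M a"
          using is_fun_memD[OF f, of p] by auto
        then have "k \<noteq> m" "y \<noteq> x"
          using p x inj is_fun_unique[OF f, of m] by auto
        then show "\<exists>k y. p = pair k y \<and> k \<in>\<^sub>M m \<and> y \<in>\<^sub>M ?b"
          using ky by auto
      next
        fix k assume k: "k \<in>\<^sub>M m"
        then obtain y where "pair k y \<in>\<^sub>M f" using is_fun_ex[OF f, of k] by auto
        then show "\<exists>y. pair k y \<in>\<^sub>M ?g" using k not_mem_self[of m] by auto
      qed (use is_fun_unique[OF f] in auto)
      moreover have "\<exists>!k. pair k y \<in>\<^sub>M ?g" if "y \<in>\<^sub>M ?b" for y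
        using that bij[of y] by auto
      ultimately have "is_bij ?g m ?b" unfolding is_bij_def by blast
      then have "P (ins x ?b)" using IH step by blast
      moreover have "ins x ?b = a" using x by (subst ext_iff) auto
      ultimately show "P a" by simp
    qed
  qed
  then show ?thesis using assms(2) unfolding is_finite_def by blast
qed

lemma is_finite_subset:
  assumes "is_finite a" "b \<subseteq>\<^sub>M a"
  shows "is_finite b"
proof -
  have "\<forall>b. b \<subseteq>\<^sub>M a \<longrightarrow> is_finite b"
  proof (rule finite_induct_definable[OF _ assms(1), of "\<lambda>a. \<forall>b. b \<subseteq>\<^sub>M a \<longrightarrow> is_finite b"])
    show "definable (\<lambda>e. \<forall>b. b \<subseteq>\<^sub>M e 0 \<longrightarrow> is_finite b)" by (intro definable_intros)
    show "\<forall>b. b \<subseteq>\<^sub>M empty \<longrightarrow> is_finite b"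
    proof (intro allI impI)
      fix b assume "b \<subseteq>\<^sub>M empty"
      then have "b = empty" by (subst ext_iff) (auto simp: sub_def)
      then show "is_finite b" using is_finite_empty by simp
    qed
    fix x a assume IH: "\<forall>b. b \<subseteq>\<^sub>M a \<longrightarrow> is_finite b"
    show "\<forall>b. b \<subseteq>\<^sub>M ins x a \<longrightarrow> is_finite b"
    proof (intro allI impI)
      fix b assume b: "b \<subseteq>\<^sub>M ins x a"
      have "inter b a \<subseteq>\<^sub>M a" by (simp add: sub_def)
      then have fin: "is_finite (inter b a)" using IH by blast
      have "b = inter b a \<or> b = ins x (inter b a)"
        unfolding ext_iff[of b] using b by (auto simp: sub_def)
      then show "is_finite b" using fin is_finite_ins by metis
    qed
  qed
  then show ?thesis using assms(2) by blast
qed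

lemma is_finite_union:
  assumes "is_finite a" "is_finite b"
  shows "is_finite (union (upair a b))"
proof (rule finite_induct_definable[OF _ assms(1), of "\<lambda>a. is_finite (union (upair a b))"])
  show "definable (\<lambda>e. is_finite (union (upair (e 0) b)))" by (intro definable_intros)
  have "union (upair empty b) = b" by (subst ext_iff) auto
  then show "is_finite (union (upair empty b))" using assms(2) by simp
  fix x a assume "is_finite (union (upair a b))"
  moreover have "union (upair (ins x a) b) = ins x (union (upair a b))" by (subst ext_iff) auto
  ultimately show "is_finite (union (upair (ins x a) b))" using is_finite_ins by simp
qed

text \<open>
Finite choice, and at the same time the image of a finite set, both by induction and hence without
an axiom of choice. The last clause of the conclusion keeps the collected set inside the range of
\<open>R\<close>.
\<close>

lemma finite_collection:
  assumes R: "definable (\<lambda>e. R (e 0) (e (Suc 0)))" and fin: "is_finite a"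
    and ex: "\<And>x. x \<in>\<^sub>M a \<Longrightarrow> \<exists>y. R x y"
  obtains b where "is_finite b" "\<And>x. x \<in>\<^sub>M a \<Longrightarrow> \<exists>y. y \<in>\<^sub>M b \<and> R x y"
    "\<And>y. y \<in>\<^sub>M b \<Longrightarrow> \<exists>x. x \<in>\<^sub>M a \<and> R x y"
proof -
  let ?P = "\<lambda>a. (\<forall>x. x \<in>\<^sub>M a \<longrightarrow> (\<exists>y. R x y)) \<longrightarrow>
    (\<exists>b. is_finite b \<and> (\<forall>x. x \<in>\<^sub>M a \<longrightarrow> (\<exists>y. y \<in>\<^sub>M b \<and> R x y)) \<and>
      (\<forall>y. y \<in>\<^sub>M b \<longrightarrow> (\<exists>x. x \<in>\<^sub>M a \<and> R x y)))"
  have "?P a"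
  proof (rule finite_induct_definable[OF _ fin, of ?P])
    show "definable (\<lambda>e. ?P (e 0))"
      by (intro definable_intros definable_subst2[OF R])
    show "?P empty" using is_finite_empty by auto
    fix x a assume IH: "?P a"
    show "?P (ins x a)"
    proof
      assume ex: "\<forall>z. z \<in>\<^sub>M ins x a \<longrightarrow> (\<exists>y. R z y)"
      then obtain y where y: "R x y" by auto
      from ex IH obtain b where b: "is_finite b" "\<And>x. x \<in>\<^sub>M a \<Longrightarrow> \<exists>y. y \<in>\<^sub>M b \<and> R x y"
        "\<And>y. y \<in>\<^sub>M b \<Longrightarrow> \<exists>x. x \<in>\<^sub>M a \<and> R x y" by auto
      show "\<exists>b. is_finite b \<and> (\<forall>z. z \<in>\<^sub>M ins x a \<longrightarrow> (\<exists>y. y \<in>\<^sub>M b \<and> R z y)) \<and>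
          (\<forall>y. y \<in>\<^sub>M b \<longrightarrow> (\<exists>z. z \<in>\<^sub>M ins x a \<and> R z y))"
        unfolding mem_ins using y b(2,3) is_finite_ins[OF b(1), of y]
        by (intro exI[of _ "ins y b"]) (unfold mem_ins, blast)
    qed
  qed
  then show thesis using ex that by blast
qed

end

section \<open>Topological spaces inside the model\<close>

context ZF
begin

lemma mem_CO: "A \<in>\<^sub>M CO X T \<longleftrightarrow> A \<in>\<^sub>M T \<and> diff X A \<in>\<^sub>M T"
  unfolding CO_def by (rule mem_coll[where a = T]) (intro definable_intros, blast)

lemma open_sub: "top_space X T \<Longrightarrow> U \<in>\<^sub>M T \<Longrightarrow> U \<subseteq>\<^sub>M X"
  unfolding top_space_def using mem_sub[of T "pow X" U] by simp

lemma open_inter: "top_space X T \<Longrightarrow> U \<in>\<^sub>M T \<Longrightarrow> V \<in>\<^sub>M T \<Longrightarrow> inter U V \<in>\<^sub>M T"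
  unfolding top_space_def by blast

text \<open>
The set is the union of all open sets that it contains; taking all of them avoids choosing a
neighbourhood for each point.
\<close>

lemma openI:
  assumes top: "top_space X T"
    and nhd: "\<And>x. x \<in>\<^sub>M U \<Longrightarrow> \<exists>V. V \<in>\<^sub>M T \<and> x \<in>\<^sub>M V \<and> V \<subseteq>\<^sub>M U"
  shows "U \<in>\<^sub>M T"
proof -
  have "definable (\<lambda>e. e 0 \<subseteq>\<^sub>M U)" by (intro definable_intros)
  then obtain G where G: "\<And>V. V \<in>\<^sub>M G \<longleftrightarrow> V \<in>\<^sub>M T \<and> V \<subseteq>\<^sub>M U"
    using separation_definable[of "\<lambda>V. V \<subseteq>\<^sub>M U" T] by blast
  then have "union G \<in>\<^sub>M T" using top unfolding top_space_def sub_def by blast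
  moreover have "union G = U"
    unfolding ext_iff[of "union G"] mem_union using G nhd unfolding sub_def by blast
  ultimately show ?thesis by simp
qed

lemma CO_compl: "top_space X T \<Longrightarrow> A \<in>\<^sub>M CO X T \<Longrightarrow> diff X A \<in>\<^sub>M CO X T"
proof -
  assume "top_space X T" "A \<in>\<^sub>M CO X T"
  moreover from this have "diff X (diff X A) = A"
    using open_sub[of X T A] by (subst ext_iff) (auto simp: mem_CO sub_def)
  ultimately show ?thesis by (simp add: mem_CO)
qed

lemma CO_inter:
  assumes top: "top_space X T" and A: "A \<in>\<^sub>M CO X T" and B: "B \<in>\<^sub>M CO X T"
  shows "inter A B \<in>\<^sub>M CO X T"
  unfolding mem_CO
proof
  show "inter A B \<in>\<^sub>M T" using assms open_inter by (auto simp: mem_CO)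
  show "diff X (inter A B) \<in>\<^sub>M T"
  proof (rule openI[OF top])
    fix x assume x: "x \<in>\<^sub>M diff X (inter A B)"
    have "diff X A \<subseteq>\<^sub>M diff X (inter A B)" "diff X B \<subseteq>\<^sub>M diff X (inter A B)"
      by (auto simp: sub_def)
    moreover have "x \<in>\<^sub>M diff X A \<or> x \<in>\<^sub>M diff X B" using x by auto
    ultimately show "\<exists>V. V \<in>\<^sub>M T \<and> x \<in>\<^sub>M V \<and> V \<subseteq>\<^sub>M diff X (inter A B)"
      using A B unfolding mem_CO by blast
  qed
qed

lemma CO_carrier: "top_space X T \<Longrightarrow> X \<in>\<^sub>M CO X T"
proof -
  have "diff X X = empty" by (subst ext_iff) auto
  then show "top_space X T \<Longrightarrow> X \<in>\<^sub>M CO X T" by (simp add: mem_CO top_space_def)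
qed

lemma base_nhd:
  "is_base B T \<Longrightarrow> U \<in>\<^sub>M T \<Longrightarrow> x \<in>\<^sub>M U \<Longrightarrow> \<exists>V. V \<in>\<^sub>M B \<and> x \<in>\<^sub>M V \<and> V \<subseteq>\<^sub>M U"
  unfolding is_base_def sub_def by (metis mem_union)

lemma is_baseI:
  assumes "B \<subseteq>\<^sub>M T"
    and nhd: "\<And>U x. U \<in>\<^sub>M T \<Longrightarrow> x \<in>\<^sub>M U \<Longrightarrow> \<exists>V. V \<in>\<^sub>M B \<and> x \<in>\<^sub>M V \<and> V \<subseteq>\<^sub>M U"
  shows "is_base B T"
  unfolding is_base_def
proof (intro conjI allI impI assms(1))
  fix U assume U: "U \<in>\<^sub>M T"
  have "definable (\<lambda>e. e 0 \<subseteq>\<^sub>M U)" by (intro definable_intros)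
  then obtain G where G: "\<And>V. V \<in>\<^sub>M G \<longleftrightarrow> V \<in>\<^sub>M B \<and> V \<subseteq>\<^sub>M U"
    using separation_definable[of "\<lambda>V. V \<subseteq>\<^sub>M U" B] by blast
  have "U = union G"
    unfolding ext_iff[of U] mem_union using G nhd[OF U] unfolding sub_def by blast
  moreover have "G \<subseteq>\<^sub>M B" using G by (simp add: sub_def)
  ultimately show "\<exists>G. G \<subseteq>\<^sub>M B \<and> U = union G" by blast
qed

lemma zero_dim_nhd:
  "zero_dim_T1_space X T \<Longrightarrow> U \<in>\<^sub>M T \<Longrightarrow> x \<in>\<^sub>M U \<Longrightarrow>
    \<exists>A. A \<in>\<^sub>M CO X T \<and> x \<in>\<^sub>M A \<and> A \<subseteq>\<^sub>M U"
  unfolding zero_dim_T1_space_def using base_nhd by blast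

lemma zero_dim_separate:
  assumes "zero_dim_T1_space X T" "x \<in>\<^sub>M X" "y \<in>\<^sub>M X" "x \<noteq> y"
  shows "\<exists>A. A \<in>\<^sub>M CO X T \<and> x \<in>\<^sub>M A \<and> \<not> y \<in>\<^sub>M A"
proof -
  obtain U where "U \<in>\<^sub>M T" "x \<in>\<^sub>M U" "\<not> y \<in>\<^sub>M U"
    using assms unfolding zero_dim_T1_space_def T1_def by blast
  then show ?thesis using zero_dim_nhd[OF assms(1), of U x] mem_sub by blast
qed

lemma zero_dim_T1_imp_hausdorff:
  assumes "zero_dim_T1_space X T" shows "hausdorff X T"
  unfolding hausdorff_def
proof (intro allI impI)
  fix x y assume xy: "x \<in>\<^sub>M X \<and> y \<in>\<^sub>M X \<and> x \<noteq> y"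
  then obtain A where A: "A \<in>\<^sub>M CO X T" "x \<in>\<^sub>M A" "\<not> y \<in>\<^sub>M A"
    using zero_dim_separate[OF assms] by blast
  have "inter A (diff X A) = empty" by (subst ext_iff) auto
  then show "\<exists>U V. U \<in>\<^sub>M T \<and> V \<in>\<^sub>M T \<and> x \<in>\<^sub>M U \<and> y \<in>\<^sub>M V \<and> inter U V = empty"
    using A xy by (intro exI[of _ A] exI[of _ "diff X A"]) (auto simp: mem_CO)
qed

lemma mem_closure: "x \<in>\<^sub>M closure X T A \<longleftrightarrow>
    x \<in>\<^sub>M X \<and> (\<forall>U. U \<in>\<^sub>M T \<and> x \<in>\<^sub>M U \<longrightarrow> (\<exists>a. a \<in>\<^sub>M A \<and> a \<in>\<^sub>M U))"
  unfolding closure_def by (rule mem_coll[where a = X]) (intro definable_intros, blast)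

lemma mem_subtop: "W \<in>\<^sub>M subtop T A \<longleftrightarrow> (\<exists>U. U \<in>\<^sub>M T \<and> W = inter U A)"
  unfolding subtop_def by (rule mem_coll[where a = "pow A"]) (intro definable_intros, auto simp: sub_def)

text \<open>
As for \<open>openI\<close>, the open set that witnesses the right-hand side is the union of all those whose
trace lies in \<open>W\<close>.
\<close>

lemma mem_subtop_iff:
  assumes "top_space X T" "A \<subseteq>\<^sub>M X"
  shows "W \<in>\<^sub>M subtop T A \<longleftrightarrow>
    W \<subseteq>\<^sub>M A \<and> (\<forall>x. x \<in>\<^sub>M W \<longrightarrow> (\<exists>U. U \<in>\<^sub>M T \<and> x \<in>\<^sub>M U \<and> inter U A \<subseteq>\<^sub>M W))"
proof
  assume "W \<in>\<^sub>M subtop T A"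
  then obtain U where U: "U \<in>\<^sub>M T" "W = inter U A" unfolding mem_subtop by blast
  then show "W \<subseteq>\<^sub>M A \<and> (\<forall>x. x \<in>\<^sub>M W \<longrightarrow> (\<exists>U. U \<in>\<^sub>M T \<and> x \<in>\<^sub>M U \<and> inter U A \<subseteq>\<^sub>M W))"
    by (auto simp: sub_def)
next
  assume W: "W \<subseteq>\<^sub>M A \<and> (\<forall>x. x \<in>\<^sub>M W \<longrightarrow> (\<exists>U. U \<in>\<^sub>M T \<and> x \<in>\<^sub>M U \<and> inter U A \<subseteq>\<^sub>M W))"
  have "definable (\<lambda>e. inter (e 0) A \<subseteq>\<^sub>M W)" by (intro definable_intros)
  then obtain G where G: "\<And>V. V \<in>\<^sub>M G \<longleftrightarrow> V \<in>\<^sub>M T \<and> inter V A \<subseteq>\<^sub>M W"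
    using separation_definable[of "\<lambda>V. inter V A \<subseteq>\<^sub>M W" T] by blast
  then have "union G \<in>\<^sub>M T" using assms(1) unfolding top_space_def sub_def by blast
  moreover have "W = inter (union G) A"
  proof (rule eqI)
    fix x assume "x \<in>\<^sub>M W"
    then show "x \<in>\<^sub>M inter (union G) A" using W G mem_sub unfolding mem_inter mem_union by blast
  next
    fix x assume "x \<in>\<^sub>M inter (union G) A"
    then obtain V where "V \<in>\<^sub>M G" "x \<in>\<^sub>M V" "x \<in>\<^sub>M A" unfolding mem_inter mem_union by blast
    then show "x \<in>\<^sub>M W" using G mem_sub[of "inter V A" W x] by simp
  qed
  ultimately show "W \<in>\<^sub>M subtop T A" unfolding mem_subtop by blast
qed

lemma top_spaceI:
  assumes "\<And>U. U \<in>\<^sub>M T \<Longrightarrow> U \<subseteq>\<^sub>M X"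
    and "X \<in>\<^sub>M T"
    and "\<And>U. U \<subseteq>\<^sub>M X \<Longrightarrow> (\<And>x. x \<in>\<^sub>M U \<Longrightarrow> \<exists>V. V \<in>\<^sub>M T \<and> x \<in>\<^sub>M V \<and> V \<subseteq>\<^sub>M U) \<Longrightarrow> U \<in>\<^sub>M T"
    and "\<And>U V. U \<in>\<^sub>M T \<Longrightarrow> V \<in>\<^sub>M T \<Longrightarrow> inter U V \<in>\<^sub>M T"
  shows "top_space X T"
  unfolding top_space_def
proof (intro conjI allI impI)
  show "T \<subseteq>\<^sub>M pow X" using assms(1) by (simp add: sub_def)
  show "empty \<in>\<^sub>M T" by (rule assms(3)) (auto simp: sub_def)
  fix G assume "G \<subseteq>\<^sub>M T"
  then have G: "V \<in>\<^sub>M T" if "V \<in>\<^sub>M G" for V using that mem_sub by blast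
  show "union G \<in>\<^sub>M T"
  proof (rule assms(3))
    show "union G \<subseteq>\<^sub>M X" using G assms(1) mem_sub unfolding sub_def mem_union by blast
    show "\<exists>V. V \<in>\<^sub>M T \<and> x \<in>\<^sub>M V \<and> V \<subseteq>\<^sub>M union G" if "x \<in>\<^sub>M union G" for x
      using that G unfolding sub_def mem_union by blast
  qed
qed (use assms in auto)

lemma top_space_subtop:
  assumes top: "top_space X T" and A: "A \<subseteq>\<^sub>M X"
  shows "top_space A (subtop T A)"
proof (rule top_spaceI)
  note iff = mem_subtop_iff[OF top A]
  show "U \<subseteq>\<^sub>M A" if "U \<in>\<^sub>M subtop T A" for U using that iff by blast
  have "A = inter X A" using A by (subst ext_iff) (auto simp: sub_def)
  then show "A \<in>\<^sub>M subtop T A" using top unfolding mem_subtop top_space_def by blast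
  show "U \<in>\<^sub>M subtop T A"
    if U: "U \<subseteq>\<^sub>M A" and nhd: "\<And>x. x \<in>\<^sub>M U \<Longrightarrow> \<exists>V. V \<in>\<^sub>M subtop T A \<and> x \<in>\<^sub>M V \<and> V \<subseteq>\<^sub>M U" for U
    unfolding iff
  proof (intro conjI allI impI U)
    fix x assume "x \<in>\<^sub>M U"
    then obtain V where V: "V \<in>\<^sub>M subtop T A" "x \<in>\<^sub>M V" "V \<subseteq>\<^sub>M U" using nhd by blast
    then obtain W where W: "W \<in>\<^sub>M T" "x \<in>\<^sub>M W" "inter W A \<subseteq>\<^sub>M V" unfolding iff by blast
    with V(3) have "inter W A \<subseteq>\<^sub>M U" unfolding sub_def by blast
    with W show "\<exists>W. W \<in>\<^sub>M T \<and> x \<in>\<^sub>M W \<and> inter W A \<subseteq>\<^sub>M U" by blast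
  qed
  show "inter U V \<in>\<^sub>M subtop T A" if UV: "U \<in>\<^sub>M subtop T A" "V \<in>\<^sub>M subtop T A" for U V
  proof -
    obtain U' V' where "U' \<in>\<^sub>M T" "V' \<in>\<^sub>M T" "U = inter U' A" "V = inter V' A"
      using UV unfolding mem_subtop by blast
    moreover have "inter (inter U' A) (inter V' A) = inter (inter U' V') A" by (subst ext_iff) auto
    ultimately show ?thesis unfolding mem_subtop using open_inter[OF top] by metis
  qed
qed

lemma definable_continuous [definable_intros]:
  "definable_term t \<Longrightarrow> definable (\<lambda>e. continuous X T Y S (t e))"
  by (rule definable_subst1) (unfold continuous_def, intro definable_intros)

lemma mem_Cont [simp]: "f \<in>\<^sub>M Cont X T Y S \<longleftrightarrow> continuous X T Y S f"
  unfolding Cont_def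
proof (rule mem_coll)
  show "definable (\<lambda>e. continuous X T Y S (e 0))" by (intro definable_intros)
  show "f \<in>\<^sub>M funs X Y" if "continuous X T Y S f" for f using that by (simp add: continuous_def)
qed

lemma continuous_comp:
  "continuous X T Y S f \<Longrightarrow> continuous Y S Z Q g \<Longrightarrow> continuous X T Z Q (comp g f)"
  unfolding continuous_def preimage_comp using is_fun_comp by blast

lemma preimage_diff:
  assumes "is_fun f X Y"
  shows "preimage f (diff Y V) = diff X (preimage f V)"
proof (rule eqI)
  fix x assume "x \<in>\<^sub>M preimage f (diff Y V)"
  then obtain y where y: "pair x y \<in>\<^sub>M f" "\<not> y \<in>\<^sub>M V" by auto
  then have "\<not> x \<in>\<^sub>M preimage f V" using is_fun_unique[OF assms, of x] by auto
  then show "x \<in>\<^sub>M diff X (preimage f V)" using is_fun_pairD[OF assms y(1)] by simp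
next
  fix x assume x: "x \<in>\<^sub>M diff X (preimage f V)"
  then obtain y where "y \<in>\<^sub>M Y" "pair x y \<in>\<^sub>M f" using is_fun_ex[OF assms, of x] by auto
  then show "x \<in>\<^sub>M preimage f (diff Y V)" using x by auto
qed

lemma preimage_CO:
  assumes f: "continuous X T Y S f" and V: "V \<in>\<^sub>M CO Y S"
  shows "preimage f V \<in>\<^sub>M CO X T"
proof -
  have "preimage f V \<in>\<^sub>M T" "preimage f (diff Y V) \<in>\<^sub>M T" "is_fun f X Y"
    using assms unfolding mem_CO continuous_def by blast+
  then show ?thesis unfolding mem_CO by (simp add: preimage_diff)
qed

end

section \<open>Ultrafilters of clopen sets\<close>

locale zero_dim_T1 = ZF mem
  for mem :: "'v \<Rightarrow> 'v \<Rightarrow> bool"  (infix "\<in>\<^sub>M" 50) +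
  fixes X T :: 'v
  assumes zd: "zero_dim_T1_space X T"
begin

lemma top: "top_space X T"
  using zd unfolding zero_dim_T1_space_def by blast

lemma clopen_sub: "A \<in>\<^sub>M CO X T \<Longrightarrow> A \<subseteq>\<^sub>M X"
  using open_sub[OF top] by (simp add: mem_CO)

lemma definable_CO_filter [definable_intros]:
  "definable_term t \<Longrightarrow> definable (\<lambda>e. CO_filter X T (t e))"
  by (rule definable_subst1) (unfold CO_filter_def, intro definable_intros)

lemma definable_CO_ultrafilter [definable_intros]:
  "definable_term t \<Longrightarrow> definable (\<lambda>e. CO_ultrafilter X T (t e))"
  by (rule definable_subst1) (unfold CO_ultrafilter_def, intro definable_intros)

lemma
  assumes "CO_ultrafilter X T p"
  shows ultra_sub: "A \<in>\<^sub>M p \<Longrightarrow> A \<in>\<^sub>M CO X T"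
    and ultra_empty: "\<not> empty \<in>\<^sub>M p"
    and ultra_inter: "A \<in>\<^sub>M p \<Longrightarrow> B \<in>\<^sub>M p \<Longrightarrow> inter A B \<in>\<^sub>M p"
    and ultra_up: "A \<in>\<^sub>M p \<Longrightarrow> B \<in>\<^sub>M CO X T \<Longrightarrow> A \<subseteq>\<^sub>M B \<Longrightarrow> B \<in>\<^sub>M p"
  using assms mem_sub[of p "CO X T" A] unfolding CO_ultrafilter_def CO_filter_def by blast+

lemma nonempty_ex: "a \<noteq> empty \<Longrightarrow> \<exists>x. x \<in>\<^sub>M a"
  by (metis ext_iff mem_empty)

text \<open>
If \<open>X - A\<close> is not in \<open>p\<close>, then \<open>A\<close> meets every member of \<open>p\<close>, so \<open>p\<close> and \<open>A\<close> generate a filter, which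
maximality forces to be \<open>p\<close> itself.
\<close>

lemma ultra_prime:
  assumes p: "CO_ultrafilter X T p" and A: "A \<in>\<^sub>M CO X T"
  shows "A \<in>\<^sub>M p \<or> diff X A \<in>\<^sub>M p"
proof (rule disjCI)
  assume no: "\<not> diff X A \<in>\<^sub>M p"
  \<comment> \<open>the filter generated by \<open>p\<close> and \<open>A\<close>\<close>
  have "definable (\<lambda>e. \<exists>C. C \<in>\<^sub>M p \<and> inter C A \<subseteq>\<^sub>M e 0)" by (intro definable_intros)
  then obtain q where q: "\<And>B. B \<in>\<^sub>M q \<longleftrightarrow> B \<in>\<^sub>M CO X T \<and> (\<exists>C. C \<in>\<^sub>M p \<and> inter C A \<subseteq>\<^sub>M B)"
    using separation_definable[of "\<lambda>B. \<exists>C. C \<in>\<^sub>M p \<and> inter C A \<subseteq>\<^sub>M B" "CO X T"] by blast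
  have pq: "p \<subseteq>\<^sub>M q"
  proof (rule subI)
    fix C assume "C \<in>\<^sub>M p"
    moreover have "inter C A \<subseteq>\<^sub>M C" by (simp add: sub_def)
    ultimately show "C \<in>\<^sub>M q" using q ultra_sub[OF p] by blast
  qed
  obtain C where C: "C \<in>\<^sub>M p"
    using p nonempty_ex unfolding CO_ultrafilter_def CO_filter_def by blast
  have "inter C A \<subseteq>\<^sub>M A" by (simp add: sub_def)
  then have Aq: "A \<in>\<^sub>M q" using q A C by blast
  have "CO_filter X T q"
    unfolding CO_filter_def
  proof (intro conjI allI impI)
    show "q \<subseteq>\<^sub>M CO X T" using q by (simp add: sub_def)
    show "q \<noteq> empty" using Aq by auto
    show "\<not> empty \<in>\<^sub>M q"
    proof
      assume "empty \<in>\<^sub>M q"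
      then obtain C where C: "C \<in>\<^sub>M p" "inter C A \<subseteq>\<^sub>M empty" using q by blast
      then have "C \<subseteq>\<^sub>M diff X A"
        using clopen_sub[OF ultra_sub[OF p C(1)]] by (auto simp: sub_def)
      then show False using no C ultra_up[OF p] CO_compl[OF top A] by blast
    qed
    show "inter B D \<in>\<^sub>M q" if BD: "B \<in>\<^sub>M q \<and> D \<in>\<^sub>M q" for B D
    proof -
      obtain C where C: "C \<in>\<^sub>M p" "inter C A \<subseteq>\<^sub>M B" "B \<in>\<^sub>M CO X T" using BD q by blast
      obtain E where E: "E \<in>\<^sub>M p" "inter E A \<subseteq>\<^sub>M D" "D \<in>\<^sub>M CO X T" using BD q by blast
      have "inter (inter C E) A \<subseteq>\<^sub>M inter B D" using C(2) E(2) by (simp add: sub_def)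
      then show ?thesis
        using q ultra_inter[OF p C(1) E(1)] CO_inter[OF top C(3) E(3)] by blast
    qed
    show "D \<in>\<^sub>M q" if "B \<in>\<^sub>M q \<and> D \<in>\<^sub>M CO X T \<and> B \<subseteq>\<^sub>M D" for B D
      using that q unfolding sub_def by blast
  qed
  then have "q = p" using pq p unfolding CO_ultrafilter_def by blast
  then show "A \<in>\<^sub>M p" using Aq by simp
qed

lemma ultra_compl: "CO_ultrafilter X T p \<Longrightarrow> A \<in>\<^sub>M p \<Longrightarrow> \<not> diff X A \<in>\<^sub>M p"
proof
  assume p: "CO_ultrafilter X T p" "A \<in>\<^sub>M p" "diff X A \<in>\<^sub>M p"
  moreover have "inter A (diff X A) = empty" by (subst ext_iff) auto
  ultimately show False using ultra_inter[OF p] ultra_empty[OF p(1)] by simp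
qed

lemma prime_filter_ultra:
  assumes p: "CO_filter X T p" and prime: "\<And>A. A \<in>\<^sub>M CO X T \<Longrightarrow> A \<in>\<^sub>M p \<or> diff X A \<in>\<^sub>M p"
  shows "CO_ultrafilter X T p"
  unfolding CO_ultrafilter_def
proof (intro conjI allI impI p)
  fix q assume q: "CO_filter X T q \<and> p \<subseteq>\<^sub>M q"
  show "q = p"
  proof (rule eqI)
    fix A assume A: "A \<in>\<^sub>M q"
    then have co: "A \<in>\<^sub>M CO X T" using q mem_sub unfolding CO_filter_def by blast
    show "A \<in>\<^sub>M p"
    proof (rule ccontr)
      assume "\<not> A \<in>\<^sub>M p"
      then have "diff X A \<in>\<^sub>M q" using prime[OF co] q mem_sub by blast
      then have "inter A (diff X A) \<in>\<^sub>M q" using A q unfolding CO_filter_def by blast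
      moreover have "inter A (diff X A) = empty" by (subst ext_iff) auto
      ultimately show False using q unfolding CO_filter_def by simp
    qed
  qed (use q mem_sub in blast)
qed

text \<open>
The prime ideal theorem for the clopen algebra, phrased through covers: passing to complements, \<open>G\<close>
becomes a family with the finite intersection property and \<open>p\<close> an ultrafilter extending it.
\<close>

definition ultrafilter_existence :: bool where
  "ultrafilter_existence \<longleftrightarrow> (\<forall>G. G \<subseteq>\<^sub>M CO X T \<and>
     (\<forall>F. F \<subseteq>\<^sub>M G \<and> is_finite F \<longrightarrow> union F \<noteq> X) \<longrightarrow>
     (\<exists>p. CO_ultrafilter X T p \<and> (\<forall>A. A \<in>\<^sub>M p \<longrightarrow> \<not> A \<in>\<^sub>M G)))"

end

section \<open>Dense maps that lift clopen sets\<close>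

text \<open>
What the Wallman space, the evaluation extension, and any compactification that extends the
two-valued maps have in common.
\<close>

locale clopen_lifting = zero_dim_T1 mem X T
  for mem :: "'v \<Rightarrow> 'v \<Rightarrow> bool"  (infix "\<in>\<^sub>M" 50) and X T +
  fixes Y S h :: 'v
  assumes topY: "top_space Y S"
    and h: "continuous X T Y S h"
    and dense: "\<And>U y. U \<in>\<^sub>M S \<Longrightarrow> y \<in>\<^sub>M U \<Longrightarrow> \<exists>x. x \<in>\<^sub>M preimage h U"
    and lift: "\<And>A. A \<in>\<^sub>M CO X T \<Longrightarrow> \<exists>V. V \<in>\<^sub>M CO Y S \<and> preimage h V = A"
begin

lemma h_fun: "is_fun h X Y"
  using h unfolding continuous_def by blast

lemma clopenY_sub: "V \<in>\<^sub>M CO Y S \<Longrightarrow> V \<subseteq>\<^sub>M Y"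
  using open_sub[OF topY] by (simp add: mem_CO)

text \<open>
The open set \<open>V - W\<close> contains no point of the dense image of \<open>X\<close>.
\<close>

lemma lift_mono:
  assumes "V \<in>\<^sub>M CO Y S" "W \<in>\<^sub>M CO Y S" "preimage h V \<subseteq>\<^sub>M preimage h W"
  shows "V \<subseteq>\<^sub>M W"
proof (rule subI, rule ccontr)
  fix y assume y: "y \<in>\<^sub>M V" "\<not> y \<in>\<^sub>M W"
  have "inter V (diff Y W) \<in>\<^sub>M S" using assms open_inter[OF topY] by (simp add: mem_CO)
  moreover have "y \<in>\<^sub>M inter V (diff Y W)" using y clopenY_sub[OF assms(1)] by (simp add: sub_def)
  ultimately obtain x where "x \<in>\<^sub>M preimage h (inter V (diff Y W))" using dense by blast
  then obtain z where z: "pair x z \<in>\<^sub>M h" "z \<in>\<^sub>M V" "\<not> z \<in>\<^sub>M W" by auto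
  then have "x \<in>\<^sub>M preimage h V" by auto
  then obtain w where "pair x w \<in>\<^sub>M h" "w \<in>\<^sub>M W" using assms(3) by (auto simp: sub_def)
  then show False using z is_fun_unique[OF h_fun, of x z w] by simp
qed

lemma lift_unique:
  "V \<in>\<^sub>M CO Y S \<Longrightarrow> W \<in>\<^sub>M CO Y S \<Longrightarrow> preimage h V = preimage h W \<Longrightarrow> V = W"
  using lift_mono[of V W] lift_mono[of W V] by (auto simp: sub_def intro!: eqI)

text \<open>
If \<open>y\<close> were in no lift, the intersection of the complements of the finitely many lifts would be a
neighbourhood of \<open>y\<close> without a point of the dense image of \<open>X\<close>. That neighbourhood is built by
induction over the cover.
\<close>

lemma cover_lift:
  assumes fin: "is_finite F" and F: "F \<subseteq>\<^sub>M CO X T" "union F = X" and y: "y \<in>\<^sub>M Y"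
  shows "\<exists>V. V \<in>\<^sub>M CO Y S \<and> preimage h V \<in>\<^sub>M F \<and> y \<in>\<^sub>M V"
proof (rule ccontr)
  assume no: "\<not> ?thesis"
  let ?P = "\<lambda>a. a \<subseteq>\<^sub>M F \<longrightarrow>
    (\<exists>N. N \<in>\<^sub>M S \<and> y \<in>\<^sub>M N \<and> (\<forall>A x. A \<in>\<^sub>M a \<and> x \<in>\<^sub>M A \<longrightarrow> \<not> x \<in>\<^sub>M preimage h N))"
  have "?P F"
  proof (rule finite_induct_definable[OF _ fin, of ?P])
    show "definable (\<lambda>e. ?P (e 0))" by (intro definable_intros)
    show "?P empty" using y topY unfolding top_space_def by auto
    fix A a assume IH: "?P a"
    show "?P (ins A a)"
    proof
      assume sub: "ins A a \<subseteq>\<^sub>M F"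
      then have "a \<subseteq>\<^sub>M F" "A \<in>\<^sub>M F" by (auto simp: sub_def)
      then obtain N where N: "N \<in>\<^sub>M S" "y \<in>\<^sub>M N"
          "\<And>B x. B \<in>\<^sub>M a \<Longrightarrow> x \<in>\<^sub>M B \<Longrightarrow> \<not> x \<in>\<^sub>M preimage h N" using IH by blast
      obtain V where V: "V \<in>\<^sub>M CO Y S" "preimage h V = A"
        using lift \<open>A \<in>\<^sub>M F\<close> mem_sub[OF F(1)] by blast
      then have yV: "\<not> y \<in>\<^sub>M V" using no \<open>A \<in>\<^sub>M F\<close> by blast
      \<comment> \<open>cutting away the lift \<open>V\<close> of \<open>A\<close> removes all images of points of \<open>A\<close>\<close>
      let ?N = "inter N (diff Y V)"
      have "?N \<in>\<^sub>M S" using V N(1) open_inter[OF topY] by (simp add: mem_CO)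
      moreover have "y \<in>\<^sub>M ?N" using y yV N(2) by simp
      moreover have "\<not> x \<in>\<^sub>M preimage h ?N" if "B \<in>\<^sub>M ins A a" "x \<in>\<^sub>M B" for B x
      proof
        assume "x \<in>\<^sub>M preimage h ?N"
        then obtain z where z: "pair x z \<in>\<^sub>M h" "z \<in>\<^sub>M N" "\<not> z \<in>\<^sub>M V" by auto
        then have "\<not> x \<in>\<^sub>M preimage h V" using is_fun_unique[OF h_fun z(1)] by (metis mem_preimage)
        then have "B \<in>\<^sub>M a" using that V(2) by auto
        moreover have "x \<in>\<^sub>M preimage h N" using z by auto
        ultimately show False using N(3)[of B x] that(2) by blast
      qed
      ultimately show "\<exists>N. N \<in>\<^sub>M S \<and> y \<in>\<^sub>M N \<and>
          (\<forall>B x. B \<in>\<^sub>M ins A a \<and> x \<in>\<^sub>M B \<longrightarrow> \<not> x \<in>\<^sub>M preimage h N)" by blast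
    qed
  qed
  then obtain N where N: "N \<in>\<^sub>M S" "y \<in>\<^sub>M N"
    "\<And>A x. A \<in>\<^sub>M F \<Longrightarrow> x \<in>\<^sub>M A \<Longrightarrow> \<not> x \<in>\<^sub>M preimage h N" by (auto simp: sub_def)
  then obtain x where x: "x \<in>\<^sub>M preimage h N" using dense by blast
  then have "x \<in>\<^sub>M union F" using is_fun_pairD[OF h_fun, of x] F(2) by auto
  then show False using N(3) x by (simp only: mem_union) blast
qed

text \<open>
The lifts of \<open>G\<close> cannot cover \<open>Y\<close>, since a finite subcover would restrict to a finite subcover of
\<open>X\<close> from \<open>G\<close>. A point \<open>y\<close> outside of them yields the ultrafilter of those clopen sets whose lift
contains \<open>y\<close>.
\<close>

lemma compact_imp_ultrafilter_existence:
  assumes "compact Y S"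
  shows ultrafilter_existence
  unfolding ultrafilter_existence_def
proof (intro allI impI, elim conjE)
  fix G assume G: "G \<subseteq>\<^sub>M CO X T" and nofin: "\<forall>F. F \<subseteq>\<^sub>M G \<and> is_finite F \<longrightarrow> union F \<noteq> X"
  have "definable (\<lambda>e. preimage h (e 0) \<in>\<^sub>M G)" by (intro definable_intros)
  then obtain H where H: "\<And>V. V \<in>\<^sub>M H \<longleftrightarrow> V \<in>\<^sub>M CO Y S \<and> preimage h V \<in>\<^sub>M G"
    using separation_definable[of "\<lambda>V. preimage h V \<in>\<^sub>M G" "CO Y S"] by blast
  have HS: "H \<subseteq>\<^sub>M S" using H by (simp add: sub_def mem_CO)
  have "union H \<noteq> Y"
  proof
    assume "union H = Y"
    then obtain E where E: "E \<subseteq>\<^sub>M H" "is_finite E" "union E = Y"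
      using assms HS unfolding compact_def by blast
    have "definable (\<lambda>e. e (Suc 0) = preimage h (e 0))" by (intro definable_intros)
    then obtain F where F: "is_finite F" "\<And>V. V \<in>\<^sub>M E \<Longrightarrow> \<exists>A. A \<in>\<^sub>M F \<and> A = preimage h V"
        "\<And>A. A \<in>\<^sub>M F \<Longrightarrow> \<exists>V. V \<in>\<^sub>M E \<and> A = preimage h V"
      using finite_collection[of "\<lambda>V A. A = preimage h V", OF _ E(2)] by auto
    have FG: "F \<subseteq>\<^sub>M G" using F(3) H E(1) by (auto simp: sub_def)
    have "union F = X"
    proof (rule eqI)
      fix x assume "x \<in>\<^sub>M union F"
      then show "x \<in>\<^sub>M X" using FG G clopen_sub unfolding sub_def mem_union by blast
    next
      fix x assume "x \<in>\<^sub>M X"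
      then obtain y where y: "y \<in>\<^sub>M Y" "pair x y \<in>\<^sub>M h" using is_fun_ex[OF h_fun] by blast
      then obtain V where V: "V \<in>\<^sub>M E" "y \<in>\<^sub>M V" using E(3) by (metis mem_union)
      then have "x \<in>\<^sub>M preimage h V" using y by auto
      then show "x \<in>\<^sub>M union F" using F(2)[OF V(1)] unfolding mem_union by blast
    qed
    then show False using nofin FG F(1) by blast
  qed
  moreover have "union H \<subseteq>\<^sub>M Y" using H clopenY_sub unfolding sub_def mem_union by blast
  ultimately obtain y where y: "y \<in>\<^sub>M Y" "\<not> y \<in>\<^sub>M union H"
    unfolding ext_iff[of "union H"] sub_def by blast
  have "definable (\<lambda>e. \<exists>V. V \<in>\<^sub>M CO Y S \<and> preimage h V = e 0 \<and> y \<in>\<^sub>M V)"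
    by (intro definable_intros)
  then obtain p where p: "\<And>A. A \<in>\<^sub>M p \<longleftrightarrow>
      A \<in>\<^sub>M CO X T \<and> (\<exists>V. V \<in>\<^sub>M CO Y S \<and> preimage h V = A \<and> y \<in>\<^sub>M V)"
    using separation_definable[of "\<lambda>A. \<exists>V. V \<in>\<^sub>M CO Y S \<and> preimage h V = A \<and> y \<in>\<^sub>M V" "CO X T"]
    by blast
  have mem_p: "preimage h V \<in>\<^sub>M p \<longleftrightarrow> y \<in>\<^sub>M V" if "V \<in>\<^sub>M CO Y S" for V
    using p lift_unique that preimage_CO[OF h that] by metis
  have "CO_ultrafilter X T p"
  proof (rule prime_filter_ultra)
    show "A \<in>\<^sub>M p \<or> diff X A \<in>\<^sub>M p" if "A \<in>\<^sub>M CO X T" for A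
    proof -
      obtain V where V: "V \<in>\<^sub>M CO Y S" "preimage h V = A" using lift \<open>A \<in>\<^sub>M CO X T\<close> by blast
      have "preimage h (diff Y V) = diff X A" using preimage_diff[OF h_fun] V(2) by simp
      then show ?thesis
        using mem_p[OF V(1)] mem_p[OF CO_compl[OF topY V(1)]] V(2) y(1) by auto
    qed
    show "CO_filter X T p"
      unfolding CO_filter_def
    proof (intro conjI allI impI)
      show "p \<subseteq>\<^sub>M CO X T" using p by (simp add: sub_def)
      have "preimage h Y \<in>\<^sub>M p" using mem_p[OF CO_carrier[OF topY]] y(1) by blast
      then show "p \<noteq> empty" by auto
      show "\<not> empty \<in>\<^sub>M p"
      proof
        assume "empty \<in>\<^sub>M p"
        then obtain V where "V \<in>\<^sub>M CO Y S" "preimage h V = empty" "y \<in>\<^sub>M V" using p by blast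
        then show False using dense[of V y] by (simp only: mem_CO mem_empty) blast
      qed
      fix A B
      show "inter A B \<in>\<^sub>M p" if AB: "A \<in>\<^sub>M p \<and> B \<in>\<^sub>M p"
      proof -
        obtain V where V: "V \<in>\<^sub>M CO Y S" "preimage h V = A" "y \<in>\<^sub>M V" using p AB by blast
        obtain W where W: "W \<in>\<^sub>M CO Y S" "preimage h W = B" "y \<in>\<^sub>M W" using p AB by blast
        have "preimage h (inter V W) = inter A B"
        proof (rule eqI)
          fix x assume "x \<in>\<^sub>M preimage h (inter V W)"
          then show "x \<in>\<^sub>M inter A B" unfolding V(2)[symmetric] W(2)[symmetric] by auto
        next
          fix x assume "x \<in>\<^sub>M inter A B"
          then obtain z w where "pair x z \<in>\<^sub>M h" "z \<in>\<^sub>M V" "pair x w \<in>\<^sub>M h" "w \<in>\<^sub>M W"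
            unfolding V(2)[symmetric] W(2)[symmetric] by auto
          then show "x \<in>\<^sub>M preimage h (inter V W)" using is_fun_unique[OF h_fun, of x z w] by auto
        qed
        then show ?thesis using mem_p[OF CO_inter[OF topY V(1) W(1)]] V(3) W(3) by simp
      qed
      show "B \<in>\<^sub>M p" if AB: "A \<in>\<^sub>M p \<and> B \<in>\<^sub>M CO X T \<and> A \<subseteq>\<^sub>M B"
      proof -
        obtain V where V: "V \<in>\<^sub>M CO Y S" "preimage h V = A" "y \<in>\<^sub>M V" using p AB by blast
        obtain W where W: "W \<in>\<^sub>M CO Y S" "preimage h W = B" using lift AB by blast
        have "y \<in>\<^sub>M W" using lift_mono[OF V(1) W(1)] V W AB mem_sub by blast
        then show ?thesis using mem_p[OF W(1)] W(2) by simp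
      qed
    qed
  qed
  moreover have "\<not> A \<in>\<^sub>M G" if "A \<in>\<^sub>M p" for A
  proof
    assume "A \<in>\<^sub>M G"
    moreover obtain V where "V \<in>\<^sub>M CO Y S" "preimage h V = A" "y \<in>\<^sub>M V" using p \<open>A \<in>\<^sub>M p\<close> by blast
    ultimately have "V \<in>\<^sub>M H" "y \<in>\<^sub>M V" using H by auto
    then show False using y(2) by auto
  qed
  ultimately show "\<exists>p. CO_ultrafilter X T p \<and> (\<forall>A. A \<in>\<^sub>M p \<longrightarrow> \<not> A \<in>\<^sub>M G)" by blast
qed

text \<open>
Given an open cover of \<open>Y\<close>, consider the clopen subsets of \<open>X\<close> whose lift fits into a member of the
cover. An ultrafilter avoiding them all would be realized by a point of \<open>Y\<close>, and a clopen
neighbourhood of this point inside a member of the cover contradicts avoidance. So finitely many of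
them cover \<open>X\<close>, their lifts cover \<open>Y\<close>, and finite choice picks the members of the cover.
\<close>

lemma ultrafilter_existence_imp_compact:
  assumes base: "is_base (CO Y S) S"
    and realize: "\<And>p. CO_ultrafilter X T p \<Longrightarrow> \<exists>y. y \<in>\<^sub>M Y \<and>
      (\<forall>A. A \<in>\<^sub>M p \<longrightarrow> (\<exists>V. V \<in>\<^sub>M CO Y S \<and> preimage h V = A \<and> y \<in>\<^sub>M V))"
    and ultrafilter_existence
  shows "compact Y S"
  unfolding compact_def
proof (intro allI impI, elim conjE)
  fix G assume G: "G \<subseteq>\<^sub>M S" "union G = Y"
  let ?R = "\<lambda>A U. U \<in>\<^sub>M G \<and> (\<exists>V. V \<in>\<^sub>M CO Y S \<and> preimage h V = A \<and> V \<subseteq>\<^sub>M U)"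
  have R: "definable (\<lambda>e. ?R (e 0) (e (Suc 0)))" by (intro definable_intros)
  have "definable (\<lambda>e. \<exists>U. ?R (e 0) U)" by (intro definable_intros)
  then obtain C where C: "\<And>A. A \<in>\<^sub>M C \<longleftrightarrow> A \<in>\<^sub>M CO X T \<and> (\<exists>U. ?R A U)"
    using separation_definable[of "\<lambda>A. \<exists>U. ?R A U" "CO X T"] by blast
  have CCO: "C \<subseteq>\<^sub>M CO X T" using C by (simp add: sub_def)
  have "\<exists>F. F \<subseteq>\<^sub>M C \<and> is_finite F \<and> union F = X"
  proof (rule ccontr)
    assume "\<not> (\<exists>F. F \<subseteq>\<^sub>M C \<and> is_finite F \<and> union F = X)"
    then obtain p where p: "CO_ultrafilter X T p" "\<And>A. A \<in>\<^sub>M p \<Longrightarrow> \<not> A \<in>\<^sub>M C"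
      using assms(3) CCO unfolding ultrafilter_existence_def by blast
    obtain y where y: "y \<in>\<^sub>M Y"
      "\<And>A. A \<in>\<^sub>M p \<Longrightarrow> \<exists>V. V \<in>\<^sub>M CO Y S \<and> preimage h V = A \<and> y \<in>\<^sub>M V"
      using realize[OF p(1)] by blast
    obtain U where U: "U \<in>\<^sub>M G" "y \<in>\<^sub>M U" using y(1) G(2) by (metis mem_union)
    obtain V where V: "V \<in>\<^sub>M CO Y S" "y \<in>\<^sub>M V" "V \<subseteq>\<^sub>M U"
      using base_nhd[OF base mem_sub[OF G(1) U(1)] U(2)] by blast
    let ?A = "preimage h V"
    have A: "?A \<in>\<^sub>M CO X T" using preimage_CO[OF h V(1)] .
    have "?A \<in>\<^sub>M C" using C A U(1) V by blast
    then have "diff X ?A \<in>\<^sub>M p" using ultra_prime[OF p(1) A] p(2) by blast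
    then obtain W where W: "W \<in>\<^sub>M CO Y S" "preimage h W = diff X ?A" "y \<in>\<^sub>M W" using y(2) by blast
    have "W = diff Y V"
      using W lift_unique CO_compl[OF topY V(1)] preimage_diff[OF h_fun] by simp
    then show False using W(3) V(2) by simp
  qed
  then obtain F where F: "F \<subseteq>\<^sub>M C" "is_finite F" "union F = X" by blast
  have exR: "\<exists>U. ?R A U" if "A \<in>\<^sub>M F" for A using C mem_sub[OF F(1) that] by blast
  obtain H where H: "is_finite H" "\<And>A. A \<in>\<^sub>M F \<Longrightarrow> \<exists>U. U \<in>\<^sub>M H \<and> ?R A U"
      "\<And>U. U \<in>\<^sub>M H \<Longrightarrow> \<exists>A. A \<in>\<^sub>M F \<and> ?R A U"
    by (rule finite_collection[of ?R, OF R F(2) exR]) blast+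
  have HG: "H \<subseteq>\<^sub>M G" using H(3) by (auto simp: sub_def)
  have "union H = Y"
  proof (rule eqI)
    fix y assume "y \<in>\<^sub>M union H"
    then show "y \<in>\<^sub>M Y" using HG unfolding G(2)[symmetric] sub_def mem_union by blast
  next
    fix y assume "y \<in>\<^sub>M Y"
    moreover have "F \<subseteq>\<^sub>M CO X T" using F(1) CCO unfolding sub_def by blast
    ultimately obtain V where V: "V \<in>\<^sub>M CO Y S" "preimage h V \<in>\<^sub>M F" "y \<in>\<^sub>M V"
      using cover_lift F by blast
    obtain U W where U: "U \<in>\<^sub>M H" "W \<in>\<^sub>M CO Y S" "preimage h W = preimage h V" "W \<subseteq>\<^sub>M U"
      using H(2)[OF V(2)] by blast
    then have "y \<in>\<^sub>M U" using V lift_unique mem_sub by metis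
    then show "y \<in>\<^sub>M union H" using U(1) by auto
  qed
  then show "\<exists>F. F \<subseteq>\<^sub>M G \<and> is_finite F \<and> union F = Y" using H(1) HG by blast
qed

text \<open>
Two points of \<open>X\<close> are separated by a clopen set, and the lift of that set separates their images.
\<close>

lemma h_inj: "pair x y \<in>\<^sub>M h \<Longrightarrow> pair x' y \<in>\<^sub>M h \<Longrightarrow> x = x'"
proof (rule ccontr)
  assume hx: "pair x y \<in>\<^sub>M h" "pair x' y \<in>\<^sub>M h" and "x \<noteq> x'"
  then obtain A where A: "A \<in>\<^sub>M CO X T" "x \<in>\<^sub>M A" "\<not> x' \<in>\<^sub>M A"
    using zero_dim_separate[OF zd] is_fun_pairD[OF h_fun] by blast
  obtain V where V: "preimage h V = A" using lift[OF A(1)] by blast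
  then obtain z where "pair x z \<in>\<^sub>M h" "z \<in>\<^sub>M V" using A(2) by auto
  then have "x' \<in>\<^sub>M preimage h V" using is_fun_unique[OF h_fun, of x z y] hx by auto
  then show False using A(3) V by simp
qed

text \<open>
The topology of \<open>X\<close> is generated by its clopen sets, and these are the traces of clopen subsets of
\<open>Y\<close>; this makes the injection \<open>h\<close> an embedding.
\<close>

lemma extension: "extension X T Y S h"
  unfolding extension_def embedding_def
proof (intro conjI topY h_fun)
  show "closure Y S (image h X) = Y"
  proof (rule eqI)
    fix y assume y: "y \<in>\<^sub>M Y"
    show "y \<in>\<^sub>M closure Y S (image h X)"
      unfolding mem_closure
    proof (intro conjI allI impI y)
      fix U assume "U \<in>\<^sub>M S \<and> y \<in>\<^sub>M U"
      then obtain x z where "z \<in>\<^sub>M U" "pair x z \<in>\<^sub>M h" using dense by (metis mem_preimage)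
      then show "\<exists>a. a \<in>\<^sub>M image h X \<and> a \<in>\<^sub>M U" using is_fun_pairD[OF h_fun] by auto
    qed
  qed (simp add: mem_closure)
  let ?I = "image h X"
  have fun_I: "is_fun h X ?I"
  proof (rule is_funI)
    fix p assume "p \<in>\<^sub>M h"
    then show "\<exists>x y. p = pair x y \<and> x \<in>\<^sub>M X \<and> y \<in>\<^sub>M ?I" using is_fun_memD[OF h_fun] by force
  qed (use is_fun_ex[OF h_fun] is_fun_unique[OF h_fun] in blast)+
  have bij: "is_bij h X ?I"
    unfolding is_bij_def using fun_I h_inj by auto
  have conv_fun: "is_fun (conv h) ?I X"
  proof (rule is_funI)
    fix p assume "p \<in>\<^sub>M conv h"
    then show "\<exists>y x. p = pair y x \<and> y \<in>\<^sub>M ?I \<and> x \<in>\<^sub>M X"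
      using is_fun_pairD[OF h_fun] unfolding mem_conv by force
  qed (use h_inj in auto)
  show "homeomorphism X T ?I (subtop S ?I) h"
    unfolding homeomorphism_def continuous_def
  proof (intro conjI allI impI bij fun_I conv_fun)
    fix V assume "V \<in>\<^sub>M subtop S ?I"
    then obtain U where U: "U \<in>\<^sub>M S" "V = inter U ?I" unfolding mem_subtop by blast
    have "preimage h V = preimage h U"
      unfolding U(2) using is_fun_pairD[OF h_fun] by (subst ext_iff) auto
    then show "preimage h V \<in>\<^sub>M T" using h U(1) unfolding continuous_def by simp
  next
    fix U assume U: "U \<in>\<^sub>M T"
    have I: "?I \<subseteq>\<^sub>M Y" using is_fun_pairD[OF h_fun] by (auto simp: sub_def)
    show "preimage (conv h) U \<in>\<^sub>M subtop S ?I"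
      unfolding mem_subtop_iff[OF topY I]
    proof (intro conjI allI impI)
      show "preimage (conv h) U \<subseteq>\<^sub>M ?I" using is_fun_pairD[OF h_fun] by (auto simp: sub_def)
      fix y assume "y \<in>\<^sub>M preimage (conv h) U"
      then obtain x where x: "x \<in>\<^sub>M U" "pair x y \<in>\<^sub>M h" by auto
      then obtain A where A: "A \<in>\<^sub>M CO X T" "x \<in>\<^sub>M A" "A \<subseteq>\<^sub>M U"
        using zero_dim_nhd[OF zd U] by blast
      obtain V where V: "V \<in>\<^sub>M CO Y S" "preimage h V = A" using lift[OF A(1)] by blast
      obtain z where "z \<in>\<^sub>M V" "pair x z \<in>\<^sub>M h" using A(2) V(2) by auto
      then have "y \<in>\<^sub>M V" using is_fun_unique[OF h_fun, of x y z] x(2) by simp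
      moreover have "inter V ?I \<subseteq>\<^sub>M preimage (conv h) U"
      proof (rule subI)
        fix z assume "z \<in>\<^sub>M inter V ?I"
        then obtain x where xz: "pair x z \<in>\<^sub>M h" "z \<in>\<^sub>M V" by auto
        then have "x \<in>\<^sub>M preimage h V" by auto
        then have "x \<in>\<^sub>M U" using V(2) mem_sub[OF A(3)] by simp
        then show "z \<in>\<^sub>M preimage (conv h) U" using xz by auto
      qed
      ultimately show "\<exists>V. V \<in>\<^sub>M S \<and> y \<in>\<^sub>M V \<and> inter V ?I \<subseteq>\<^sub>M preimage (conv h) U"
        using V(1) unfolding mem_CO by blast
    qed
  qed
qed

text \<open>
The value at \<open>y\<close> is the point \<open>k\<close> such that, for every clopen \<open>D\<close> containing \<open>k\<close>, the lift of
\<open>f\<^sup>-\<^sup>1[D]\<close> contains \<open>y\<close>. If there were no such \<open>k\<close>, the clopen sets \<open>D\<close> whose lifted preimage misses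
\<open>y\<close> would cover \<open>K\<close>; a finite subcover pulls back to a clopen cover of \<open>X\<close>, and its lifts cover
\<open>Y\<close>. Clopen sets separate the points of \<open>K\<close>, which gives uniqueness.
\<close>

lemma extend_continuous:
  assumes K: "zero_dim_T1_space K Q" "compact K Q" and f: "continuous X T K Q f"
  obtains g where "continuous Y S K Q g" "comp g h = f"
proof -
  have topK: "top_space K Q" using K(1) unfolding zero_dim_T1_space_def by blast
  have f_fun: "is_fun f X K" using f unfolding continuous_def by blast
  let ?L = "\<lambda>y D. \<exists>V. V \<in>\<^sub>M CO Y S \<and> preimage h V = preimage f D \<and> y \<in>\<^sub>M V"
  let ?R = "\<lambda>y k. \<forall>D. D \<in>\<^sub>M CO K Q \<and> k \<in>\<^sub>M D \<longrightarrow> ?L y D"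
  have compl: "\<not> ?L y (diff K D)" if "?L y D" for y D
  proof
    assume "?L y (diff K D)"
    then obtain W where W: "W \<in>\<^sub>M CO Y S" "preimage h W = preimage f (diff K D)" "y \<in>\<^sub>M W" by blast
    from \<open>?L y D\<close> obtain V where V: "V \<in>\<^sub>M CO Y S" "preimage h V = preimage f D" "y \<in>\<^sub>M V" by blast
    have "W = diff Y V"
      using W lift_unique CO_compl[OF topY V(1)] preimage_diff[OF h_fun] preimage_diff[OF f_fun] V(2)
      by simp
    then show False using W(3) V(3) by simp
  qed
  have R: "definable (\<lambda>e. ?R (e 0) (e (Suc 0)))" by (intro definable_intros)
  have ex: "\<exists>k. k \<in>\<^sub>M K \<and> ?R y k" if y: "y \<in>\<^sub>M Y" for y
  proof (rule ccontr)
    assume no: "\<not> (\<exists>k. k \<in>\<^sub>M K \<and> ?R y k)"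
    have "definable (\<lambda>e. \<not> ?L y (e 0))" by (intro definable_intros)
    then obtain G where G: "\<And>D. D \<in>\<^sub>M G \<longleftrightarrow> D \<in>\<^sub>M CO K Q \<and> \<not> ?L y D"
      using separation_definable[of "\<lambda>D. \<not> ?L y D" "CO K Q"] by blast
    have "G \<subseteq>\<^sub>M Q" using G by (simp add: sub_def mem_CO)
    moreover have "union G = K"
    proof (rule eqI)
      fix k assume "k \<in>\<^sub>M union G"
      then show "k \<in>\<^sub>M K" using G open_sub[OF topK] unfolding mem_union mem_CO sub_def by blast
    next
      fix k assume "k \<in>\<^sub>M K"
      then show "k \<in>\<^sub>M union G" using no G unfolding mem_union by blast
    qed
    ultimately obtain E where E: "E \<subseteq>\<^sub>M G" "is_finite E" "union E = K"
      using K(2) unfolding compact_def by blast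
    have "definable (\<lambda>e. e (Suc 0) = preimage f (e 0))" by (intro definable_intros)
    then obtain F where F: "is_finite F" "\<And>D. D \<in>\<^sub>M E \<Longrightarrow> \<exists>A. A \<in>\<^sub>M F \<and> A = preimage f D"
        "\<And>A. A \<in>\<^sub>M F \<Longrightarrow> \<exists>D. D \<in>\<^sub>M E \<and> A = preimage f D"
      using finite_collection[of "\<lambda>D A. A = preimage f D", OF _ E(2)] by auto
    have "F \<subseteq>\<^sub>M CO X T"
      using F(3) mem_sub[OF E(1)] G preimage_CO[OF f] by (metis subI)
    moreover have "union F = X"
    proof (rule eqI)
      fix x assume "x \<in>\<^sub>M union F"
      then show "x \<in>\<^sub>M X" using \<open>F \<subseteq>\<^sub>M CO X T\<close> clopen_sub unfolding sub_def mem_union by blast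
    next
      fix x assume "x \<in>\<^sub>M X"
      then obtain k where k: "k \<in>\<^sub>M K" "pair x k \<in>\<^sub>M f" using is_fun_ex[OF f_fun] by blast
      then obtain D where D: "D \<in>\<^sub>M E" "k \<in>\<^sub>M D" using E(3) by (metis mem_union)
      then have "x \<in>\<^sub>M preimage f D" using k by auto
      then show "x \<in>\<^sub>M union F" using F(2)[OF D(1)] unfolding mem_union by blast
    qed
    ultimately obtain V where V: "V \<in>\<^sub>M CO Y S" "preimage h V \<in>\<^sub>M F" "y \<in>\<^sub>M V"
      using cover_lift[OF F(1) _ _ y] by blast
    then obtain D where "D \<in>\<^sub>M E" "preimage h V = preimage f D" using F(3) by blast
    then show False using G mem_sub[OF E(1)] V by blast
  qed
  have unique: "k = l" if "k \<in>\<^sub>M K" "l \<in>\<^sub>M K" "?R y k" "?R y l" for y k l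
  proof (rule ccontr)
    assume "k \<noteq> l"
    then obtain D where D: "D \<in>\<^sub>M CO K Q" "k \<in>\<^sub>M D" "\<not> l \<in>\<^sub>M D"
      using zero_dim_separate[OF K(1) \<open>k \<in>\<^sub>M K\<close> \<open>l \<in>\<^sub>M K\<close>] by blast
    have "?L y D" using \<open>?R y k\<close> D by blast
    moreover have "?L y (diff K D)"
      using \<open>?R y l\<close> CO_compl[OF topK D(1)] D(3) \<open>l \<in>\<^sub>M K\<close> by simp
    ultimately show False using compl by blast
  qed
  obtain g where g_fun: "is_fun g Y K"
    and g: "\<And>y k. pair y k \<in>\<^sub>M g \<longleftrightarrow> y \<in>\<^sub>M Y \<and> k \<in>\<^sub>M K \<and> ?R y k"
    by (rule ex_fun[of ?R Y K, OF R]) (use ex unique in blast)+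
  have "preimage g W \<in>\<^sub>M S" if W: "W \<in>\<^sub>M Q" for W
  proof (rule openI[OF topY])
    fix y assume "y \<in>\<^sub>M preimage g W"
    then obtain k where k: "k \<in>\<^sub>M W" "pair y k \<in>\<^sub>M g" by auto
    obtain D where D: "D \<in>\<^sub>M CO K Q" "k \<in>\<^sub>M D" "D \<subseteq>\<^sub>M W" using zero_dim_nhd[OF K(1) W k(1)] by blast
    obtain V where V: "V \<in>\<^sub>M CO Y S" "preimage h V = preimage f D" "y \<in>\<^sub>M V"
      using g k(2) D by blast
    have "V \<subseteq>\<^sub>M preimage g W"
    proof (rule subI)
      fix z assume z: "z \<in>\<^sub>M V"
      then obtain l where l: "l \<in>\<^sub>M K" "pair z l \<in>\<^sub>M g"
        using is_fun_ex[OF g_fun] clopenY_sub[OF V(1)] mem_sub by blast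
      have "l \<in>\<^sub>M D"
      proof (rule ccontr)
        assume "\<not> l \<in>\<^sub>M D"
        then have "l \<in>\<^sub>M diff K D" using l(1) by simp
        moreover have "?R z l" using g l(2) by blast
        ultimately have "?L z (diff K D)" using CO_compl[OF topK D(1)] by blast
        moreover have "?L z D" using V z by blast
        ultimately show False using compl by blast
      qed
      then show "z \<in>\<^sub>M preimage g W" using l(2) D(3) by (auto simp: sub_def)
    qed
    then show "\<exists>V. V \<in>\<^sub>M S \<and> y \<in>\<^sub>M V \<and> V \<subseteq>\<^sub>M preimage g W" using V unfolding mem_CO by blast
  qed
  then have "continuous Y S K Q g" using g_fun unfolding continuous_def by blast
  moreover have "comp g h = f"
  proof (rule sym, rule is_fun_eqI[OF f_fun is_fun_comp[OF h_fun g_fun]])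
    fix x k assume x: "pair x k \<in>\<^sub>M f"
    then have xk: "x \<in>\<^sub>M X" "k \<in>\<^sub>M K" using is_fun_pairD[OF f_fun] by blast+
    obtain y where y: "y \<in>\<^sub>M Y" "pair x y \<in>\<^sub>M h" using is_fun_ex[OF h_fun xk(1)] by blast
    have "?L y D" if D: "D \<in>\<^sub>M CO K Q" "k \<in>\<^sub>M D" for D
    proof -
      obtain V where V: "V \<in>\<^sub>M CO Y S" "preimage h V = preimage f D"
        using lift[OF preimage_CO[OF f D(1)]] by blast
      have "x \<in>\<^sub>M preimage h V" unfolding V(2) using x D(2) by auto
      then obtain z where "z \<in>\<^sub>M V" "pair x z \<in>\<^sub>M h" by auto
      then show ?thesis using V is_fun_unique[OF h_fun y(2), of z] by blast
    qed
    then have "pair y k \<in>\<^sub>M g" using g y xk by blast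
    then show "pair x k \<in>\<^sub>M comp g h" using y(2) by auto
  qed
  ultimately show thesis using that by blast
qed

lemma banaschewskiI:
  assumes "zero_dim_T1_space Y S" "compact Y S"
  shows "banaschewski X T Y S h"
  unfolding banaschewski_def compactification_def mem_Cont
  using assms extension extend_continuous by (metis (no_types))

end

section \<open>The Wallman space\<close>

context zero_dim_T1
begin

lemma mem_wallman [simp]: "p \<in>\<^sub>M wallman X T \<longleftrightarrow> CO_ultrafilter X T p"
  unfolding wallman_def
proof (rule mem_coll)
  show "definable (\<lambda>e. CO_ultrafilter X T (e 0))" by (intro definable_intros)
  show "p \<in>\<^sub>M pow (CO X T)" if "CO_ultrafilter X T p" for p
    using that by (simp add: CO_ultrafilter_def CO_filter_def)
qed

text \<open>
The basic closed sets of the Wallman space; by \<open>ultra_prime\<close> they are open as well.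
\<close>

definition cell :: "'v \<Rightarrow> 'v" where
  "cell A = coll (\<lambda>p. p \<in>\<^sub>M wallman X T \<and> A \<in>\<^sub>M p)"

lemma ex_cell: "\<exists>c. \<forall>p. p \<in>\<^sub>M c \<longleftrightarrow> p \<in>\<^sub>M wallman X T \<and> A \<in>\<^sub>M p"
  by (rule separation_definable) (intro definable_intros)

lemma mem_cell [simp]: "p \<in>\<^sub>M cell A \<longleftrightarrow> CO_ultrafilter X T p \<and> A \<in>\<^sub>M p"
  unfolding cell_def using mem_coll_ex[OF ex_cell] by simp

lemma definable_term_cell [definable_intros]:
  "definable_term t \<Longrightarrow> definable_term (\<lambda>e. cell (t e))"
  by (rule definable_term_subst1)
    (unfold cell_def, intro definable_term_coll definable_intros ex_cell)

lemma mem_wallman_closed_base: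
  "D \<in>\<^sub>M wallman_closed_base X T \<longleftrightarrow> (\<exists>A. A \<in>\<^sub>M CO X T \<and> D = cell A)"
  unfolding wallman_closed_base_def cell_def[symmetric]
proof (rule mem_coll)
  show "definable (\<lambda>e. \<exists>A. A \<in>\<^sub>M CO X T \<and> e 0 = cell A)" by (intro definable_intros)
  show "D \<in>\<^sub>M pow (wallman X T)" if "\<exists>A. A \<in>\<^sub>M CO X T \<and> D = cell A" for D
    using that by (auto simp: sub_def)
qed

lemma ex_common: "\<exists>c. \<forall>p. p \<in>\<^sub>M c \<longleftrightarrow> p \<in>\<^sub>M W \<and> (\<forall>D. D \<in>\<^sub>M G \<longrightarrow> p \<in>\<^sub>M D)"
  by (rule separation_definable) (intro definable_intros)

lemma definable_term_common [definable_intros]: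
  "definable_term t \<Longrightarrow> definable_term (\<lambda>e. coll (\<lambda>p. p \<in>\<^sub>M W \<and> (\<forall>D. D \<in>\<^sub>M t e \<longrightarrow> p \<in>\<^sub>M D)))"
  by (rule definable_term_subst1[of "\<lambda>G. coll (\<lambda>p. p \<in>\<^sub>M W \<and> (\<forall>D. D \<in>\<^sub>M G \<longrightarrow> p \<in>\<^sub>M D))"])
    (intro definable_term_coll definable_intros ex_common)

lemma cell_compl:
  assumes "A \<in>\<^sub>M CO X T" shows "diff (wallman X T) (cell A) = cell (diff X A)"
  by (subst ext_iff) (use ultra_prime[OF _ assms] ultra_compl in auto)

text \<open>
The topology is given by a base for the closed sets. As the complement of the cell of \<open>A\<close> is the cell
of \<open>X - A\<close>, the cells are also a base for the open sets.
\<close>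

lemma mem_wallman_top:
  "U \<in>\<^sub>M wallman_top X T \<longleftrightarrow>
    U \<subseteq>\<^sub>M wallman X T \<and> (\<forall>p. p \<in>\<^sub>M U \<longrightarrow> (\<exists>A. A \<in>\<^sub>M p \<and> cell A \<subseteq>\<^sub>M U))"
    (is "_ \<longleftrightarrow> ?R")
proof -
  let ?W = "wallman X T"
  let ?L = "U \<subseteq>\<^sub>M ?W \<and> (\<exists>G. G \<subseteq>\<^sub>M wallman_closed_base X T \<and>
        diff ?W U = coll (\<lambda>p. p \<in>\<^sub>M ?W \<and> (\<forall>D. D \<in>\<^sub>M G \<longrightarrow> p \<in>\<^sub>M D)))"
  have "U \<in>\<^sub>M wallman_top X T \<longleftrightarrow> ?L"
    unfolding wallman_top_def by (rule mem_coll[where a = "pow ?W"]) (intro definable_intros, simp)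
  also have "\<dots> \<longleftrightarrow> ?R"
  proof
    assume ?L
    then obtain G where U: "U \<subseteq>\<^sub>M ?W" and G: "G \<subseteq>\<^sub>M wallman_closed_base X T"
      and eq: "diff ?W U = coll (\<lambda>p. p \<in>\<^sub>M ?W \<and> (\<forall>D. D \<in>\<^sub>M G \<longrightarrow> p \<in>\<^sub>M D))" by blast
    have iff: "p \<in>\<^sub>M diff ?W U \<longleftrightarrow> p \<in>\<^sub>M ?W \<and> (\<forall>D. D \<in>\<^sub>M G \<longrightarrow> p \<in>\<^sub>M D)" for p
      unfolding eq using ex_common by (rule mem_coll_ex)
    have "\<exists>A. A \<in>\<^sub>M p \<and> cell A \<subseteq>\<^sub>M U" if p: "p \<in>\<^sub>M U" for p
    proof -
      have ultra: "CO_ultrafilter X T p" using mem_sub[OF U p] by simp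
      obtain D where D: "D \<in>\<^sub>M G" "\<not> p \<in>\<^sub>M D" using iff[of p] p ultra by auto
      then obtain A where A: "A \<in>\<^sub>M CO X T" "D = cell A"
        using mem_sub[OF G] mem_wallman_closed_base by blast
      have "diff X A \<in>\<^sub>M p" using ultra_prime[OF ultra A(1)] D(2) A(2) ultra by auto
      moreover have "cell (diff X A) \<subseteq>\<^sub>M U"
      proof (rule subI)
        fix q assume q: "q \<in>\<^sub>M cell (diff X A)"
        then have "q \<in>\<^sub>M ?W" "\<not> q \<in>\<^sub>M D" unfolding A(2) using ultra_compl by auto
        then show "q \<in>\<^sub>M U" using iff[of q] D(1) unfolding mem_diff by blast
      qed
      ultimately show ?thesis by blast
    qed
    then show ?R using U by blast
  next
    assume R: ?R
    \<comment> \<open>all basic closed sets that contain the complement of \<open>U\<close>, which avoids choosing among them\<close>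
    have "definable (\<lambda>e. diff ?W U \<subseteq>\<^sub>M e 0)" by (intro definable_intros)
    then obtain G where G: "\<And>D. D \<in>\<^sub>M G \<longleftrightarrow> D \<in>\<^sub>M wallman_closed_base X T \<and> diff ?W U \<subseteq>\<^sub>M D"
      using separation_definable[of "\<lambda>D. diff ?W U \<subseteq>\<^sub>M D" "wallman_closed_base X T"] by blast
    have "coll (\<lambda>p. p \<in>\<^sub>M ?W \<and> (\<forall>D. D \<in>\<^sub>M G \<longrightarrow> p \<in>\<^sub>M D)) = diff ?W U"
    proof (rule coll_eqI)
      fix p
      show "p \<in>\<^sub>M diff ?W U \<longleftrightarrow> p \<in>\<^sub>M ?W \<and> (\<forall>D. D \<in>\<^sub>M G \<longrightarrow> p \<in>\<^sub>M D)"
      proof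
        assume "p \<in>\<^sub>M diff ?W U"
        then show "p \<in>\<^sub>M ?W \<and> (\<forall>D. D \<in>\<^sub>M G \<longrightarrow> p \<in>\<^sub>M D)"
          using G unfolding sub_def mem_diff by blast
      next
        assume p: "p \<in>\<^sub>M ?W \<and> (\<forall>D. D \<in>\<^sub>M G \<longrightarrow> p \<in>\<^sub>M D)"
        have "\<not> p \<in>\<^sub>M U"
        proof
          assume "p \<in>\<^sub>M U"
          then obtain A where A: "A \<in>\<^sub>M p" "cell A \<subseteq>\<^sub>M U" using R by blast
          have ultra: "CO_ultrafilter X T p" using p by simp
          have co: "A \<in>\<^sub>M CO X T" using ultra_sub[OF ultra A(1)] .
          have "diff ?W U \<subseteq>\<^sub>M cell (diff X A)"
            unfolding cell_compl[OF co, symmetric] using A(2) by (auto simp: sub_def)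
          then have "cell (diff X A) \<in>\<^sub>M G"
            using G mem_wallman_closed_base CO_compl[OF top co] by blast
          then have "diff X A \<in>\<^sub>M p" using p by auto
          then show False using ultra_compl[OF ultra A(1)] by blast
        qed
        then show "p \<in>\<^sub>M diff ?W U" using p by simp
      qed
    qed
    moreover have "G \<subseteq>\<^sub>M wallman_closed_base X T" using G by (simp add: sub_def)
    ultimately show ?L using R by metis
  qed
  finally show ?thesis .
qed

lemma top_space_wallman: "top_space (wallman X T) (wallman_top X T)"
proof (rule top_spaceI)
  show "wallman X T \<in>\<^sub>M wallman_top X T"
    unfolding mem_wallman_top
  proof (intro conjI allI impI)
    fix p assume "p \<in>\<^sub>M wallman X T"
    then obtain A where "A \<in>\<^sub>M p"
      using nonempty_ex unfolding mem_wallman CO_ultrafilter_def CO_filter_def by blast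
    then show "\<exists>A. A \<in>\<^sub>M p \<and> cell A \<subseteq>\<^sub>M wallman X T" by (auto simp: sub_def)
  qed (simp add: sub_def)
  show "U \<in>\<^sub>M wallman_top X T"
    if U: "U \<subseteq>\<^sub>M wallman X T"
      and nhd: "\<And>p. p \<in>\<^sub>M U \<Longrightarrow> \<exists>V. V \<in>\<^sub>M wallman_top X T \<and> p \<in>\<^sub>M V \<and> V \<subseteq>\<^sub>M U" for U
    unfolding mem_wallman_top
  proof (intro conjI allI impI U)
    fix p assume "p \<in>\<^sub>M U"
    then obtain V where V: "V \<in>\<^sub>M wallman_top X T" "p \<in>\<^sub>M V" "V \<subseteq>\<^sub>M U" using nhd by blast
    then obtain A where "A \<in>\<^sub>M p" "cell A \<subseteq>\<^sub>M V" unfolding mem_wallman_top by blast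
    then show "\<exists>A. A \<in>\<^sub>M p \<and> cell A \<subseteq>\<^sub>M U" using V(3) unfolding sub_def by blast
  qed
  show "inter U V \<in>\<^sub>M wallman_top X T"
    if UV: "U \<in>\<^sub>M wallman_top X T" "V \<in>\<^sub>M wallman_top X T" for U V
    unfolding mem_wallman_top
  proof (intro conjI allI impI)
    show "inter U V \<subseteq>\<^sub>M wallman X T" using UV unfolding mem_wallman_top sub_def mem_inter by blast
    fix p assume p: "p \<in>\<^sub>M inter U V"
    then have ultra: "CO_ultrafilter X T p"
      using UV(1) mem_sub[of U "wallman X T" p] unfolding mem_wallman_top by simp
    obtain A where A: "A \<in>\<^sub>M p" "cell A \<subseteq>\<^sub>M U" using p UV(1) unfolding mem_wallman_top by auto
    obtain B where B: "B \<in>\<^sub>M p" "cell B \<subseteq>\<^sub>M V" using p UV(2) unfolding mem_wallman_top by auto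
    have "cell (inter A B) \<subseteq>\<^sub>M inter U V"
    proof (rule subI)
      fix q assume q: "q \<in>\<^sub>M cell (inter A B)"
      then have uq: "CO_ultrafilter X T q" "inter A B \<in>\<^sub>M q" by auto
      have "A \<in>\<^sub>M q" "B \<in>\<^sub>M q"
        using ultra_up[OF uq ultra_sub[OF ultra A(1)]] ultra_up[OF uq ultra_sub[OF ultra B(1)]]
        by (auto simp: sub_def)
      then show "q \<in>\<^sub>M inter U V" using uq(1) A(2) B(2) by (auto simp: sub_def)
    qed
    then show "\<exists>A. A \<in>\<^sub>M p \<and> cell A \<subseteq>\<^sub>M inter U V" using ultra_inter[OF ultra A(1) B(1)] by blast
  qed
qed (auto simp: mem_wallman_top)

lemma cell_clopen:
  assumes "A \<in>\<^sub>M CO X T" shows "cell A \<in>\<^sub>M CO (wallman X T) (wallman_top X T)"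
proof -
  have "cell B \<in>\<^sub>M wallman_top X T" for B
    unfolding mem_wallman_top by (auto simp: sub_def)
  then show ?thesis unfolding mem_CO cell_compl[OF assms] by blast
qed

lemma principal_ultra:
  assumes x: "x \<in>\<^sub>M X" and p: "\<And>A. A \<in>\<^sub>M p \<longleftrightarrow> A \<in>\<^sub>M CO X T \<and> x \<in>\<^sub>M A"
  shows "CO_ultrafilter X T p"
proof (rule prime_filter_ultra)
  show "A \<in>\<^sub>M p \<or> diff X A \<in>\<^sub>M p" if "A \<in>\<^sub>M CO X T" for A
    using that x p CO_compl[OF top that] by auto
  show "CO_filter X T p"
    unfolding CO_filter_def
  proof (intro conjI allI impI)
    show "p \<subseteq>\<^sub>M CO X T" using p by (simp add: sub_def)
    have "X \<in>\<^sub>M p" using p x CO_carrier[OF top] by blast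
    then show "p \<noteq> empty" by auto
    show "\<not> empty \<in>\<^sub>M p" using p by auto
    show "inter A B \<in>\<^sub>M p" if "A \<in>\<^sub>M p \<and> B \<in>\<^sub>M p" for A B
      using that p CO_inter[OF top] by simp
    show "B \<in>\<^sub>M p" if "A \<in>\<^sub>M p \<and> B \<in>\<^sub>M CO X T \<and> A \<subseteq>\<^sub>M B" for A B
      using that p mem_sub by blast
  qed
qed

lemma ex_principal:
  assumes "x \<in>\<^sub>M X"
  obtains p where "CO_ultrafilter X T p" "\<And>A. A \<in>\<^sub>M p \<longleftrightarrow> A \<in>\<^sub>M CO X T \<and> x \<in>\<^sub>M A"
proof -
  have "definable (\<lambda>e. x \<in>\<^sub>M e 0)" by (intro definable_intros)
  then obtain p where "\<And>A. A \<in>\<^sub>M p \<longleftrightarrow> A \<in>\<^sub>M CO X T \<and> x \<in>\<^sub>M A"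
    using separation_definable[of "\<lambda>A. x \<in>\<^sub>M A" "CO X T"] by blast
  then show thesis using that principal_ultra[OF assms] by blast
qed

text \<open>
The map sends a point to the ultrafilter of its clopen neighbourhoods, and the cell of \<open>A\<close> lifts \<open>A\<close>.
The image is dense because members of an ultrafilter are not empty.
\<close>

lemma wallman_lifting:
  obtains h where "clopen_lifting mem X T (wallman X T) (wallman_top X T) h"
    "\<And>A. A \<in>\<^sub>M CO X T \<Longrightarrow> preimage h (cell A) = A"
proof -
  let ?W = "wallman X T" and ?R = "\<lambda>x p. \<forall>A. A \<in>\<^sub>M p \<longleftrightarrow> A \<in>\<^sub>M CO X T \<and> x \<in>\<^sub>M A"
  have R: "definable (\<lambda>e. ?R (e 0) (e (Suc 0)))" by (intro definable_intros)
  have exR: "\<exists>p. p \<in>\<^sub>M ?W \<and> ?R x p" if "x \<in>\<^sub>M X" for x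
    using ex_principal[OF that] mem_wallman by metis
  have uniqueR: "p = q" if "x \<in>\<^sub>M X" "p \<in>\<^sub>M ?W" "q \<in>\<^sub>M ?W" "?R x p" "?R x q" for x p q
    using that(4,5) by (subst ext_iff) blast
  obtain h where h_fun: "is_fun h X ?W"
    and h: "\<And>x p. pair x p \<in>\<^sub>M h \<longleftrightarrow> x \<in>\<^sub>M X \<and> p \<in>\<^sub>M ?W \<and> ?R x p"
    by (rule ex_fun[of ?R X ?W, OF R exR uniqueR]) blast+
  have pre: "preimage h (cell A) = A" if A: "A \<in>\<^sub>M CO X T" for A
  proof (rule eqI)
    fix x assume "x \<in>\<^sub>M preimage h (cell A)"
    then show "x \<in>\<^sub>M A" using h by auto
  next
    fix x assume x: "x \<in>\<^sub>M A"
    then have "x \<in>\<^sub>M X" using mem_sub[OF clopen_sub[OF A]] by blast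
    then obtain p where p: "p \<in>\<^sub>M ?W" "pair x p \<in>\<^sub>M h" using is_fun_ex[OF h_fun] by blast
    then have "p \<in>\<^sub>M cell A" using h x A by auto
    then show "x \<in>\<^sub>M preimage h (cell A)" using p(2) by auto
  qed
  have "clopen_lifting mem X T ?W (wallman_top X T) h"
  proof (unfold_locales)
    show "top_space ?W (wallman_top X T)" by (rule top_space_wallman)
    have "preimage h U \<in>\<^sub>M T" if U: "U \<in>\<^sub>M wallman_top X T" for U
    proof (rule openI[OF top])
      fix x assume "x \<in>\<^sub>M preimage h U"
      then obtain p where p: "p \<in>\<^sub>M U" "pair x p \<in>\<^sub>M h" by auto
      then obtain A where A: "A \<in>\<^sub>M p" "cell A \<subseteq>\<^sub>M U" using U unfolding mem_wallman_top by blast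
      have co: "A \<in>\<^sub>M CO X T" "x \<in>\<^sub>M A" using h p(2) A(1) by blast+
      have "A \<subseteq>\<^sub>M preimage h U"
        using A(2) pre[OF co(1)] unfolding sub_def by (metis mem_preimage)
      then show "\<exists>V. V \<in>\<^sub>M T \<and> x \<in>\<^sub>M V \<and> V \<subseteq>\<^sub>M preimage h U" using co unfolding mem_CO by blast
    qed
    then show "continuous X T ?W (wallman_top X T) h" unfolding continuous_def using h_fun by blast
    show "\<exists>x. x \<in>\<^sub>M preimage h U" if U: "U \<in>\<^sub>M wallman_top X T" "p \<in>\<^sub>M U" for U p
    proof -
      obtain A where A: "A \<in>\<^sub>M p" "cell A \<subseteq>\<^sub>M U" using U unfolding mem_wallman_top by blast
      have ultra: "CO_ultrafilter X T p" using U mem_sub unfolding mem_wallman_top mem_wallman[symmetric] by blast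
      then have "A \<noteq> empty" using A(1) ultra_empty by blast
      then obtain x where "x \<in>\<^sub>M A" using nonempty_ex by blast
      then have "x \<in>\<^sub>M preimage h (cell A)" using pre[OF ultra_sub[OF ultra A(1)]] by simp
      then show ?thesis using A(2) by (auto simp: sub_def)
    qed
    show "\<exists>V. V \<in>\<^sub>M CO ?W (wallman_top X T) \<and> preimage h V = A" if "A \<in>\<^sub>M CO X T" for A
      using cell_clopen[OF that] pre[OF that] by blast
  qed
  with pre show thesis using that by blast
qed

text \<open>
In the Wallman space an ultrafilter is realized by itself.
\<close>

theorem wallman_compact_iff:
  "compact (wallman X T) (wallman_top X T) \<longleftrightarrow> ultrafilter_existence"
proof -
  obtain h where "clopen_lifting mem X T (wallman X T) (wallman_top X T) h"
    and pre: "\<And>A. A \<in>\<^sub>M CO X T \<Longrightarrow> preimage h (cell A) = A" by (rule wallman_lifting) blast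
  then interpret W: clopen_lifting mem X T "wallman X T" "wallman_top X T" h by blast
  show ?thesis
  proof (rule iffI, erule W.compact_imp_ultrafilter_existence, rule W.ultrafilter_existence_imp_compact)
    show "is_base (CO (wallman X T) (wallman_top X T)) (wallman_top X T)"
    proof (rule is_baseI)
      show "CO (wallman X T) (wallman_top X T) \<subseteq>\<^sub>M wallman_top X T" by (simp add: sub_def mem_CO)
      fix U p assume U: "U \<in>\<^sub>M wallman_top X T" "p \<in>\<^sub>M U"
      then obtain A where A: "A \<in>\<^sub>M p" "cell A \<subseteq>\<^sub>M U" unfolding mem_wallman_top by blast
      have ultra: "CO_ultrafilter X T p" using U mem_sub unfolding mem_wallman_top mem_wallman[symmetric] by blast
      then show "\<exists>V. V \<in>\<^sub>M CO (wallman X T) (wallman_top X T) \<and> p \<in>\<^sub>M V \<and> V \<subseteq>\<^sub>M U"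
        using A cell_clopen ultra_sub[OF ultra A(1)] by (intro exI[of _ "cell A"]) auto
    qed
    fix p assume p: "CO_ultrafilter X T p"
    have "\<exists>V. V \<in>\<^sub>M CO (wallman X T) (wallman_top X T) \<and> preimage h V = A \<and> p \<in>\<^sub>M V"
      if "A \<in>\<^sub>M p" for A
      using that p cell_clopen pre ultra_sub[OF p that] by (intro exI[of _ "cell A"]) auto
    then show "\<exists>y. y \<in>\<^sub>M wallman X T \<and> (\<forall>A. A \<in>\<^sub>M p \<longrightarrow>
        (\<exists>V. V \<in>\<^sub>M CO (wallman X T) (wallman_top X T) \<and> preimage h V = A \<and> y \<in>\<^sub>M V))"
      using p by auto
  qed
qed

end

section \<open>Powers of a discrete space\<close>

context ZF
begin

text \<open>
Application \<open>app\<close> is a definite description, which gives a definable function only on the domain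
of a function. Rewriting it through membership of pairs makes separation applicable.
\<close>

lemma mem_box:
  assumes B: "is_fun B J S"
  shows "q \<in>\<^sub>M box J Y B \<longleftrightarrow> is_fun q J Y \<and> (\<forall>j y b. pair j y \<in>\<^sub>M q \<and> pair j b \<in>\<^sub>M B \<longrightarrow> y \<in>\<^sub>M b)"
proof -
  let ?P = "\<lambda>q. is_fun q J Y \<and> (\<forall>j y b. pair j y \<in>\<^sub>M q \<and> pair j b \<in>\<^sub>M B \<longrightarrow> y \<in>\<^sub>M b)"
  have "(q \<in>\<^sub>M funs J Y \<and> (\<forall>j. j \<in>\<^sub>M J \<longrightarrow> app q j \<in>\<^sub>M app B j)) = ?P q" for q
  proof (cases "is_fun q J Y")
    case True
    have "app q j \<in>\<^sub>M app B j \<longleftrightarrow> (\<forall>y b. pair j y \<in>\<^sub>M q \<and> pair j b \<in>\<^sub>M B \<longrightarrow> y \<in>\<^sub>M b)"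
      if j: "j \<in>\<^sub>M J" for j
    proof -
      obtain y where y: "pair j y \<in>\<^sub>M q" using is_fun_ex[OF True j] by blast
      obtain b where b: "pair j b \<in>\<^sub>M B" using is_fun_ex[OF B j] by blast
      show ?thesis
        unfolding app_eq[OF True y] app_eq[OF B b]
        using y b is_fun_unique[OF True y] is_fun_unique[OF B b] by blast
    qed
    moreover have "j \<in>\<^sub>M J" if "pair j y \<in>\<^sub>M q" for j y using is_fun_pairD[OF True that] by blast
    ultimately show ?thesis using True by (simp only: mem_funs) blast
  qed simp
  then have "box J Y B = coll ?P" unfolding box_def by presburger
  moreover have "q \<in>\<^sub>M coll ?P \<longleftrightarrow> ?P q"
  proof (rule mem_coll)
    show "definable (\<lambda>e. ?P (e 0))" by (intro definable_intros)
    show "q \<in>\<^sub>M funs J Y" if "?P q" for q using that by simp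
  qed
  ultimately show ?thesis by simp
qed

lemma mem_support:
  assumes B: "is_fun B J S"
  shows "j \<in>\<^sub>M coll (\<lambda>j. j \<in>\<^sub>M J \<and> app B j \<noteq> Y) \<longleftrightarrow> (\<exists>b. pair j b \<in>\<^sub>M B \<and> b \<noteq> Y)"
proof -
  have "(j \<in>\<^sub>M J \<and> app B j \<noteq> Y) = (\<exists>b. pair j b \<in>\<^sub>M B \<and> b \<noteq> Y)" for j
    using is_fun_ex[OF B] is_fun_pairD[OF B] app_eq[OF B] by metis
  then have "coll (\<lambda>j. j \<in>\<^sub>M J \<and> app B j \<noteq> Y) = coll (\<lambda>j. \<exists>b. pair j b \<in>\<^sub>M B \<and> b \<noteq> Y)"
    by presburger
  moreover have "j \<in>\<^sub>M coll (\<lambda>j. \<exists>b. pair j b \<in>\<^sub>M B \<and> b \<noteq> Y) \<longleftrightarrow> (\<exists>b. pair j b \<in>\<^sub>M B \<and> b \<noteq> Y)"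
    by (rule mem_coll[where a = J]) (intro definable_intros, use is_fun_pairD[OF B] in blast)
  ultimately show ?thesis by simp
qed

definition agree :: "'v \<Rightarrow> 'v \<Rightarrow> 'v \<Rightarrow> bool" where
  "agree N q r \<longleftrightarrow> (\<forall>j y. j \<in>\<^sub>M N \<and> pair j y \<in>\<^sub>M q \<longrightarrow> pair j y \<in>\<^sub>M r)"

lemma definable_agree [definable_intros]:
  "definable_term t \<Longrightarrow> definable_term u \<Longrightarrow> definable_term v \<Longrightarrow>
    definable (\<lambda>e. agree (t e) (u e) (v e))"
  by (rule definable_subst3) (unfold agree_def, intro definable_intros)

lemma agree_sym:
  assumes "is_fun q J Y" "is_fun r J Y" "agree N q r" shows "agree N r q"
  unfolding agree_def
proof (intro allI impI, elim conjE)
  fix j y assume j: "j \<in>\<^sub>M N" "pair j y \<in>\<^sub>M r"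
  then obtain z where z: "pair j z \<in>\<^sub>M q" using is_fun_pairD[OF assms(2)] is_fun_ex[OF assms(1)] by blast
  then have "pair j z \<in>\<^sub>M r" using assms(3) j(1) unfolding agree_def by blast
  then show "pair j y \<in>\<^sub>M q" using is_fun_unique[OF assms(2) j(2)] z by blast
qed

text \<open>
For a discrete factor, boxes can be shrunk to those that fix finitely many coordinates: a box with
support \<open>N\<close> contains all points agreeing with \<open>p\<close> on \<open>N\<close>, and conversely these points form a box
with singleton factors over \<open>N\<close>.
\<close>

lemma mem_power_top_discrete:
  "U \<in>\<^sub>M power_top J Y (pow Y) \<longleftrightarrow> U \<subseteq>\<^sub>M funs J Y \<and> (\<forall>p. p \<in>\<^sub>M U \<longrightarrow>
    (\<exists>N. is_finite N \<and> N \<subseteq>\<^sub>M J \<and> (\<forall>r. is_fun r J Y \<and> agree N p r \<longrightarrow> r \<in>\<^sub>M U)))"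
proof -
  let ?nhd = "\<lambda>p U. \<exists>N. is_finite N \<and> N \<subseteq>\<^sub>M J \<and> (\<forall>r. is_fun r J Y \<and> agree N p r \<longrightarrow> r \<in>\<^sub>M U)"
  let ?box = "\<lambda>p U. \<exists>B. B \<in>\<^sub>M funs J (pow Y) \<and> is_finite (coll (\<lambda>j. j \<in>\<^sub>M J \<and> app B j \<noteq> Y))
        \<and> p \<in>\<^sub>M box J Y B \<and> box J Y B \<subseteq>\<^sub>M U"
  have box_iff: "?box p U \<longleftrightarrow> ?nhd p U" if p: "is_fun p J Y" for p U
  proof
    assume "?box p U"
    then obtain B where B: "is_fun B J (pow Y)"
      and fin: "is_finite (coll (\<lambda>j. j \<in>\<^sub>M J \<and> app B j \<noteq> Y))" (is "is_finite ?N")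
      and pB: "p \<in>\<^sub>M box J Y B" and sub: "box J Y B \<subseteq>\<^sub>M U" by auto
    note N = mem_support[OF B]
    have "?N \<subseteq>\<^sub>M J" by (rule subI) (use N is_fun_pairD[OF B] in blast)
    moreover have "r \<in>\<^sub>M U" if r: "is_fun r J Y" "agree ?N p r" for r
    proof (rule mem_sub[OF sub])
      have "y \<in>\<^sub>M b" if y: "pair j y \<in>\<^sub>M r" "pair j b \<in>\<^sub>M B" for j y b
      proof (cases "b = Y")
        case True
        then show ?thesis using is_fun_pairD[OF r(1) y(1)] by blast
      next
        case False
        then have "j \<in>\<^sub>M ?N" using N y(2) by blast
        then have "pair j y \<in>\<^sub>M p"
          using agree_sym[OF p r] y(1) unfolding agree_def by blast
        then show ?thesis using pB y(2) unfolding mem_box[OF B] by blast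
      qed
      then show "r \<in>\<^sub>M box J Y B" unfolding mem_box[OF B] using r(1) by blast
    qed
    ultimately show "?nhd p U" using fin by blast
  next
    assume "?nhd p U"
    then obtain N where N: "is_finite N" "N \<subseteq>\<^sub>M J"
      and nhd: "\<And>r. is_fun r J Y \<Longrightarrow> agree N p r \<Longrightarrow> r \<in>\<^sub>M U" by blast
    \<comment> \<open>the box that fixes the coordinates of \<open>p\<close> in \<open>N\<close> and leaves the others free\<close>
    let ?R = "\<lambda>j b. (j \<in>\<^sub>M N \<and> (\<exists>y. pair j y \<in>\<^sub>M p \<and> b = upair y y)) \<or> (\<not> j \<in>\<^sub>M N \<and> b = Y)"
    have R: "definable (\<lambda>e. ?R (e 0) (e (Suc 0)))" by (intro definable_intros)
    have exR: "\<exists>b. b \<in>\<^sub>M pow Y \<and> ?R j b" if "j \<in>\<^sub>M J" for j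
    proof (cases "j \<in>\<^sub>M N")
      case True
      obtain y where "y \<in>\<^sub>M Y" "pair j y \<in>\<^sub>M p" using is_fun_ex[OF p \<open>j \<in>\<^sub>M J\<close>] by blast
      then show ?thesis using True by (intro exI[of _ "upair y y"]) (auto simp: sub_def)
    next
      case False
      then show ?thesis by (intro exI[of _ Y]) (auto simp: sub_def)
    qed
    have uniqueR: "b = c" if "j \<in>\<^sub>M J" "b \<in>\<^sub>M pow Y" "c \<in>\<^sub>M pow Y" "?R j b" "?R j c" for j b c
      using that(4,5) is_fun_unique[OF p, of j] by metis
    obtain B where B: "is_fun B J (pow Y)"
      and memB: "\<And>j b. pair j b \<in>\<^sub>M B \<longleftrightarrow> j \<in>\<^sub>M J \<and> b \<in>\<^sub>M pow Y \<and> ?R j b"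
      by (rule ex_fun[of ?R J "pow Y", OF R exR uniqueR]) blast+
    have "is_finite (coll (\<lambda>j. j \<in>\<^sub>M J \<and> app B j \<noteq> Y))"
      by (rule is_finite_subset[OF N(1)], rule subI) (use mem_support[OF B] memB in blast)
    moreover have "y \<in>\<^sub>M b" if y: "pair j y \<in>\<^sub>M p" "pair j b \<in>\<^sub>M B" for j y b
      using is_fun_pairD[OF p y(1)] is_fun_unique[OF p y(1)] y(2) memB[of j b] by auto
    then have "p \<in>\<^sub>M box J Y B" unfolding mem_box[OF B] using p by blast
    moreover have "box J Y B \<subseteq>\<^sub>M U"
    proof (rule subI)
      fix r assume "r \<in>\<^sub>M box J Y B"
      then have r: "is_fun r J Y" "\<And>j y b. pair j y \<in>\<^sub>M r \<Longrightarrow> pair j b \<in>\<^sub>M B \<Longrightarrow> y \<in>\<^sub>M b"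
        unfolding mem_box[OF B] by blast+
      have "agree N p r"
        unfolding agree_def
      proof (intro allI impI, elim conjE)
        fix j y assume j: "j \<in>\<^sub>M N" "pair j y \<in>\<^sub>M p"
        then have jJ: "j \<in>\<^sub>M J" "y \<in>\<^sub>M Y" using is_fun_pairD[OF p] by blast+
        then obtain z where z: "pair j z \<in>\<^sub>M r" using is_fun_ex[OF r(1)] by blast
        have jB: "pair j (upair y y) \<in>\<^sub>M B" using memB j jJ by (auto simp: sub_def)
        have "z = y" using r(2)[OF z jB] by simp
        then show "pair j y \<in>\<^sub>M r" using z by simp
      qed
      then show "r \<in>\<^sub>M U" using nhd r(1) by blast
    qed
    ultimately show "?box p U" using B by auto
  qed
  have "(U \<subseteq>\<^sub>M funs J Y \<and> (\<forall>p. p \<in>\<^sub>M U \<longrightarrow> ?box p U)) =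
      (U \<subseteq>\<^sub>M funs J Y \<and> (\<forall>p. p \<in>\<^sub>M U \<longrightarrow> ?nhd p U))" for U
    using box_iff mem_sub[of U "funs J Y"] unfolding mem_funs by blast
  then have "power_top J Y (pow Y) =
      coll (\<lambda>U. U \<subseteq>\<^sub>M funs J Y \<and> (\<forall>p. p \<in>\<^sub>M U \<longrightarrow> ?nhd p U))"
    unfolding power_top_def by presburger
  moreover have "U \<in>\<^sub>M coll (\<lambda>U. U \<subseteq>\<^sub>M funs J Y \<and> (\<forall>p. p \<in>\<^sub>M U \<longrightarrow> ?nhd p U)) \<longleftrightarrow>
      U \<subseteq>\<^sub>M funs J Y \<and> (\<forall>p. p \<in>\<^sub>M U \<longrightarrow> ?nhd p U)"
    by (rule mem_coll[where a = "pow (funs J Y)"]) (intro definable_intros, simp)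
  ultimately show ?thesis by simp
qed

lemma top_space_power_discrete: "top_space (funs J Y) (power_top J Y (pow Y))"
proof (rule top_spaceI)
  show "funs J Y \<in>\<^sub>M power_top J Y (pow Y)"
    unfolding mem_power_top_discrete using is_finite_empty by (auto simp: sub_def)
  show "U \<in>\<^sub>M power_top J Y (pow Y)"
    if U: "U \<subseteq>\<^sub>M funs J Y"
      and nhd: "\<And>q. q \<in>\<^sub>M U \<Longrightarrow> \<exists>V. V \<in>\<^sub>M power_top J Y (pow Y) \<and> q \<in>\<^sub>M V \<and> V \<subseteq>\<^sub>M U" for U
    unfolding mem_power_top_discrete
  proof (intro conjI allI impI U)
    fix q assume "q \<in>\<^sub>M U"
    then obtain V where V: "V \<in>\<^sub>M power_top J Y (pow Y)" "q \<in>\<^sub>M V" "V \<subseteq>\<^sub>M U" using nhd by blast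
    then obtain N where "is_finite N" "N \<subseteq>\<^sub>M J" "\<forall>r. is_fun r J Y \<and> agree N q r \<longrightarrow> r \<in>\<^sub>M V"
      unfolding mem_power_top_discrete by blast
    then show "\<exists>N. is_finite N \<and> N \<subseteq>\<^sub>M J \<and> (\<forall>r. is_fun r J Y \<and> agree N q r \<longrightarrow> r \<in>\<^sub>M U)"
      using V(3) mem_sub by blast
  qed
  show "inter U V \<in>\<^sub>M power_top J Y (pow Y)"
    if UV: "U \<in>\<^sub>M power_top J Y (pow Y)" "V \<in>\<^sub>M power_top J Y (pow Y)" for U V
    unfolding mem_power_top_discrete
  proof (intro conjI allI impI)
    show "inter U V \<subseteq>\<^sub>M funs J Y"
      using UV unfolding mem_power_top_discrete sub_def mem_inter by blast
    fix q assume q: "q \<in>\<^sub>M inter U V"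
    obtain N where N: "is_finite N" "N \<subseteq>\<^sub>M J" "\<And>r. is_fun r J Y \<Longrightarrow> agree N q r \<Longrightarrow> r \<in>\<^sub>M U"
      using q UV(1) unfolding mem_power_top_discrete mem_inter by blast
    obtain M where M: "is_finite M" "M \<subseteq>\<^sub>M J" "\<And>r. is_fun r J Y \<Longrightarrow> agree M q r \<Longrightarrow> r \<in>\<^sub>M V"
      using q UV(2) unfolding mem_power_top_discrete mem_inter by blast
    have "agree N q r" "agree M q r" if "agree (union (upair N M)) q r" for r
      using that unfolding agree_def by auto
    then have "\<forall>r. is_fun r J Y \<and> agree (union (upair N M)) q r \<longrightarrow> r \<in>\<^sub>M inter U V"
      using N(3) M(3) by simp
    moreover have "union (upair N M) \<subseteq>\<^sub>M J" using N(2) M(2) by (auto simp: sub_def)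
    ultimately show "\<exists>N. is_finite N \<and> N \<subseteq>\<^sub>M J \<and> (\<forall>r. is_fun r J Y \<and> agree N q r \<longrightarrow> r \<in>\<^sub>M inter U V)"
      using is_finite_union[OF N(1) M(1)] by blast
  qed
qed (simp add: mem_power_top_discrete)

text \<open>
Agreement on \<open>N\<close> is symmetric, so the complement of \<open>U\<close> depends on the coordinates in \<open>N\<close> only, too.
\<close>

lemma finitely_determined_clopen:
  assumes U: "U \<subseteq>\<^sub>M funs J Y" and N: "is_finite N" "N \<subseteq>\<^sub>M J"
    and det: "\<And>q r. q \<in>\<^sub>M U \<Longrightarrow> is_fun r J Y \<Longrightarrow> agree N q r \<Longrightarrow> r \<in>\<^sub>M U"
  shows "U \<in>\<^sub>M CO (funs J Y) (power_top J Y (pow Y))"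
  unfolding mem_CO mem_power_top_discrete
proof (intro conjI allI impI U)
  show "diff (funs J Y) U \<subseteq>\<^sub>M funs J Y" by (simp add: sub_def)
  fix q
  show "\<exists>N. is_finite N \<and> N \<subseteq>\<^sub>M J \<and> (\<forall>r. is_fun r J Y \<and> agree N q r \<longrightarrow> r \<in>\<^sub>M U)"
    if "q \<in>\<^sub>M U" using N det[OF that] by blast
  assume q: "q \<in>\<^sub>M diff (funs J Y) U"
  have "r \<in>\<^sub>M diff (funs J Y) U" if r: "is_fun r J Y" "agree N q r" for r
    using q det[of r q] agree_sym[of q J Y r N] r by auto
  then show "\<exists>N. is_finite N \<and> N \<subseteq>\<^sub>M J \<and>
      (\<forall>r. is_fun r J Y \<and> agree N q r \<longrightarrow> r \<in>\<^sub>M diff (funs J Y) U)" using N by blast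
qed

lemma CO_subtop:
  assumes "V \<in>\<^sub>M CO Y S" "A \<subseteq>\<^sub>M Y" shows "inter V A \<in>\<^sub>M CO A (subtop S A)"
proof -
  have "diff A (inter V A) = inter (diff Y V) A"
    using assms(2) by (subst ext_iff) (auto simp: sub_def)
  then show ?thesis using assms(1) unfolding mem_CO mem_subtop by metis
qed

lemma mem_two [simp]: "x \<in>\<^sub>M two \<longleftrightarrow> x = empty \<or> x = one"
  by (simp add: two_def)

lemma empty_neq_one [simp]: "empty \<noteq> one"
proof
  assume "empty = one"
  moreover have "empty \<in>\<^sub>M one" by (simp add: one_def)
  ultimately show False by (metis mem_empty)
qed

lemma top_space_discrete: "top_space Y (pow Y)"
  by (rule top_spaceI) (auto simp: sub_def)

end

section \<open>Evaluation at two-valued continuous maps\<close>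

context zero_dim_T1
begin

lemma mem_C2 [simp]: "f \<in>\<^sub>M C2 X T \<longleftrightarrow> continuous X T two (pow two) f"
  by (simp add: C2_def)

lemma C2_fun: "f \<in>\<^sub>M C2 X T \<Longrightarrow> is_fun f X two"
  by (simp add: continuous_def)

lemma C2_preimage_clopen: "f \<in>\<^sub>M C2 X T \<Longrightarrow> V \<subseteq>\<^sub>M two \<Longrightarrow> preimage f V \<in>\<^sub>M CO X T"
  by (rule preimage_CO[where S = "pow two" and Y = two]) (auto simp: mem_CO sub_def)

lemma ex_characteristic:
  assumes A: "A \<in>\<^sub>M CO X T"
  obtains f where "f \<in>\<^sub>M C2 X T"
    "\<And>x y. pair x y \<in>\<^sub>M f \<longleftrightarrow> x \<in>\<^sub>M X \<and> (y = one \<and> x \<in>\<^sub>M A \<or> y = empty \<and> \<not> x \<in>\<^sub>M A)"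
proof -
  let ?R = "\<lambda>x y. y = one \<and> x \<in>\<^sub>M A \<or> y = empty \<and> \<not> x \<in>\<^sub>M A"
  have R: "definable (\<lambda>e. ?R (e 0) (e (Suc 0)))" by (intro definable_intros)
  obtain f where f_fun: "is_fun f X two"
    and f: "\<And>x y. pair x y \<in>\<^sub>M f \<longleftrightarrow> x \<in>\<^sub>M X \<and> y \<in>\<^sub>M two \<and> ?R x y"
    by (rule ex_fun[of ?R X two, OF R]) auto
  have f': "pair x y \<in>\<^sub>M f \<longleftrightarrow> x \<in>\<^sub>M X \<and> ?R x y" for x y using f by auto
  have "preimage f V \<in>\<^sub>M T" for V
  proof (rule openI[OF top])
    fix x assume x: "x \<in>\<^sub>M preimage f V"
    show "\<exists>U. U \<in>\<^sub>M T \<and> x \<in>\<^sub>M U \<and> U \<subseteq>\<^sub>M preimage f V"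
    proof (cases "x \<in>\<^sub>M A")
      case True
      then have "A \<subseteq>\<^sub>M preimage f V" using x f' clopen_sub[OF A] by (auto simp: sub_def)
      then show ?thesis using True A unfolding mem_CO by blast
    next
      case False
      then have "diff X A \<subseteq>\<^sub>M preimage f V" "x \<in>\<^sub>M diff X A" using x f' by (auto simp: sub_def)
      then show ?thesis using A unfolding mem_CO by blast
    qed
  qed
  then have "f \<in>\<^sub>M C2 X T" using f_fun by (simp add: continuous_def)
  then show thesis using that f' by blast
qed

text \<open>
Here and in \<open>e2_fun\<close> the terms formed with \<open>lam\<close> are identified with functions obtained from
\<open>ex_fun\<close>, since their defining predicates mention \<open>app\<close>.
\<close>

lemma evaluation:
  assumes x: "x \<in>\<^sub>M X"
  shows "is_fun (lam (C2 X T) (\<lambda>f. app f x)) (C2 X T) two" (is ?fun)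
    and "pair f y \<in>\<^sub>M lam (C2 X T) (\<lambda>f. app f x) \<longleftrightarrow> f \<in>\<^sub>M C2 X T \<and> pair x y \<in>\<^sub>M f" (is ?mem)
proof -
  let ?R = "\<lambda>f y. pair x y \<in>\<^sub>M f"
  have R: "definable (\<lambda>e. ?R (e 0) (e (Suc 0)))" by (intro definable_intros)
  have exR: "\<exists>y. y \<in>\<^sub>M two \<and> ?R f y" if "f \<in>\<^sub>M C2 X T" for f
    using is_fun_ex[OF C2_fun[OF that] x] by blast
  have uniqueR: "y = z" if "f \<in>\<^sub>M C2 X T" "y \<in>\<^sub>M two" "z \<in>\<^sub>M two" "?R f y" "?R f z" for f y z
    using is_fun_unique[OF C2_fun[OF that(1)] that(4,5)] .
  obtain v where v_fun: "is_fun v (C2 X T) two"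
    and v: "\<And>f y. pair f y \<in>\<^sub>M v \<longleftrightarrow> f \<in>\<^sub>M C2 X T \<and> y \<in>\<^sub>M two \<and> ?R f y"
    by (rule ex_fun[of ?R "C2 X T" two, OF R exR uniqueR]) blast+
  have "lam (C2 X T) (\<lambda>f. app f x) = v"
    unfolding lam_def
  proof (rule coll_eqI)
    fix p
    have app: "app f x = y" if "f \<in>\<^sub>M C2 X T" "pair x y \<in>\<^sub>M f" for f y
      using app_eq[OF C2_fun[OF that(1)] that(2)] .
    show "p \<in>\<^sub>M v \<longleftrightarrow> (\<exists>f. f \<in>\<^sub>M C2 X T \<and> p = pair f (app f x))"
    proof
      assume p: "p \<in>\<^sub>M v"
      then obtain f y where fy: "p = pair f y" using is_fun_memD[OF v_fun] by blast
      then show "\<exists>f. f \<in>\<^sub>M C2 X T \<and> p = pair f (app f x)" using p v app by blast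
    next
      assume "\<exists>f. f \<in>\<^sub>M C2 X T \<and> p = pair f (app f x)"
      then obtain f where f: "f \<in>\<^sub>M C2 X T" "p = pair f (app f x)" by blast
      obtain y where "y \<in>\<^sub>M two" "?R f y" using exR[OF f(1)] by blast
      then show "p \<in>\<^sub>M v" using f v app by blast
    qed
  qed
  moreover have "y \<in>\<^sub>M two" if "f \<in>\<^sub>M C2 X T" "pair x y \<in>\<^sub>M f"
    using is_fun_pairD[OF C2_fun[OF that(1)] that(2)] by blast
  ultimately show ?fun ?mem using v_fun v by blast+
qed

lemma e2_fun: "is_fun (e2 X T) X (funs (C2 X T) two)"
  and pair_mem_e2: "pair x v \<in>\<^sub>M e2 X T \<longleftrightarrow> x \<in>\<^sub>M X \<and> is_fun v (C2 X T) two \<and>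
    (\<forall>f y. pair f y \<in>\<^sub>M v \<longleftrightarrow> f \<in>\<^sub>M C2 X T \<and> pair x y \<in>\<^sub>M f)"
proof -
  let ?ev = "\<lambda>x. lam (C2 X T) (\<lambda>f. app f x)"
  let ?R = "\<lambda>x v. is_fun v (C2 X T) two \<and> (\<forall>f y. pair f y \<in>\<^sub>M v \<longleftrightarrow> f \<in>\<^sub>M C2 X T \<and> pair x y \<in>\<^sub>M f)"
  have R: "definable (\<lambda>e. ?R (e 0) (e (Suc 0)))" by (intro definable_intros)
  have R_iff: "?R x v \<longleftrightarrow> v = ?ev x" if "x \<in>\<^sub>M X" for x v
  proof
    assume "?R x v"
    then show "v = ?ev x"
      using evaluation[OF that] by (intro is_fun_eqI[of v "C2 X T" two "?ev x" two]) blast+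
  next
    assume "v = ?ev x"
    then show "?R x v" using evaluation[OF that] by blast
  qed
  have exR: "\<exists>v. v \<in>\<^sub>M funs (C2 X T) two \<and> ?R x v" if "x \<in>\<^sub>M X" for x
    using R_iff[OF that] evaluation(1)[OF that] mem_funs by blast
  have uniqueR: "v = w" if "x \<in>\<^sub>M X" "v \<in>\<^sub>M funs (C2 X T) two" "w \<in>\<^sub>M funs (C2 X T) two"
    "?R x v" "?R x w" for x v w
    using R_iff[OF that(1), THEN iffD1, OF that(4)] R_iff[OF that(1), THEN iffD1, OF that(5)] by simp
  obtain F where F_fun: "is_fun F X (funs (C2 X T) two)"
    and F: "\<And>x v. pair x v \<in>\<^sub>M F \<longleftrightarrow> x \<in>\<^sub>M X \<and> v \<in>\<^sub>M funs (C2 X T) two \<and> ?R x v"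
    by (rule ex_fun[of ?R X "funs (C2 X T) two", OF R exR uniqueR]) blast+
  have "e2 X T = F"
    unfolding e2_def lam_def[of X]
  proof (rule coll_eqI)
    fix p
    show "p \<in>\<^sub>M F \<longleftrightarrow> (\<exists>x. x \<in>\<^sub>M X \<and> p = pair x (?ev x))"
    proof
      assume p: "p \<in>\<^sub>M F"
      then obtain x v where xv: "p = pair x v" using is_fun_memD[OF F_fun] by blast
      then have "x \<in>\<^sub>M X" "v = ?ev x" using p F R_iff by blast+
      then show "\<exists>x. x \<in>\<^sub>M X \<and> p = pair x (?ev x)" using xv by blast
    next
      assume "\<exists>x. x \<in>\<^sub>M X \<and> p = pair x (?ev x)"
      then obtain x where x: "x \<in>\<^sub>M X" "p = pair x (?ev x)" by blast
      then show "p \<in>\<^sub>M F" using F R_iff[OF x(1)] evaluation(1)[OF x(1)] mem_funs by blast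
    qed
  qed
  then show "is_fun (e2 X T) X (funs (C2 X T) two)"
    and "pair x v \<in>\<^sub>M e2 X T \<longleftrightarrow> x \<in>\<^sub>M X \<and> ?R x v"
    using F_fun F mem_funs by blast+
qed

lemma ultra_value_unique:
  assumes p: "CO_ultrafilter X T p" and f: "f \<in>\<^sub>M C2 X T"
    and y: "preimage f (upair y y) \<in>\<^sub>M p" and z: "preimage f (upair z z) \<in>\<^sub>M p"
  shows "y = z"
proof -
  have "inter (preimage f (upair y y)) (preimage f (upair z z)) \<noteq> empty"
    using ultra_inter[OF p y z] ultra_empty[OF p] by metis
  then obtain x where "pair x y \<in>\<^sub>M f" "pair x z \<in>\<^sub>M f" using nonempty_ex by force
  then show ?thesis using is_fun_unique[OF C2_fun[OF f]] by blast
qed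

text \<open>
An ultrafilter assigns to \<open>f\<close> the value \<open>y\<close> with \<open>f\<^sup>-\<^sup>1{y}\<close> in \<open>p\<close>; for finitely many \<open>f\<close> these values are
attained simultaneously on a member of \<open>p\<close>. For a principal ultrafilter this gives continuity of
the evaluation map, in general that every ultrafilter is realized in the closure of its image.
\<close>

lemma ultra_finite_values:
  assumes p: "CO_ultrafilter X T p" and N: "is_finite N" "N \<subseteq>\<^sub>M C2 X T"
  shows "\<exists>A. A \<in>\<^sub>M p \<and> (\<forall>x f y. x \<in>\<^sub>M A \<and> f \<in>\<^sub>M N \<and> preimage f (upair y y) \<in>\<^sub>M p \<longrightarrow> pair x y \<in>\<^sub>M f)"
proof -
  let ?P = "\<lambda>N. N \<subseteq>\<^sub>M C2 X T \<longrightarrow> (\<exists>A. A \<in>\<^sub>M p \<and>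
    (\<forall>x f y. x \<in>\<^sub>M A \<and> f \<in>\<^sub>M N \<and> preimage f (upair y y) \<in>\<^sub>M p \<longrightarrow> pair x y \<in>\<^sub>M f))"
  have "?P N"
  proof (rule finite_induct_definable[OF _ N(1), of ?P])
    show "definable (\<lambda>e. ?P (e 0))" by (intro definable_intros)
    have "\<exists>A. A \<in>\<^sub>M p" using p nonempty_ex unfolding CO_ultrafilter_def CO_filter_def by blast
    then show "?P empty" by auto
    fix f N assume IH: "?P N"
    show "?P (ins f N)"
    proof
      assume sub: "ins f N \<subseteq>\<^sub>M C2 X T"
      then have fC: "f \<in>\<^sub>M C2 X T" and NC: "N \<subseteq>\<^sub>M C2 X T" unfolding sub_def mem_ins by blast+
      obtain A where A: "A \<in>\<^sub>M p"
        "\<And>x g y. x \<in>\<^sub>M A \<Longrightarrow> g \<in>\<^sub>M N \<Longrightarrow> preimage g (upair y y) \<in>\<^sub>M p \<Longrightarrow> pair x y \<in>\<^sub>M g"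
        using IH NC by blast
      have "\<exists>B. B \<in>\<^sub>M p \<and> (\<forall>x y. x \<in>\<^sub>M B \<and> preimage f (upair y y) \<in>\<^sub>M p \<longrightarrow> pair x y \<in>\<^sub>M f)"
      proof (cases "\<exists>y. preimage f (upair y y) \<in>\<^sub>M p")
        case True
        then obtain y where y: "preimage f (upair y y) \<in>\<^sub>M p" by blast
        have "z = y" if "preimage f (upair z z) \<in>\<^sub>M p" for z
          using ultra_value_unique[OF p fC that y] .
        moreover have "pair x y \<in>\<^sub>M f" if "x \<in>\<^sub>M preimage f (upair y y)" for x using that by auto
        ultimately show ?thesis using y by blast
      qed (use A(1) in blast)
      then obtain B where B: "B \<in>\<^sub>M p"
        "\<And>x y. x \<in>\<^sub>M B \<Longrightarrow> preimage f (upair y y) \<in>\<^sub>M p \<Longrightarrow> pair x y \<in>\<^sub>M f" by blast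
      have "\<forall>x g y. x \<in>\<^sub>M inter A B \<and> g \<in>\<^sub>M ins f N \<and> preimage g (upair y y) \<in>\<^sub>M p \<longrightarrow> pair x y \<in>\<^sub>M g"
        using A(2) B(2) unfolding mem_inter mem_ins by blast
      then show "\<exists>A. A \<in>\<^sub>M p \<and> (\<forall>x g y. x \<in>\<^sub>M A \<and> g \<in>\<^sub>M ins f N \<and> preimage g (upair y y) \<in>\<^sub>M p \<longrightarrow>
          pair x y \<in>\<^sub>M g)" using ultra_inter[OF p A(1) B(1)] by blast
    qed
  qed
  then show ?thesis using N(2) by blast
qed

abbreviation cube_top :: 'v where
  "cube_top \<equiv> power_top (C2 X T) two (pow two)"

lemma e2_carrier_sub: "e2_carrier X T \<subseteq>\<^sub>M funs (C2 X T) two"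
  unfolding e2_carrier_def by (simp add: sub_def mem_closure)

lemma e2_open_nhd:
  assumes "U \<in>\<^sub>M e2_top X T" "q \<in>\<^sub>M U"
  obtains N where "is_finite N" "N \<subseteq>\<^sub>M C2 X T"
    "\<And>r. r \<in>\<^sub>M e2_carrier X T \<Longrightarrow> agree N q r \<Longrightarrow> r \<in>\<^sub>M U"
proof -
  obtain U' where U': "U' \<in>\<^sub>M cube_top" "U = inter U' (e2_carrier X T)"
    using assms(1) unfolding e2_top_def mem_subtop by blast
  then have "q \<in>\<^sub>M U'" using assms(2) by simp
  then obtain N where N: "is_finite N" "N \<subseteq>\<^sub>M C2 X T"
    "\<And>r. is_fun r (C2 X T) two \<Longrightarrow> agree N q r \<Longrightarrow> r \<in>\<^sub>M U'"
    using U'(1) unfolding mem_power_top_discrete by blast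
  have "r \<in>\<^sub>M U" if "r \<in>\<^sub>M e2_carrier X T" "agree N q r" for r
    using N(3)[of r] that mem_sub[OF e2_carrier_sub that(1)] U'(2) by simp
  then show thesis using that N(1,2) by blast
qed

lemma e2_clopen:
  assumes N: "is_finite N" "N \<subseteq>\<^sub>M C2 X T" and P: "definable (\<lambda>e. P (e 0))"
    and det: "\<And>q r. P q \<Longrightarrow> is_fun q (C2 X T) two \<Longrightarrow> is_fun r (C2 X T) two \<Longrightarrow> agree N q r \<Longrightarrow> P r"
  obtains V where "V \<in>\<^sub>M CO (e2_carrier X T) (e2_top X T)"
    "\<And>q. q \<in>\<^sub>M V \<longleftrightarrow> q \<in>\<^sub>M e2_carrier X T \<and> P q"
proof -
  obtain Z where Z: "\<And>q. q \<in>\<^sub>M Z \<longleftrightarrow> q \<in>\<^sub>M funs (C2 X T) two \<and> P q"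
    using separation_definable[OF P, of "funs (C2 X T) two"] by blast
  have "Z \<in>\<^sub>M CO (funs (C2 X T) two) cube_top"
    by (rule finitely_determined_clopen[OF _ N])
      (use Z det in \<open>unfold sub_def mem_funs, blast+\<close>)
  then have "inter Z (e2_carrier X T) \<in>\<^sub>M CO (e2_carrier X T) (e2_top X T)"
    unfolding e2_top_def using CO_subtop e2_carrier_sub by blast
  moreover have "q \<in>\<^sub>M inter Z (e2_carrier X T) \<longleftrightarrow> q \<in>\<^sub>M e2_carrier X T \<and> P q" for q
    using Z mem_sub[OF e2_carrier_sub, of q] unfolding mem_inter by blast
  ultimately show thesis using that by blast
qed

lemma e2_value_clopen:
  assumes "f \<in>\<^sub>M C2 X T"
  obtains V where "V \<in>\<^sub>M CO (e2_carrier X T) (e2_top X T)"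
    "\<And>q. q \<in>\<^sub>M V \<longleftrightarrow> q \<in>\<^sub>M e2_carrier X T \<and> pair f y \<in>\<^sub>M q"
proof (rule e2_clopen[of "ins f empty" "\<lambda>q. pair f y \<in>\<^sub>M q"])
  show "is_finite (ins f empty)" using is_finite_ins[OF is_finite_empty] .
  show "ins f empty \<subseteq>\<^sub>M C2 X T" using assms by (simp add: sub_def)
  show "definable (\<lambda>e. pair f y \<in>\<^sub>M e 0)" by (intro definable_intros)
qed (auto simp: agree_def intro: that)

lemma top_space_e2: "top_space (e2_carrier X T) (e2_top X T)"
  unfolding e2_top_def by (rule top_space_subtop[OF top_space_power_discrete e2_carrier_sub])

lemma e2_fun_carrier: "is_fun (e2 X T) X (e2_carrier X T)"
proof (rule is_funI)
  fix p assume p: "p \<in>\<^sub>M e2 X T"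
  then obtain x v where xv: "p = pair x v" "x \<in>\<^sub>M X" "v \<in>\<^sub>M funs (C2 X T) two"
    using is_fun_memD[OF e2_fun] by blast
  then have "v \<in>\<^sub>M image (e2 X T) X" using p by auto
  then have "v \<in>\<^sub>M e2_carrier X T" unfolding e2_carrier_def mem_closure using xv(3) by blast
  then show "\<exists>x v. p = pair x v \<and> x \<in>\<^sub>M X \<and> v \<in>\<^sub>M e2_carrier X T" using xv by blast
qed (use is_fun_ex[OF e2_fun] is_fun_unique[OF e2_fun] in blast)+

lemma e2_characteristic:
  assumes A: "A \<in>\<^sub>M CO X T"
    and f: "\<And>x y. pair x y \<in>\<^sub>M f \<longleftrightarrow> x \<in>\<^sub>M X \<and> (y = one \<and> x \<in>\<^sub>M A \<or> y = empty \<and> \<not> x \<in>\<^sub>M A)"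
    and fC: "f \<in>\<^sub>M C2 X T"
    and V: "\<And>q. q \<in>\<^sub>M V \<longleftrightarrow> q \<in>\<^sub>M e2_carrier X T \<and> pair f one \<in>\<^sub>M q"
  shows "preimage (e2 X T) V = A"
proof (rule eqI)
  fix x assume "x \<in>\<^sub>M preimage (e2 X T) V"
  then obtain v where "pair f one \<in>\<^sub>M v" "pair x v \<in>\<^sub>M e2 X T" using V by auto
  then have "pair x one \<in>\<^sub>M f" unfolding pair_mem_e2 by blast
  then show "x \<in>\<^sub>M A" using f empty_neq_one by metis
next
  fix x assume x: "x \<in>\<^sub>M A"
  then have xX: "x \<in>\<^sub>M X" using mem_sub[OF clopen_sub[OF A]] by blast
  then obtain v where v: "v \<in>\<^sub>M e2_carrier X T" "pair x v \<in>\<^sub>M e2 X T"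
    using is_fun_ex[OF e2_fun_carrier] by blast
  have "pair x one \<in>\<^sub>M f" using f x xX by blast
  then have "pair f one \<in>\<^sub>M v" using v(2) fC unfolding pair_mem_e2 by blast
  then show "x \<in>\<^sub>M preimage (e2 X T) V" using V v by auto
qed

lemma e2_lifting: "clopen_lifting mem X T (e2_carrier X T) (e2_top X T) (e2 X T)"
proof (unfold_locales)
  show "top_space (e2_carrier X T) (e2_top X T)" by (rule top_space_e2)
  have "preimage (e2 X T) U \<in>\<^sub>M T" if U: "U \<in>\<^sub>M e2_top X T" for U
  proof (rule openI[OF top])
    fix x assume "x \<in>\<^sub>M preimage (e2 X T) U"
    then obtain v where v: "v \<in>\<^sub>M U" "pair x v \<in>\<^sub>M e2 X T" by auto
    then have x: "x \<in>\<^sub>M X" using is_fun_pairD[OF e2_fun] by blast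
    obtain N where N: "is_finite N" "N \<subseteq>\<^sub>M C2 X T"
      "\<And>r. r \<in>\<^sub>M e2_carrier X T \<Longrightarrow> agree N v r \<Longrightarrow> r \<in>\<^sub>M U" using e2_open_nhd[OF U v(1)] by blast
    obtain p where p: "CO_ultrafilter X T p" "\<And>A. A \<in>\<^sub>M p \<longleftrightarrow> A \<in>\<^sub>M CO X T \<and> x \<in>\<^sub>M A"
      using ex_principal[OF x] by blast
    obtain A where A: "A \<in>\<^sub>M p"
      "\<And>z f y. z \<in>\<^sub>M A \<Longrightarrow> f \<in>\<^sub>M N \<Longrightarrow> preimage f (upair y y) \<in>\<^sub>M p \<Longrightarrow> pair z y \<in>\<^sub>M f"
      using ultra_finite_values[OF p(1) N(1,2)] by blast
    have co: "A \<in>\<^sub>M CO X T" "x \<in>\<^sub>M A" using A(1) p(2) by blast+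
    have "A \<subseteq>\<^sub>M preimage (e2 X T) U"
    proof (rule subI)
      fix z assume z: "z \<in>\<^sub>M A"
      then have "z \<in>\<^sub>M X" using mem_sub[OF clopen_sub[OF co(1)]] by blast
      then obtain w where w: "w \<in>\<^sub>M e2_carrier X T" "pair z w \<in>\<^sub>M e2 X T"
        using is_fun_ex[OF e2_fun_carrier] by blast
      have "agree N v w"
        unfolding agree_def
      proof (intro allI impI, elim conjE)
        fix f y assume f: "f \<in>\<^sub>M N" "pair f y \<in>\<^sub>M v"
        then have fx: "f \<in>\<^sub>M C2 X T" "pair x y \<in>\<^sub>M f" using v(2) unfolding pair_mem_e2 by blast+
        then have "y \<in>\<^sub>M two" using is_fun_pairD[OF C2_fun] by blast
        then have "preimage f (upair y y) \<in>\<^sub>M CO X T"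
          by (intro C2_preimage_clopen[OF fx(1)]) (auto simp: sub_def)
        then have "preimage f (upair y y) \<in>\<^sub>M p" using p(2) fx(2) by auto
        then have "pair z y \<in>\<^sub>M f" using A(2)[OF z f(1)] by blast
        then show "pair f y \<in>\<^sub>M w" using w(2) fx(1) unfolding pair_mem_e2 by blast
      qed
      then have "w \<in>\<^sub>M U" using N(3) w(1) by blast
      then show "z \<in>\<^sub>M preimage (e2 X T) U" using w(2) by auto
    qed
    then show "\<exists>V. V \<in>\<^sub>M T \<and> x \<in>\<^sub>M V \<and> V \<subseteq>\<^sub>M preimage (e2 X T) U" using co unfolding mem_CO by blast
  qed
  then show "continuous X T (e2_carrier X T) (e2_top X T) (e2 X T)"
    unfolding continuous_def using e2_fun_carrier by blast
  show "\<exists>x. x \<in>\<^sub>M preimage (e2 X T) U" if U: "U \<in>\<^sub>M e2_top X T" "q \<in>\<^sub>M U" for U q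
  proof -
    obtain U' where U': "U' \<in>\<^sub>M cube_top" "U = inter U' (e2_carrier X T)"
      using U(1) unfolding e2_top_def mem_subtop by blast
    then have "q \<in>\<^sub>M e2_carrier X T" "q \<in>\<^sub>M U'" using U(2) by auto
    then obtain v where v: "v \<in>\<^sub>M image (e2 X T) X" "v \<in>\<^sub>M U'"
      using U'(1) unfolding e2_carrier_def mem_closure by blast
    then obtain x where x: "pair x v \<in>\<^sub>M e2 X T" by auto
    then have "v \<in>\<^sub>M U" using v(2) U'(2) is_fun_pairD[OF e2_fun_carrier] by auto
    then show ?thesis using x by auto
  qed
  show "\<exists>V. V \<in>\<^sub>M CO (e2_carrier X T) (e2_top X T) \<and> preimage (e2 X T) V = A"
    if A: "A \<in>\<^sub>M CO X T" for A
  proof -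
    obtain f where f: "f \<in>\<^sub>M C2 X T"
      "\<And>x y. pair x y \<in>\<^sub>M f \<longleftrightarrow> x \<in>\<^sub>M X \<and> (y = one \<and> x \<in>\<^sub>M A \<or> y = empty \<and> \<not> x \<in>\<^sub>M A)"
      by (rule ex_characteristic[OF A]) blast
    obtain V where V: "V \<in>\<^sub>M CO (e2_carrier X T) (e2_top X T)"
      "\<And>q. q \<in>\<^sub>M V \<longleftrightarrow> q \<in>\<^sub>M e2_carrier X T \<and> pair f one \<in>\<^sub>M q"
      using e2_value_clopen[OF f(1), of one] by blast
    show ?thesis using V(1) e2_characteristic[OF A f(2,1) V(2)] by blast
  qed
qed

sublocale e2: clopen_lifting mem X T "e2_carrier X T" "e2_top X T" "e2 X T"
  by (rule e2_lifting)

lemma e2_base: "is_base (CO (e2_carrier X T) (e2_top X T)) (e2_top X T)"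
proof (rule is_baseI)
  show "CO (e2_carrier X T) (e2_top X T) \<subseteq>\<^sub>M e2_top X T" by (simp add: sub_def mem_CO)
  fix U q assume U: "U \<in>\<^sub>M e2_top X T" "q \<in>\<^sub>M U"
  obtain N where N: "is_finite N" "N \<subseteq>\<^sub>M C2 X T"
    "\<And>r. r \<in>\<^sub>M e2_carrier X T \<Longrightarrow> agree N q r \<Longrightarrow> r \<in>\<^sub>M U" using e2_open_nhd[OF U] by blast
  have P: "definable (\<lambda>e. agree N q (e 0))" by (intro definable_intros)
  obtain V where "V \<in>\<^sub>M CO (e2_carrier X T) (e2_top X T)"
    "\<And>r. r \<in>\<^sub>M V \<longleftrightarrow> r \<in>\<^sub>M e2_carrier X T \<and> agree N q r"
    by (rule e2_clopen[OF N(1,2), of "agree N q", OF P]) (auto simp: agree_def)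
  moreover have "q \<in>\<^sub>M e2_carrier X T" using mem_sub[OF open_sub[OF top_space_e2 U(1)] U(2)] .
  moreover have "agree N q q" by (simp add: agree_def)
  ultimately show "\<exists>V. V \<in>\<^sub>M CO (e2_carrier X T) (e2_top X T) \<and> q \<in>\<^sub>M V \<and> V \<subseteq>\<^sub>M U"
    using N(3) unfolding sub_def by blast
qed

lemma e2_zero_dim_T1: "zero_dim_T1_space (e2_carrier X T) (e2_top X T)"
  unfolding zero_dim_T1_space_def T1_def
proof (intro conjI allI impI top_space_e2 e2_base)
  fix q r assume qr: "q \<in>\<^sub>M e2_carrier X T \<and> r \<in>\<^sub>M e2_carrier X T \<and> q \<noteq> r"
  then have funs: "is_fun q (C2 X T) two" "is_fun r (C2 X T) two"
    using mem_sub[OF e2_carrier_sub] by auto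
  then obtain f y where fy: "pair f y \<in>\<^sub>M q" "\<not> pair f y \<in>\<^sub>M r"
    using is_fun_eqI qr by blast
  then have "f \<in>\<^sub>M C2 X T" using is_fun_pairD[OF funs(1)] by blast
  then obtain V where "V \<in>\<^sub>M CO (e2_carrier X T) (e2_top X T)"
    "\<And>q. q \<in>\<^sub>M V \<longleftrightarrow> q \<in>\<^sub>M e2_carrier X T \<and> pair f y \<in>\<^sub>M q"
    using e2_value_clopen[of f y] by blast
  then show "\<exists>U. U \<in>\<^sub>M e2_top X T \<and> q \<in>\<^sub>M U \<and> \<not> r \<in>\<^sub>M U" using fy qr unfolding mem_CO by blast
qed

text \<open>
The ultrafilter \<open>p\<close> is realized by its function of values, \<open>f \<mapsto> y\<close> with \<open>f\<^sup>-\<^sup>1{y} \<in> p\<close>. Finitely many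
of these values are attained at a common point of \<open>X\<close>, so the function lies in the closure of the
image of \<open>X\<close>.
\<close>

lemma e2_realize:
  assumes p: "CO_ultrafilter X T p"
  shows "\<exists>q. q \<in>\<^sub>M e2_carrier X T \<and> (\<forall>A. A \<in>\<^sub>M p \<longrightarrow>
    (\<exists>V. V \<in>\<^sub>M CO (e2_carrier X T) (e2_top X T) \<and> preimage (e2 X T) V = A \<and> q \<in>\<^sub>M V))"
proof -
  let ?R = "\<lambda>f y. preimage f (upair y y) \<in>\<^sub>M p"
  have R: "definable (\<lambda>e. ?R (e 0) (e (Suc 0)))" by (intro definable_intros)
  have exR: "\<exists>y. y \<in>\<^sub>M two \<and> ?R f y" if f: "f \<in>\<^sub>M C2 X T" for f
  proof -
    have "preimage f (upair one one) \<in>\<^sub>M CO X T"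
      by (rule C2_preimage_clopen[OF f]) (simp add: sub_def)
    moreover have "diff two (upair one one) = upair empty empty" by (subst ext_iff) auto
    then have "diff X (preimage f (upair one one)) = preimage f (upair empty empty)"
      using preimage_diff[OF C2_fun[OF f], of "upair one one"] by simp
    ultimately have "?R f one \<or> ?R f empty" using ultra_prime[OF p] by metis
    then show ?thesis by auto
  qed
  have uniqueR: "y = z" if "f \<in>\<^sub>M C2 X T" "y \<in>\<^sub>M two" "z \<in>\<^sub>M two" "?R f y" "?R f z" for f y z
    using ultra_value_unique[OF p that(1,4,5)] .
  obtain q where q_fun: "is_fun q (C2 X T) two"
    and q: "\<And>f y. pair f y \<in>\<^sub>M q \<longleftrightarrow> f \<in>\<^sub>M C2 X T \<and> y \<in>\<^sub>M two \<and> ?R f y"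
    by (rule ex_fun[of ?R "C2 X T" two, OF R exR uniqueR]) blast+
  have qY: "q \<in>\<^sub>M e2_carrier X T"
    unfolding e2_carrier_def mem_closure
  proof (intro conjI allI impI)
    show "q \<in>\<^sub>M funs (C2 X T) two" using q_fun by simp
    fix U assume U: "U \<in>\<^sub>M cube_top \<and> q \<in>\<^sub>M U"
    then obtain N where N: "is_finite N" "N \<subseteq>\<^sub>M C2 X T"
      "\<And>r. is_fun r (C2 X T) two \<Longrightarrow> agree N q r \<Longrightarrow> r \<in>\<^sub>M U"
      unfolding mem_power_top_discrete by blast
    obtain A where A: "A \<in>\<^sub>M p"
      "\<And>z f y. z \<in>\<^sub>M A \<Longrightarrow> f \<in>\<^sub>M N \<Longrightarrow> preimage f (upair y y) \<in>\<^sub>M p \<Longrightarrow> pair z y \<in>\<^sub>M f"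
      using ultra_finite_values[OF p N(1,2)] by blast
    have "A \<noteq> empty" using A(1) ultra_empty[OF p] by blast
    then obtain x where x: "x \<in>\<^sub>M A" using nonempty_ex by blast
    then have "x \<in>\<^sub>M X" using mem_sub[OF clopen_sub[OF ultra_sub[OF p A(1)]]] by blast
    then obtain v where v: "is_fun v (C2 X T) two" "pair x v \<in>\<^sub>M e2 X T"
      using is_fun_ex[OF e2_fun] mem_funs by blast
    have "agree N q v"
      unfolding agree_def using q A(2)[OF x] v(2) unfolding pair_mem_e2 by blast
    then have "v \<in>\<^sub>M U" using N(3) v(1) by blast
    moreover have "v \<in>\<^sub>M image (e2 X T) X" using v(2) \<open>x \<in>\<^sub>M X\<close> by auto
    ultimately show "\<exists>a. a \<in>\<^sub>M image (e2 X T) X \<and> a \<in>\<^sub>M U" by blast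
  qed
  have "\<exists>V. V \<in>\<^sub>M CO (e2_carrier X T) (e2_top X T) \<and> preimage (e2 X T) V = A \<and> q \<in>\<^sub>M V"
    if A: "A \<in>\<^sub>M p" for A
  proof -
    have co: "A \<in>\<^sub>M CO X T" using ultra_sub[OF p A] .
    obtain f where f: "f \<in>\<^sub>M C2 X T"
      "\<And>x y. pair x y \<in>\<^sub>M f \<longleftrightarrow> x \<in>\<^sub>M X \<and> (y = one \<and> x \<in>\<^sub>M A \<or> y = empty \<and> \<not> x \<in>\<^sub>M A)"
      by (rule ex_characteristic[OF co]) blast
    obtain V where V: "V \<in>\<^sub>M CO (e2_carrier X T) (e2_top X T)"
      "\<And>q. q \<in>\<^sub>M V \<longleftrightarrow> q \<in>\<^sub>M e2_carrier X T \<and> pair f one \<in>\<^sub>M q"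
      using e2_value_clopen[OF f(1), of one] by blast
    have "preimage f (upair one one) = A"
      using f(2) clopen_sub[OF co] by (subst ext_iff) (auto simp: sub_def dest: sym)
    then have "pair f one \<in>\<^sub>M q" using q f(1) A by simp
    then show ?thesis using V e2_characteristic[OF co f(2,1) V(2)] qY by blast
  qed
  then show ?thesis using qY by blast
qed

theorem e2_compact_iff: "compact (e2_carrier X T) (e2_top X T) \<longleftrightarrow> ultrafilter_existence"
  using e2.compact_imp_ultrafilter_existence
    e2.ultrafilter_existence_imp_compact[OF e2_base e2_realize] by blast

end

section \<open>Two-valued maps as real-valued maps\<close>

context ZF
begin

lemma zero_dim_T1_discrete: "zero_dim_T1_space Y (pow Y)"
  unfolding zero_dim_T1_space_def T1_def
proof (intro conjI allI impI top_space_discrete is_baseI)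
  show "CO Y (pow Y) \<subseteq>\<^sub>M pow Y" by (auto simp: sub_def mem_CO)
  show "\<exists>V. V \<in>\<^sub>M CO Y (pow Y) \<and> x \<in>\<^sub>M V \<and> V \<subseteq>\<^sub>M U" if "U \<in>\<^sub>M pow Y" "x \<in>\<^sub>M U" for U x
    using that by (intro exI[of _ U]) (auto simp: mem_CO sub_def)
  show "\<exists>U. U \<in>\<^sub>M pow Y \<and> x \<in>\<^sub>M U \<and> \<not> y \<in>\<^sub>M U" if "x \<in>\<^sub>M Y \<and> y \<in>\<^sub>M Y \<and> x \<noteq> y" for x y
    using that by (intro exI[of _ "upair x x"]) (auto simp: sub_def)
qed

lemma finite_imp_compact:
  assumes "is_finite Y" shows "compact Y S"
  unfolding compact_def
proof (intro allI impI, elim conjE)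
  fix G assume G: "G \<subseteq>\<^sub>M S" "union G = Y"
  let ?R = "\<lambda>y U. U \<in>\<^sub>M G \<and> y \<in>\<^sub>M U"
  have R: "definable (\<lambda>e. ?R (e 0) (e (Suc 0)))" by (intro definable_intros)
  have exR: "\<exists>U. ?R y U" if "y \<in>\<^sub>M Y" for y using that unfolding G(2)[symmetric] mem_union .
  obtain F where F: "is_finite F" "\<And>y. y \<in>\<^sub>M Y \<Longrightarrow> \<exists>U. U \<in>\<^sub>M F \<and> ?R y U"
    "\<And>U. U \<in>\<^sub>M F \<Longrightarrow> \<exists>y. y \<in>\<^sub>M Y \<and> ?R y U"
    by (rule finite_collection[of ?R, OF R assms exR]) blast+
  have FG: "F \<subseteq>\<^sub>M G" using F(3) unfolding sub_def by blast
  moreover have "union F = Y"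
  proof (rule eqI)
    fix y assume "y \<in>\<^sub>M union F"
    then show "y \<in>\<^sub>M Y" using FG unfolding G(2)[symmetric] sub_def mem_union by blast
  qed (use F(2) in \<open>unfold mem_union, blast\<close>)
  ultimately show "\<exists>F. F \<subseteq>\<^sub>M G \<and> is_finite F \<and> union F = Y" using F(1) by blast
qed

lemma compact_two: "compact two (pow two)"
proof (rule finite_imp_compact)
  have "two = ins empty (ins one empty)" by (subst ext_iff) auto
  then show "is_finite two" using is_finite_ins is_finite_empty by simp
qed

lemma mem_two_to_real [simp]:
  "pair x y \<in>\<^sub>M two_to_real z u \<longleftrightarrow> x = empty \<and> y = z \<or> x = one \<and> y = u"
  by (simp add: two_to_real_def)

lemma two_to_real_continuous:
  assumes "z \<in>\<^sub>M R" "u \<in>\<^sub>M R"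
  shows "continuous two (pow two) R S (two_to_real z u)"
proof -
  have "is_fun (two_to_real z u) two R"
  proof (rule is_funI)
    fix p assume "p \<in>\<^sub>M two_to_real z u"
    then have "p = pair empty z \<or> p = pair one u" by (simp add: two_to_real_def)
    then show "\<exists>x y. p = pair x y \<and> x \<in>\<^sub>M two \<and> y \<in>\<^sub>M R" using assms by force
  qed (auto simp: empty_neq_one[symmetric])
  then show ?thesis unfolding continuous_def by (auto simp: sub_def)
qed

lemma mem_C_alpha: "f \<in>\<^sub>M C_alpha R l X T Y S h \<longleftrightarrow> continuous X T R (real_top R l) f \<and>
    (\<exists>g. continuous Y S R (real_top R l) g \<and> comp g h = f)"
  unfolding C_alpha_def mem_Cont
  by (rule mem_coll[where a = "Cont X T R (real_top R l)"]) (intro definable_intros, simp)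

end

locale real_line = ZF mem
  for mem :: "'v \<Rightarrow> 'v \<Rightarrow> bool"  (infix "\<in>\<^sub>M" 50) +
  fixes R p m z u l :: 'v
  assumes real: "real_field R p m z u l"
begin

abbreviation add :: "'v \<Rightarrow> 'v \<Rightarrow> 'v" where "add x y \<equiv> app p (pair x y)"
abbreviation le :: "'v \<Rightarrow> 'v \<Rightarrow> bool" where "le x y \<equiv> pair x y \<in>\<^sub>M l"

lemma zero_R: "z \<in>\<^sub>M R" and one_R: "u \<in>\<^sub>M R" and zero_neq_one: "z \<noteq> u"
  and add_fun: "is_fun p (cart R R) R" and l_sub: "l \<subseteq>\<^sub>M cart R R"
  using real unfolding real_field_def Let_def by blast+

lemma
  assumes "a \<in>\<^sub>M R" "b \<in>\<^sub>M R" "c \<in>\<^sub>M R"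
  shows add_assoc: "add (add a b) c = add a (add b c)" and add_comm: "add a b = add b a"
    and add_zero: "add z a = a" and add_inverse: "\<exists>d. d \<in>\<^sub>M R \<and> add a d = z"
    and le_total: "le a b \<or> le b a" and le_antisym: "le a b \<Longrightarrow> le b a \<Longrightarrow> a = b"
    and add_mono: "le a b \<Longrightarrow> le (add a c) (add b c)"
  using real assms unfolding real_field_def Let_def by blast+

lemma add_R:
  assumes "a \<in>\<^sub>M R" "b \<in>\<^sub>M R" shows "add a b \<in>\<^sub>M R"
proof -
  have "pair a b \<in>\<^sub>M cart R R" using assms by simp
  then obtain c where "c \<in>\<^sub>M R" "pair (pair a b) c \<in>\<^sub>M p" using is_fun_ex[OF add_fun] by blast
  then show ?thesis using app_eq[OF add_fun] by metis
qed

lemma add_eq_imp_zero: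
  assumes "a \<in>\<^sub>M R" "b \<in>\<^sub>M R" "add a b = b" shows "a = z"
proof -
  obtain d where d: "d \<in>\<^sub>M R" "add b d = z" using add_inverse assms by blast
  have "a = add a z" using add_comm[OF assms(1) zero_R zero_R] add_zero[OF assms(1,1,1)] by simp
  also have "\<dots> = add (add a b) d" using add_assoc[OF assms(1,2) d(1)] d(2) by simp
  also have "\<dots> = z" using assms(3) d(2) by simp
  finally show ?thesis .
qed

text \<open>
Adding \<open>u\<close> to \<open>x\<close> and adding its negative \<open>d\<close> move \<open>x\<close> in opposite directions. Which of the two goes
up depends on the order of \<open>z\<close> and \<open>u\<close>, and either case provides both neighbours.
\<close>

lemma ex_between:
  assumes x: "x \<in>\<^sub>M R"
  obtains a b where "a \<in>\<^sub>M R" "b \<in>\<^sub>M R" "le a x" "a \<noteq> x" "le x b" "b \<noteq> x"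
proof -
  obtain d where d: "d \<in>\<^sub>M R" "add u d = z" using add_inverse one_R by blast
  have "d \<noteq> z"
    using d add_comm[OF one_R d(1) d(1)] add_zero[OF one_R one_R one_R] zero_neq_one by auto
  then have dx: "add d x \<in>\<^sub>M R" "add d x \<noteq> x"
    using add_R add_eq_imp_zero d(1) x by blast+
  have ux: "add u x \<in>\<^sub>M R" "add u x \<noteq> x"
    using add_R add_eq_imp_zero one_R x zero_neq_one by metis+
  have zx: "add z x = x" "add z d = d" using add_zero[OF x x x] add_zero[OF d(1,1,1)] .
  have "le z u \<or> le u z" using le_total[OF zero_R one_R one_R] .
  then show thesis
  proof
    assume "le z u"
    then have "le x (add u x)" "le d z"
      using add_mono[OF zero_R one_R x] add_mono[OF zero_R one_R d(1)] zx d(2) by simp_all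
    moreover from this have "le (add d x) x" using add_mono[OF d(1) zero_R x] zx by simp
    ultimately show thesis using that dx ux by blast
  next
    assume "le u z"
    then have "le (add u x) x" "le z d"
      using add_mono[OF one_R zero_R x] add_mono[OF one_R zero_R d(1)] zx d(2) by simp_all
    moreover from this have "le x (add d x)" using add_mono[OF zero_R d(1) x] zx by simp
    ultimately show thesis using that dx ux by blast
  qed
qed

lemma mem_real_top: "U \<in>\<^sub>M real_top R l \<longleftrightarrow> U \<subseteq>\<^sub>M R \<and> (\<forall>x. x \<in>\<^sub>M U \<longrightarrow>
    (\<exists>a b. a \<in>\<^sub>M R \<and> b \<in>\<^sub>M R \<and> (le a x \<and> a \<noteq> x) \<and> (le x b \<and> x \<noteq> b) \<and>
      (\<forall>y. y \<in>\<^sub>M R \<and> (le a y \<and> a \<noteq> y) \<and> (le y b \<and> y \<noteq> b) \<longrightarrow> y \<in>\<^sub>M U)))"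
  unfolding real_top_def Let_def
  by (rule mem_coll[where a = "pow R"]) (intro definable_intros, simp)

text \<open>
The intervals that witness openness end at \<open>c\<close> on the side of \<open>c\<close>.
\<close>

lemma punctured_line_open:
  assumes c: "c \<in>\<^sub>M R" shows "diff R (upair c c) \<in>\<^sub>M real_top R l"
  unfolding mem_real_top
proof (intro conjI allI impI)
  show "diff R (upair c c) \<subseteq>\<^sub>M R" by (simp add: sub_def)
  fix x assume "x \<in>\<^sub>M diff R (upair c c)"
  then have x: "x \<in>\<^sub>M R" "x \<noteq> c" by auto
  obtain a b where ab: "a \<in>\<^sub>M R" "b \<in>\<^sub>M R" "le a x" "a \<noteq> x" "le x b" "b \<noteq> x"
    using ex_between[OF x(1)] by blast
  have "le c x \<or> le x c" using le_total[OF c x(1) x(1)] .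
  then show "\<exists>a b. a \<in>\<^sub>M R \<and> b \<in>\<^sub>M R \<and> (le a x \<and> a \<noteq> x) \<and> (le x b \<and> x \<noteq> b) \<and>
      (\<forall>y. y \<in>\<^sub>M R \<and> (le a y \<and> a \<noteq> y) \<and> (le y b \<and> y \<noteq> b) \<longrightarrow> y \<in>\<^sub>M diff R (upair c c))"
  proof
    assume "le c x"
    then show ?thesis using ab x c by (intro exI[of _ c] exI[of _ b]) auto
  next
    assume "le x c"
    then show ?thesis using ab x c by (intro exI[of _ a] exI[of _ c]) auto
  qed
qed

end

section \<open>The characterization\<close>

locale zero_dim_T1_real_line = zero_dim_T1 mem X T + real_line mem R p m z u l
  for mem :: "'v \<Rightarrow> 'v \<Rightarrow> bool"  (infix "\<in>\<^sub>M" 50) and X T R p m z u l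
begin

definition extends_two_valued :: "'v \<Rightarrow> 'v \<Rightarrow> 'v \<Rightarrow> bool" where
  "extends_two_valued Y S h \<longleftrightarrow> compactification X T Y S h \<and> hausdorff Y S \<and>
    (\<forall>f. f \<in>\<^sub>M C2 X T \<longrightarrow> comp (two_to_real z u) f \<in>\<^sub>M C_alpha R l X T Y S h)"

text \<open>
Two-valued maps extend as maps into the compact space \<open>2\<close>, and the inclusion of \<open>2\<close> in the real
line is composed afterwards.
\<close>

lemma banaschewski_extends_two_valued:
  assumes "banaschewski X T Y S h" shows "extends_two_valued Y S h"
  unfolding extends_two_valued_def
proof (intro conjI allI impI)
  show "compactification X T Y S h" "hausdorff Y S"
    using assms zero_dim_T1_imp_hausdorff unfolding banaschewski_def by blast+
  fix f assume f: "f \<in>\<^sub>M C2 X T"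
  then obtain g where g: "continuous Y S two (pow two) g" "comp g h = f"
    using assms zero_dim_T1_discrete compact_two unfolding banaschewski_def C2_def mem_Cont by blast
  have j: "continuous two (pow two) R (real_top R l) (two_to_real z u)"
    by (rule two_to_real_continuous[OF zero_R one_R])
  have "continuous X T R (real_top R l) (comp (two_to_real z u) f)"
    using continuous_comp[OF _ j] f by simp
  moreover have "continuous Y S R (real_top R l) (comp (two_to_real z u) g)"
    using continuous_comp[OF g(1) j] .
  moreover have "comp (comp (two_to_real z u) g) h = comp (two_to_real z u) f"
    unfolding comp_assoc g(2) ..
  ultimately show "comp (two_to_real z u) f \<in>\<^sub>M C_alpha R l X T Y S h"
    unfolding mem_C_alpha by blast
qed

text \<open>
Let \<open>g\<close> extend the characteristic function of \<open>A\<close>. The open set where \<open>g\<close> is neither 0 nor 1 misses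
the dense image of \<open>X\<close> and is therefore empty. So the open sets \<open>{g \<noteq> 0}\<close> and \<open>{g \<noteq> 1}\<close> are
complementary, and the first one lifts \<open>A\<close>.
\<close>

lemma extends_two_valued_lifting:
  assumes "extends_two_valued Y S h" shows "clopen_lifting mem X T Y S h"
proof -
  have topY: "top_space Y S" and h_fun: "is_fun h X Y"
    and h_cont: "continuous X T (image h X) (subtop S (image h X)) h"
    and dense: "closure Y S (image h X) = Y"
    and ext: "\<And>f. f \<in>\<^sub>M C2 X T \<Longrightarrow> comp (two_to_real z u) f \<in>\<^sub>M C_alpha R l X T Y S h"
    using assms unfolding extends_two_valued_def compactification_def extension_def embedding_def
      homeomorphism_def by blast+
  have dense': "\<exists>x. x \<in>\<^sub>M preimage h U" if U: "U \<in>\<^sub>M S" "y \<in>\<^sub>M U" for U y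
  proof -
    have "y \<in>\<^sub>M closure Y S (image h X)" unfolding dense using mem_sub[OF open_sub[OF topY U(1)] U(2)] .
    then obtain a where "a \<in>\<^sub>M image h X" "a \<in>\<^sub>M U" using U unfolding mem_closure by blast
    then show ?thesis by auto
  qed
  show ?thesis
  proof (unfold_locales)
    have "preimage h U \<in>\<^sub>M T" if U: "U \<in>\<^sub>M S" for U
    proof -
      have "inter U (image h X) \<in>\<^sub>M subtop S (image h X)" using U unfolding mem_subtop by blast
      then have "preimage h (inter U (image h X)) \<in>\<^sub>M T" using h_cont unfolding continuous_def by blast
      moreover have "preimage h (inter U (image h X)) = preimage h U"
        using is_fun_pairD[OF h_fun] by (subst ext_iff) auto
      ultimately show ?thesis by simp
    qed
    then show "continuous X T Y S h" unfolding continuous_def using h_fun by blast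
    show "\<exists>V. V \<in>\<^sub>M CO Y S \<and> preimage h V = A" if A: "A \<in>\<^sub>M CO X T" for A
    proof -
      obtain f where f: "f \<in>\<^sub>M C2 X T"
        "\<And>x y. pair x y \<in>\<^sub>M f \<longleftrightarrow> x \<in>\<^sub>M X \<and> (y = one \<and> x \<in>\<^sub>M A \<or> y = empty \<and> \<not> x \<in>\<^sub>M A)"
        by (rule ex_characteristic[OF A]) blast
      obtain g where g: "continuous Y S R (real_top R l) g" "comp g h = comp (two_to_real z u) f"
        using ext[OF f(1)] unfolding mem_C_alpha by blast
      then have g_fun: "is_fun g Y R" unfolding continuous_def by blast
      have gh: "c = (if x \<in>\<^sub>M A then u else z)" if xyc: "pair x y \<in>\<^sub>M h" "pair y c \<in>\<^sub>M g" for x y c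
      proof -
        have "pair x c \<in>\<^sub>M comp (two_to_real z u) f" unfolding g(2)[symmetric] using xyc by auto
        then show ?thesis using f(2) by (auto simp: empty_neq_one[symmetric])
      qed
      let ?V = "preimage g (diff R (upair z z))" and ?W = "preimage g (diff R (upair u u))"
      note open_sets = punctured_line_open[OF zero_R] punctured_line_open[OF one_R]
      have VS: "?V \<in>\<^sub>M S" "?W \<in>\<^sub>M S" using g(1) open_sets unfolding continuous_def by blast+
      have disj: "\<not> y \<in>\<^sub>M inter ?V ?W" for y
      proof
        assume "y \<in>\<^sub>M inter ?V ?W"
        then obtain x where "x \<in>\<^sub>M preimage h (inter ?V ?W)"
          using dense' open_inter[OF topY VS] by blast
        then obtain y' c d where y': "pair x y' \<in>\<^sub>M h" "pair y' c \<in>\<^sub>M g" "c \<noteq> z"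
          "pair y' d \<in>\<^sub>M g" "d \<noteq> u" by auto
        then show False using gh[OF y'(1,2)] gh[OF y'(1,4)] by (auto split: if_splits)
      qed
      have "diff Y ?V = ?W"
      proof (rule eqI)
        fix y assume y: "y \<in>\<^sub>M diff Y ?V"
        then obtain c where c: "c \<in>\<^sub>M R" "pair y c \<in>\<^sub>M g" using is_fun_ex[OF g_fun, of y] by auto
        then have "c = z" using y by auto
        then show "y \<in>\<^sub>M ?W" using c zero_neq_one by auto
      next
        fix y assume "y \<in>\<^sub>M ?W"
        moreover from this have "y \<in>\<^sub>M Y" using is_fun_pairD[OF g_fun] by auto
        ultimately show "y \<in>\<^sub>M diff Y ?V" using disj[of y] unfolding mem_inter mem_diff by blast
      qed
      then have "?V \<in>\<^sub>M CO Y S" using VS unfolding mem_CO by simp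
      moreover have "preimage h ?V = A"
      proof (rule eqI)
        fix x assume "x \<in>\<^sub>M preimage h ?V"
        then obtain y c where "pair x y \<in>\<^sub>M h" "pair y c \<in>\<^sub>M g" "c \<noteq> z" by auto
        then show "x \<in>\<^sub>M A" using gh by metis
      next
        fix x assume x: "x \<in>\<^sub>M A"
        then obtain y where y: "y \<in>\<^sub>M Y" "pair x y \<in>\<^sub>M h"
          using is_fun_ex[OF h_fun] mem_sub[OF clopen_sub[OF A]] by blast
        then obtain c where c: "c \<in>\<^sub>M R" "pair y c \<in>\<^sub>M g" using is_fun_ex[OF g_fun] by blast
        then have "c = u" using gh[OF y(2) c(2)] x by simp
        then have "y \<in>\<^sub>M ?V" using c zero_neq_one by auto
        then show "x \<in>\<^sub>M preimage h ?V" using y(2) by (simp only: mem_preimage[of x]) blast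
      qed
      ultimately show ?thesis by blast
    qed
  qed (use topY dense' in blast)+
qed

lemma extends_two_valued_imp_ultrafilter_existence:
  assumes "extends_two_valued Y S h" shows ultrafilter_existence
proof -
  interpret clopen_lifting mem X T Y S h by (rule extends_two_valued_lifting[OF assms])
  show ?thesis
    using assms compact_imp_ultrafilter_existence
    unfolding extends_two_valued_def compactification_def by blast
qed

lemma ultrafilter_existence_imp_banaschewski:
  assumes ultrafilter_existence
  shows "banaschewski X T (e2_carrier X T) (e2_top X T) (e2 X T)"
  using e2.banaschewskiI[OF e2_zero_dim_T1] e2_compact_iff assms by blast

lemma equivalences:
  shows "compact (e2_carrier X T) (e2_top X T) \<longleftrightarrow> (\<exists>Y S h. banaschewski X T Y S h)"
    and "(\<exists>Y S h. banaschewski X T Y S h) \<longleftrightarrow> (\<exists>Y S h. extends_two_valued Y S h)"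
    and "(\<exists>Y S h. extends_two_valued Y S h) \<longleftrightarrow> compact (wallman X T) (wallman_top X T)"
  using e2_compact_iff wallman_compact_iff ultrafilter_existence_imp_banaschewski
    banaschewski_extends_two_valued extends_two_valued_imp_ultrafilter_existence by metis+

end

theorem theorem2p1:
  fixes mem :: "'v \<Rightarrow> 'v \<Rightarrow> bool"
    and X T R add_R mul_R zero_R one_R le_R :: 'v
  assumes "ZF mem"
    and "set_structure.real_field mem R add_R mul_R zero_R one_R le_R"
    and "set_structure.zero_dim_T1_space mem X T"
  shows "let i = set_structure.compact mem
                   (set_structure.e2_carrier mem X T) (set_structure.e2_top mem X T);
             ii = (\<exists>Y S h. set_structure.banaschewski mem X T Y S h);
             iii = (\<exists>Y S h. set_structure.compactification mem X T Y S h
                     \<and> set_structure.hausdorff mem Y S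
                     \<and> (\<forall>f. mem f (set_structure.C2 mem X T) \<longrightarrow>
                          mem (set_structure.comp mem (set_structure.two_to_real mem zero_R one_R) f)
                              (set_structure.C_alpha mem R le_R X T Y S h)));
             iv = set_structure.compact mem
                   (set_structure.wallman mem X T) (set_structure.wallman_top mem X T)
         in (i \<longleftrightarrow> ii) \<and> (ii \<longleftrightarrow> iii) \<and> (iii \<longleftrightarrow> iv)"
proof -
  interpret zero_dim_T1_real_line mem X T R add_R mul_R zero_R one_R le_R
    using assms by (simp add: zero_dim_T1_real_line_def zero_dim_T1_def zero_dim_T1_axioms_def
        real_line_def real_line_axioms_def)
  show ?thesis
    unfolding Let_def using equivalences unfolding extends_two_valued_def by blast
qed

end
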